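(* There exists a data structure for the partial-sums problem on an array of $n$ integers, with word size $b$ bits and update arguments of $\delta$ bits, achieving $t_u=t_q=t_s=O\left(\frac{\lg n}{\lg(b/\delta)}\right)$, where $t_u,t_q,t_s$ are the running times of \texttt{update}, \texttt{sum} and \texttt{select}. The data structure runs on a Random Access Machine, is deterministic, and the bounds are worst-case.
   Context: Throughout, $\lg x$ denotes $\log_2(2+x)$. The partial-sums problem asks to maintain an array $A[1..n]$ of integers under: $\texttt{update}(k,\Delta)$, which sets $A[k]\gets\Delta$; $\texttt{sum}(k)$, which returns $\sum_{i=1}^k A[i]$; $\texttt{select}(\sigma)$, which returns the index $i$ with $\texttt{sum}(i-1)<\sigma\le\texttt{sum}(i)$ (for \texttt{select} it is required that $A[i]>0$ for all $i$). Every array element and partial sum fits in a $b$-bit word, $b=\Omega(\lg n)$, and $\delta\le b$ is the number of bits needed to represent an argument $\Delta$ of \texttt{update}. The RAM has $b$-bit words with standard word operations (addition, multiplication, bitwise boolean operations, shifts) in constant time.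
   Formalization: The bound proved is O(max(1, lg n / lg(b/δ))), since for fixed n and growing b/δ the quotient tends to 0 while an operation takes at least one step; b = Ω(lg n) is read as n < 2^b, and the array starts at zero. *)

theory Defs
  imports Complex_Main "HOL-Library.Landau_Symbols"
begin

definition lg :: "real \<Rightarrow> real" where
  "lg x = log 2 (2 + x)"


section \<open>The word RAM\<close>

text \<open>
  A word is a natural number below \<open>2 ^ b\<close>.  The type of words of the library fixes the length in
  the type, whereas here one program has to serve all word lengths, so words are plain numbers and
  every result is truncated to \<open>b\<close> bits.
\<close>

datatype alu = Add | Sub | Mul | And | Or | Xor | Shl | Shr

text \<open>
  Memory consists of arrays of \<open>2 ^ b\<close> words each, addressed by the content of a register; which
  array is accessed is a literal in the instruction, so that a program uses only a constant number
  of them.  This lets a pointer into a structure of \<open>O(n)\<close> words be a single word even if \<open>n\<close> is as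
  large as \<open>2 ^ b - 1\<close>.
\<close>

datatype instr =
    Const nat nat          \<comment> \<open>target register, literal\<close>
  | Not nat nat            \<comment> \<open>target register, operand\<close>
  | Alu alu nat nat nat    \<comment> \<open>target register, two operands\<close>
  | Load nat nat nat       \<comment> \<open>target register, array, register holding the address\<close>
  | Store nat nat nat      \<comment> \<open>array, register holding the address, source register\<close>
  | Jump nat
  | JumpEq nat nat nat     \<comment> \<open>two registers, program position\<close>
  | JumpLess nat nat nat   \<comment> \<open>two registers (compared as unsigned words), program position\<close>

type_synonym program = "instr list"
type_synonym memory = "nat \<Rightarrow> nat \<Rightarrow> nat"

record state =
  pc :: nat
  regs :: "nat \<Rightarrow> nat"
  mem :: memory

fun alu_result :: "nat \<Rightarrow> alu \<Rightarrow> nat \<Rightarrow> nat \<Rightarrow> nat" where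
  "alu_result b Add x y = x + y"
| "alu_result b Sub x y = x + 2 ^ b - y"
| "alu_result b Mul x y = x * y"
| "alu_result b And x y = and x y"
| "alu_result b Or x y = or x y"
| "alu_result b Xor x y = xor x y"
| "alu_result b Shl x y = push_bit y x"
| "alu_result b Shr x y = drop_bit y x"

definition put :: "nat \<Rightarrow> nat \<Rightarrow> nat \<Rightarrow> state \<Rightarrow> state" where
  "put b r v s = s\<lparr>pc := Suc (pc s), regs := (regs s)(r := take_bit b v)\<rparr>"

fun exec :: "nat \<Rightarrow> instr \<Rightarrow> state \<Rightarrow> state" where
  "exec b (Const r c) s = put b r c s"
| "exec b (Not r x) s = put b r (xor (mask b) (regs s x)) s"
| "exec b (Alu f r x y) s = put b r (alu_result b f (regs s x) (regs s y)) s"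
| "exec b (Load r j a) s = put b r (mem s j (regs s a)) s"
| "exec b (Store j a x) s =
     s\<lparr>pc := Suc (pc s), mem := (mem s)(j := (mem s j)(regs s a := regs s x))\<rparr>"
| "exec b (Jump l) s = s\<lparr>pc := l\<rparr>"
| "exec b (JumpEq x y l) s = s\<lparr>pc := (if regs s x = regs s y then l else Suc (pc s))\<rparr>"
| "exec b (JumpLess x y l) s = s\<lparr>pc := (if regs s x < regs s y then l else Suc (pc s))\<rparr>"

text \<open>A program halts by leaving its text.\<close>

definition step :: "nat \<Rightarrow> program \<Rightarrow> state \<Rightarrow> state" where
  "step b P s = (if pc s < length P then exec b (P ! pc s) s else s)"

text \<open>Only memory survives from one operation to the next.\<close>

definition start :: "nat list \<Rightarrow> memory \<Rightarrow> state" where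
  "start xs M = \<lparr>pc = 0, regs = (\<lambda>i. if i < length xs then xs ! i else 0), mem = M\<rparr>"

definition halts :: "nat \<Rightarrow> program \<Rightarrow> nat list \<Rightarrow> memory \<Rightarrow> nat \<Rightarrow> state \<Rightarrow> bool" where
  "halts b P xs M t s \<longleftrightarrow> s = (step b P ^^ t) (start xs M) \<and> length P \<le> pc s"


section \<open>The partial-sums problem\<close>

text \<open>Integers are represented in two's complement.\<close>

definition fits :: "nat \<Rightarrow> int \<Rightarrow> bool" where
  "fits w x \<longleftrightarrow> - (2 ^ (w - 1)) \<le> x \<and> x < 2 ^ (w - 1)"

definition word_of :: "nat \<Rightarrow> int \<Rightarrow> nat" where
  "word_of b x = nat (take_bit b x)"

definition psum :: "(nat \<Rightarrow> int) \<Rightarrow> nat \<Rightarrow> int" where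
  "psum A k = (\<Sum>i=1..k. A i)"

datatype operation = Update nat int | Sum nat | Select int

fun apply_op :: "operation \<Rightarrow> (nat \<Rightarrow> int) \<Rightarrow> (nat \<Rightarrow> int)" where
  "apply_op (Update k \<Delta>) A = A(k := \<Delta>)"
| "apply_op _ A = A"

text \<open>
  The bounds on \<open>\<sigma>\<close> say that the index asked for by \<open>Select \<sigma>\<close> exists.
\<close>

fun legal :: "nat \<Rightarrow> nat \<Rightarrow> nat \<Rightarrow> (nat \<Rightarrow> int) \<Rightarrow> operation \<Rightarrow> bool" where
  "legal n b \<delta> A (Update k \<Delta>) \<longleftrightarrow>
     k \<in> {1..n} \<and> fits \<delta> \<Delta> \<and>
     (\<forall>i\<in>{1..n}. fits b ((A(k := \<Delta>)) i) \<and> fits b (psum (A(k := \<Delta>)) i))"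
| "legal n b \<delta> A (Sum k) \<longleftrightarrow> k \<le> n"
| "legal n b \<delta> A (Select \<sigma>) \<longleftrightarrow> (\<forall>i\<in>{1..n}. A i > 0) \<and> 0 < \<sigma> \<and> \<sigma> \<le> psum A n"

fun answer :: "nat \<Rightarrow> nat \<Rightarrow> (nat \<Rightarrow> int) \<Rightarrow> operation \<Rightarrow> nat \<Rightarrow> bool" where
  "answer n b A (Update k \<Delta>) r \<longleftrightarrow> True"
| "answer n b A (Sum k) r \<longleftrightarrow> r = word_of b (psum A k)"
| "answer n b A (Select \<sigma>) r \<longleftrightarrow> r \<in> {1..n} \<and> psum A (r - 1) < \<sigma> \<and> \<sigma> \<le> psum A r"

fun arguments :: "nat \<Rightarrow> operation \<Rightarrow> nat list" where
  "arguments b (Update k \<Delta>) = [k, word_of b \<Delta>]"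
| "arguments b (Sum k) = [k]"
| "arguments b (Select \<sigma>) = [word_of b \<sigma>]"

record data_structure =
  init_prog :: program
  update_prog :: program
  sum_prog :: program
  select_prog :: program

fun prog_of :: "data_structure \<Rightarrow> operation \<Rightarrow> program" where
  "prog_of D (Update _ _) = update_prog D"
| "prog_of D (Sum _) = sum_prog D"
| "prog_of D (Select _) = select_prog D"

text \<open>
  The arrays together with the memory contents representing them that can arise from initialising
  the structure on blank memory, with \<open>n\<close>, \<open>b\<close>, \<open>\<delta>\<close> in the first three registers, and performing
  legal operations.  The array is initially zero: any other array of \<open>\<delta>\<close>-bit integers is reached by
  updating its entries from left to right.
\<close>

inductive reachable ::
  "data_structure \<Rightarrow> nat \<Rightarrow> nat \<Rightarrow> nat \<Rightarrow> (nat \<Rightarrow> int) \<Rightarrow> memory \<Rightarrow> bool"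
  for D n b \<delta> where
  initial: "halts b (init_prog D) [n, b, \<delta>] (\<lambda>_ _. 0) t s \<Longrightarrow> reachable D n b \<delta> (\<lambda>_. 0) (mem s)"
| operate: "reachable D n b \<delta> A M \<Longrightarrow> legal n b \<delta> A opn \<Longrightarrow>
    halts b (prog_of D opn) (arguments b opn) M t s \<Longrightarrow>
    reachable D n b \<delta> (apply_op opn A) (mem s)"

fun time_of :: "nat \<Rightarrow> nat \<Rightarrow> nat \<Rightarrow> operation \<Rightarrow> nat" where
  "time_of tu tq ts (Update _ _) = tu"
| "time_of tu tq ts (Sum _) = tq"
| "time_of tu tq ts (Select _) = ts"

text \<open>
  \<open>tu\<close>, \<open>tq\<close>, \<open>ts\<close> bound the number of instructions executed by each single operation, whatever the
  operations before it.  An answer is returned in the first register.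
\<close>

definition solves_partial_sums ::
  "data_structure \<Rightarrow> nat \<Rightarrow> nat \<Rightarrow> nat \<Rightarrow> nat \<Rightarrow> nat \<Rightarrow> nat \<Rightarrow> bool" where
  "solves_partial_sums D n b \<delta> tu tq ts \<longleftrightarrow>
     (\<exists>t s. halts b (init_prog D) [n, b, \<delta>] (\<lambda>_ _. 0) t s) \<and>
     (\<forall>A M opn. reachable D n b \<delta> A M \<and> legal n b \<delta> A opn \<longrightarrow>
        (\<exists>t s. t \<le> time_of tu tq ts opn \<and>
           halts b (prog_of D opn) (arguments b opn) M t s \<and> answer n b A opn (regs s 0)))"

text \<open>
  The condition \<open>n < 2 ^ b\<close> is the hypothesis \<open>b = \<Omega>(lg n)\<close> in its weakest form for a RAM on which
  an index into the array is a word.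
\<close>

definition parameters :: "(nat \<times> nat \<times> nat) set" where
  "parameters = {(n, b, \<delta>). 1 \<le> n \<and> n < 2 ^ b \<and> 1 \<le> \<delta> \<and> \<delta> \<le> b}"

text \<open>
  The quotient tends to 0 for fixed \<open>n\<close> and growing \<open>b\<close>, while every operation takes at least
  constant time; hence the maximum.
\<close>

definition time_bound :: "nat \<Rightarrow> nat \<Rightarrow> nat \<Rightarrow> real" where
  "time_bound n b \<delta> = max 1 (lg (real n) / lg (real b / real \<delta>))"

end

theory Submission
  imports Defs
begin

text \<open>
  The elements are the leaves of a tree of degree \<open>B = 2 ^ \<beta>\<close>, where \<open>\<beta>\<close> is of the order of
  \<open>lg (b / \<delta>)\<close>, and every node knows the prefix sums of the sums of its children.  Let the children
  have \<open>2 ^ s\<close> leaves.  If \<open>s < \<delta> + \<beta>\<close>, a prefix sum has \<open>O(\<delta> + \<beta>)\<close> bits and all of them fit into one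
  word: an update of the node is a multiplication, and the child containing a given rank is found by
  subtracting all prefix sums in parallel and counting sign bits.  Otherwise each prefix sum is a full
  word plus a correction of \<open>O(\<delta> + \<beta>)\<close> bits, and the corrections are packed into one word.  Every update
  of the node flushes one correction, in cyclic order, so that none exceeds \<open>B * 2 ^ \<delta> \<le> 2 ^ s\<close>.  As
  selection assumes positive elements, consecutive prefix sums differ by at least \<open>2 ^ s\<close>; therefore
  the full words rounded to multiples of \<open>2 ^ s\<close>, which again can be packed, leave a bounded number of
  candidates for the child.
\<close>


section \<open>Structured programs\<close>

text \<open>The level \<open>s = \<delta> + \<beta>\<close> separates the two kinds of nodes because
  two requirements meet there with \<open>w = 2 * (\<delta> + \<beta>)\<close>. Below it a node has
  at most \<open>2 ^ (\<beta> + s)\<close> leaves, so its prefix sums stay under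
  \<open>2 ^ (w - 1)\<close>; from it on the pending corrections, at most
  \<open>F * 2 ^ \<delta>\<close>, are smaller than the unit \<open>2 ^ s\<close> to which keys are
  rounded. The obstacle is that elements may be negative between two selections, so that neither the
  sign nor the order of the prefix sums in a high node can be kept as an invariant. Its full words
  are therefore described only as residues modulo \<open>2 ^ b\<close>, and a key as a function of
  the residue it belongs to; sizes are recovered at the moment of a selection, from the positivity
  of the elements. The programs must not depend on \<open>n\<close>, \<open>b\<close>,
  \<open>\<delta>\<close>. The initialisation, which only has to halt, finds \<open>\<beta>\<close>
  by trial, and since blank memory represents the zero array it sets up no nodes.\<close>

type_synonym registers = "nat \<Rightarrow> nat"

datatype com =
    Do "instr list"
  | Seq com com  (infixr ";;" 60)
  | Cond nat nat com com
  | While nat nat com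

fun plain :: "instr \<Rightarrow> bool" where
  "plain (Jump _) = False"
| "plain (JumpEq _ _ _) = False"
| "plain (JumpLess _ _ _) = False"
| "plain _ = True"

fun eff :: "nat \<Rightarrow> instr \<Rightarrow> registers \<times> memory \<Rightarrow> registers \<times> memory" where
  "eff b (Const r c) (R, M) = (R(r := take_bit b c), M)"
| "eff b (Not r x) (R, M) = (R(r := take_bit b (xor (mask b) (R x))), M)"
| "eff b (Alu f r x y) (R, M) = (R(r := take_bit b (alu_result b f (R x) (R y))), M)"
| "eff b (Load r j a) (R, M) = (R(r := take_bit b (M j (R a))), M)"
| "eff b (Store j a x) (R, M) = (R, M(j := (M j)(R a := R x)))"
| "eff b _ s = s"

fun len :: "com \<Rightarrow> nat" where
  "len (Do is) = length is"
| "len (c1 ;; c2) = len c1 + len c2"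
| "len (Cond x y c1 c2) = len c1 + len c2 + 2"
| "len (While x y c) = len c + 3"

text \<open>The first argument is the address of the code, as jump targets are absolute. In
  \<open>Cond\<close> the second branch is placed first because the jump is taken when the
  comparison holds; hence the unequal costs 1 and 2 in \<open>big\<close>. \<open>While\<close> uses
  a second jump, there being no jump on the negated comparison, and so pays 2 in every round and 2
  on exit.\<close>

fun compile :: "nat \<Rightarrow> com \<Rightarrow> program" where
  "compile a (Do is) = is"
| "compile a (c1 ;; c2) = compile a c1 @ compile (a + len c1) c2"
| "compile a (Cond x y c1 c2) =
     JumpLess x y (a + len c2 + 2) # compile (Suc a) c2 @ Jump (a + len c1 + len c2 + 2) #
     compile (a + len c2 + 2) c1"
| "compile a (While x y c) =
     JumpLess x y (a + 2) # Jump (a + len c + 3) # compile (a + 2) c @ [Jump a]"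

inductive big ::
  "nat \<Rightarrow> com \<Rightarrow> registers \<times> memory \<Rightarrow> nat \<Rightarrow> registers \<times> memory \<Rightarrow> bool" for b where
  Do: "\<forall>i\<in>set is. plain i \<Longrightarrow> big b (Do is) s (length is) (fold (eff b) is s)"
| Seq: "big b c1 s t1 s1 \<Longrightarrow> big b c2 s1 t2 s2 \<Longrightarrow> big b (c1 ;; c2) s (t1 + t2) s2"
| CondT: "fst s x < fst s y \<Longrightarrow> big b c1 s t s1 \<Longrightarrow> big b (Cond x y c1 c2) s (Suc t) s1"
| CondF: "\<not> fst s x < fst s y \<Longrightarrow> big b c2 s t s1 \<Longrightarrow> big b (Cond x y c1 c2) s (t + 2) s1"
| WhileT: "fst s x < fst s y \<Longrightarrow> big b c s t1 s1 \<Longrightarrow> big b (While x y c) s1 t2 s2 \<Longrightarrow>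
    big b (While x y c) s (t1 + t2 + 2) s2"
| WhileF: "\<not> fst s x < fst s y \<Longrightarrow> big b (While x y c) s 2 s"

section \<open>Correctness of the translation into jumps\<close>

lemma length_compile [simp]: "length (compile a c) = len c"
  by (induction a c rule: compile.induct) auto

abbreviation state_at :: "nat \<Rightarrow> registers \<times> memory \<Rightarrow> state" where
  "state_at a s \<equiv> \<lparr>pc = a, regs = fst s, mem = snd s\<rparr>"

lemma exec_plain: "plain i \<Longrightarrow> exec b i (state_at a s) = state_at (Suc a) (eff b i s)"
  by (cases i; cases s) (auto simp: put_def)

lemma step_nth: "i < length is \<Longrightarrow>
    step b (pre @ is @ post) (state_at (length pre + i) s) = exec b (is ! i) (state_at (length pre + i) s)"
  by (simp add: step_def nth_append)

lemma steps_plain: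
  assumes "\<forall>i\<in>set is. plain i"
  shows "(step b (pre @ is @ post) ^^ length is) (state_at (length pre) s) =
    state_at (length pre + length is) (fold (eff b) is s)"
  using assms
proof (induction "is" arbitrary: pre s)
  case (Cons i "is")
  have "step b (pre @ (i # is) @ post) (state_at (length pre) s) = state_at (Suc (length pre)) (eff b i s)"
    using step_nth[of 0 "i # is" b pre post s] Cons.prems exec_plain[of i b "length pre" s] by simp
  moreover have "(step b ((pre @ [i]) @ is @ post) ^^ length is) (state_at (length (pre @ [i])) (eff b i s)) =
      state_at (length (pre @ [i]) + length is) (fold (eff b) is (eff b i s))"
    by (rule Cons.IH) (use Cons.prems in auto)
  ultimately show ?case
    by (simp add: funpow_Suc_right del: funpow.simps)
qed simp

lemma steps_add:
  assumes "(f ^^ t1) s = s1" "(f ^^ t2) s1 = s2"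
  shows "(f ^^ (t1 + t2)) s = s2"
  using assms by (metis add.commute comp_apply funpow_add)

text \<open>The code stands between arbitrary \<open>pre\<close> and \<open>post\<close>, since
  inside a compound command each subcommand runs with its siblings and the surrounding jumps as
  context.\<close>

lemma compile_correct:
  assumes "big b c s t s'"
  shows "(step b (pre @ compile (length pre) c @ post) ^^ t) (state_at (length pre) s) =
    state_at (length pre + len c) s'"
  using assms
proof (induction arbitrary: pre post)
  case (Do "is" s)
  then show ?case using steps_plain[of "is" b pre post s] by simp
next
  case (Seq c1 s t1 s1 c2 t2 s2)
  show ?case
    using steps_add[OF Seq.IH(1)[of pre "compile (length pre + len c1) c2 @ post"]
        Seq.IH(2)[of "pre @ compile (length pre) c1" post, simplified]]
    by (simp add: add.assoc)
next
  case (CondT s x y c1 t s1 c2)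
  let ?P = "pre @ compile (length pre) (Cond x y c1 c2) @ post"
  have "(step b ?P ^^ 1) (state_at (length pre) s) = state_at (length pre + len c2 + 2) s"
    using step_nth[of 0 "compile (length pre) (Cond x y c1 c2)" b pre post s] CondT.hyps(1) by simp
  from steps_add[OF this] show ?case
    using CondT.IH[of "pre @ JumpLess x y (length pre + len c2 + 2) # compile (Suc (length pre)) c2 @
      [Jump (length pre + len c1 + len c2 + 2)]" post]
    by (simp add: algebra_simps)
next
  case (CondF s x y c2 t s1 c1)
  let ?P = "pre @ compile (length pre) (Cond x y c1 c2) @ post"
  have 1: "(step b ?P ^^ 1) (state_at (length pre) s) = state_at (Suc (length pre)) s"
    using step_nth[of 0 "compile (length pre) (Cond x y c1 c2)" b pre post s] CondF.hyps(1) by simp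
  have 2: "(step b ?P ^^ t) (state_at (Suc (length pre)) s) = state_at (Suc (length pre) + len c2) s1"
    using CondF.IH[of "pre @ [JumpLess x y (length pre + len c2 + 2)]"
      "Jump (length pre + len c1 + len c2 + 2) # compile (length pre + len c2 + 2) c1 @ post"]
    by simp
  have 3: "(step b ?P ^^ 1) (state_at (Suc (length pre) + len c2) s1) = state_at (length pre + len c1 + len c2 + 2) s1"
    using step_nth[of "Suc (len c2)" "compile (length pre) (Cond x y c1 c2)" b pre post s1]
    by (simp add: nth_append)
  show ?case using steps_add[OF steps_add[OF 1 2] 3] by (simp add: algebra_simps)
next
  case (WhileT s x y c t1 s1 t2 s2)
  let ?P = "pre @ compile (length pre) (While x y c) @ post"
  have 1: "(step b ?P ^^ 1) (state_at (length pre) s) = state_at (length pre + 2) s"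
    using step_nth[of 0 "compile (length pre) (While x y c)" b pre post s] WhileT.hyps(1) by simp
  have 2: "(step b ?P ^^ t1) (state_at (length pre + 2) s) = state_at (length pre + 2 + len c) s1"
    using WhileT.IH(1)[of "pre @ [JumpLess x y (length pre + 2), Jump (length pre + len c + 3)]"
      "Jump (length pre) # post"] by simp
  have 3: "(step b ?P ^^ 1) (state_at (length pre + 2 + len c) s1) = state_at (length pre) s1"
    using step_nth[of "2 + len c" "compile (length pre) (While x y c)" b pre post s1]
    by (simp add: nth_append)
  show ?case using steps_add[OF steps_add[OF steps_add[OF 1 2] 3] WhileT.IH(2)[of pre post]]
    by (simp add: algebra_simps)
next
  case (WhileF s x y c)
  let ?P = "pre @ compile (length pre) (While x y c) @ post"
  have 1: "(step b ?P ^^ 1) (state_at (length pre) s) = state_at (Suc (length pre)) s"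
    using step_nth[of 0 "compile (length pre) (While x y c)" b pre post s] WhileF by simp
  have 2: "(step b ?P ^^ 1) (state_at (Suc (length pre)) s) = state_at (length pre + len c + 3) s"
    using step_nth[of 1 "compile (length pre) (While x y c)" b pre post s] by simp
  show ?case using steps_add[OF 1 2] by (simp add: numeral_2_eq_2 add.assoc)
qed

lemma steps_halted:
  assumes "length P \<le> pc s"
  shows "(step b P ^^ t) s = s"
proof -
  have "step b P s = s" using assms by (simp add: step_def)
  then show ?thesis by (induction t) auto
qed

text \<open>\<open>reachable\<close> follows any halting run, whereas correctness is shown by
  exhibiting one; uniqueness identifies the two.\<close>

lemma halts_unique:
  assumes "halts b P xs M t1 s1" "halts b P xs M t2 s2"
  shows "s1 = s2"
proof -
  have *: "u2 = u1" if "halts b P xs M k1 u1" "halts b P xs M k2 u2" "k1 \<le> k2" for k1 k2 u1 u2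
  proof -
    have "(step b P ^^ (k1 + (k2 - k1))) (start xs M) = u1"
      by (rule steps_add[of k1 _ _ u1]) (use that(1) steps_halted[of P u1] in \<open>auto simp: halts_def\<close>)
    then show ?thesis using that(2,3) by (simp add: halts_def)
  qed
  show ?thesis using *[OF assms] *[OF assms(2,1)] using nat_le_linear by blast
qed

section \<open>Total correctness with a time bound\<close>

definition wpt ::
  "nat \<Rightarrow> com \<Rightarrow> nat \<Rightarrow> (registers \<Rightarrow> memory \<Rightarrow> bool) \<Rightarrow> registers \<Rightarrow> memory \<Rightarrow> bool" where
  "wpt b c t Q R M \<longleftrightarrow> (\<exists>t'\<le>t. \<exists>R' M'. big b c (R, M) t' (R', M') \<and> Q R' M')"

lemma wpt_halts:
  assumes "wpt b c t Q R M" "R = (\<lambda>i. if i < length xs then xs ! i else 0)"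
  shows "\<exists>t'\<le>t. \<exists>s. halts b (compile 0 c) xs M t' s \<and> Q (regs s) (mem s)"
proof -
  obtain t' R' M' where *: "t' \<le> t" "big b c (R, M) t' (R', M')" "Q R' M'"
    using assms(1) unfolding wpt_def by blast
  have "halts b (compile 0 c) xs M t' (state_at (len c) (R', M'))"
    using compile_correct[OF *(2), of "[]" "[]"] assms(2) by (simp add: halts_def start_def)
  with * show ?thesis by (intro exI[of _ t'] conjI exI[of _ "state_at (len c) (R', M')"]) auto
qed

lemma wpt_weaken: "wpt b c t Q R M \<Longrightarrow> t \<le> t' \<Longrightarrow> (\<And>R M. Q R M \<Longrightarrow> Q' R M) \<Longrightarrow> wpt b c t' Q' R M"
  unfolding wpt_def using le_trans by blast

lemma wpt_Seq:
  assumes "wpt b c1 t1 Q R M" "\<And>R M. Q R M \<Longrightarrow> wpt b c2 t2 Q' R M"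
  shows "wpt b (c1 ;; c2) (t1 + t2) Q' R M"
proof -
  obtain t1' R1 M1 where 1: "t1' \<le> t1" "big b c1 (R, M) t1' (R1, M1)" "Q R1 M1"
    using assms(1) unfolding wpt_def by blast
  obtain t2' R2 M2 where 2: "t2' \<le> t2" "big b c2 (R1, M1) t2' (R2, M2)" "Q' R2 M2"
    using assms(2)[OF 1(3)] unfolding wpt_def by blast
  show ?thesis
    unfolding wpt_def using big.Seq[OF 1(2) 2(2)] 1 2 by (intro exI[of _ "t1' + t2'"]) auto
qed

text \<open>For the initialisation, where only termination counts: the bound for the second part may
  be chosen after the intermediate state is known.\<close>

lemma wpt_Seq_ex:
  assumes "wpt b c1 t1 Q R M" "\<And>R M. Q R M \<Longrightarrow> \<exists>t. wpt b c2 t Q' R M"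
  shows "\<exists>t. wpt b (c1 ;; c2) t Q' R M"
proof -
  obtain t R1 M1 where 1: "big b c1 (R, M) t (R1, M1)" "Q R1 M1"
    using assms(1) unfolding wpt_def by blast
  obtain t2 where "wpt b c2 t2 Q' R1 M1" using assms(2)[OF 1(2)] by blast
  then obtain t' R2 M2 where 2: "big b c2 (R1, M1) t' (R2, M2)" "Q' R2 M2"
    unfolding wpt_def by blast
  have "wpt b (c1 ;; c2) (t + t') Q' R M"
    unfolding wpt_def using big.Seq[OF 1(1) 2(1)] 2(2) by blast
  then show ?thesis by blast
qed

text \<open>The index of the invariant counts the rounds still to come. In the three operations it
  is the level of the tree, so that the depth \<open>D\<close> bounds the number of rounds.\<close>

lemma wpt_While:
  assumes "Inv k R M"
    and step: "\<And>k R M. Inv (Suc k) R M \<Longrightarrow> R x < R y \<and> wpt b c t (Inv k) R M"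
    and stop: "\<And>R M. Inv 0 R M \<Longrightarrow> \<not> R x < R y"
  shows "wpt b (While x y c) (k * (t + 2) + 2) (Inv 0) R M"
  using assms(1)
proof (induction k arbitrary: R M)
  case 0
  then show ?case
    using big.WhileF[of "(R, M)" x y b c] stop[of R M] unfolding wpt_def by (intro exI[of _ 2]) auto
next
  case (Suc k)
  obtain t1 R1 M1 where 1: "t1 \<le> t" "big b c (R, M) t1 (R1, M1)" "Inv k R1 M1"
    using step[OF Suc.prems] unfolding wpt_def by blast
  obtain t2 R2 M2 where 2: "t2 \<le> k * (t + 2) + 2" "big b (While x y c) (R1, M1) t2 (R2, M2)" "Inv 0 R2 M2"
    using Suc.IH[OF 1(3)] unfolding wpt_def by blast
  have "big b (While x y c) (R, M) (t1 + t2 + 2) (R2, M2)"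
    by (rule big.WhileT[OF _ 1(2) 2(2)]) (use step[OF Suc.prems] in simp)
  then show ?case
    unfolding wpt_def using 1 2 by (intro exI[of _ "t1 + t2 + 2"]) auto
qed

text \<open>A name for the truncated result, so that simplifying \<open>wp\<close> leaves an
  operation folded until a fact about its operands applies.\<close>

definition alu_val :: "nat \<Rightarrow> alu \<Rightarrow> nat \<Rightarrow> nat \<Rightarrow> nat" where
  "alu_val b f x y = take_bit b (alu_result b f x y)"

fun wp_block ::
  "nat \<Rightarrow> instr list \<Rightarrow> (registers \<Rightarrow> memory \<Rightarrow> bool) \<Rightarrow> registers \<Rightarrow> memory \<Rightarrow> bool" where
  "wp_block b [] Q R M = Q R M"
| "wp_block b (Const r c # is) Q R M = wp_block b is Q (R(r := take_bit b c)) M"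
| "wp_block b (Alu f r x y # is) Q R M =
     wp_block b is Q (R(r := alu_val b f (R x) (R y))) M"
| "wp_block b (Load r j a # is) Q R M = wp_block b is Q (R(r := take_bit b (M j (R a)))) M"
| "wp_block b (Store j a x # is) Q R M = wp_block b is Q R (M(j := (M j)(R a := R x)))"
| "wp_block b (_ # is) Q R M = False"

text \<open>Meant for loop-free code, on which simplification evaluates it completely. The value
  \<open>False\<close> for a loop is sound because \<open>wp\<close> only has to be sufficient;
  loops are left to \<open>wpt_While\<close>.\<close>

fun wp :: "nat \<Rightarrow> com \<Rightarrow> (registers \<Rightarrow> memory \<Rightarrow> bool) \<Rightarrow> registers \<Rightarrow> memory \<Rightarrow> bool" where
  "wp b (Do is) Q R M = wp_block b is Q R M"
| "wp b (c1 ;; c2) Q R M = wp b c1 (wp b c2 Q) R M"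
| "wp b (Cond x y c1 c2) Q R M = (if R x < R y then wp b c1 Q R M else wp b c2 Q R M)"
| "wp b (While x y c) Q R M = False"

lemma wp_block_fold:
  "wp_block b is Q R M \<Longrightarrow>
    (\<forall>i\<in>set is. plain i) \<and> Q (fst (fold (eff b) is (R, M))) (snd (fold (eff b) is (R, M)))"
  by (induction b "is" Q R M rule: wp_block.induct) (auto simp: alu_val_def)

text \<open>Without loops no instruction is executed twice, so the length of the code bounds its
  time. All constants in the running times are such lengths.\<close>

lemma wp_imp_wpt: "wp b c Q R M \<Longrightarrow> wpt b c (len c) Q R M"
proof (induction c arbitrary: Q R M)
  case (Do "is")
  then have *: "wp_block b is Q R M" by simp
  have "big b (Do is) (R, M) (length is) (fold (eff b) is (R, M))"
    using wp_block_fold[OF *] by (intro big.Do) blast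
  then show ?case
    unfolding wpt_def using wp_block_fold[OF *]
    by (intro exI[of _ "length is"] conjI exI[of _ "fst (fold (eff b) is (R, M))"]
      exI[of _ "snd (fold (eff b) is (R, M))"]) auto
next
  case (Seq c1 c2)
  then show ?case
    using wpt_Seq[OF Seq.IH(1)[of "wp b c2 Q" R M] Seq.IH(2)] by simp
next
  case (Cond x y c1 c2)
  show ?case
  proof (cases "R x < R y")
    case True
    then obtain t' R' M' where *: "t' \<le> len c1" "big b c1 (R, M) t' (R', M')" "Q R' M'"
      using Cond.IH(1)[of Q R M] Cond.prems unfolding wpt_def by auto
    have "big b (Cond x y c1 c2) (R, M) (Suc t') (R', M')"
      by (rule big.CondT[OF _ *(2)]) (use True in simp)
    then show ?thesis
      unfolding wpt_def using * by (intro exI[of _ "Suc t'"]) auto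
  next
    case False
    then obtain t' R' M' where *: "t' \<le> len c2" "big b c2 (R, M) t' (R', M')" "Q R' M'"
      using Cond.IH(2)[of Q R M] Cond.prems unfolding wpt_def by auto
    have "big b (Cond x y c1 c2) (R, M) (t' + 2) (R', M')"
      by (rule big.CondF[OF _ *(2)]) (use False in simp)
    then show ?thesis
      unfolding wpt_def using * by (intro exI[of _ "t' + 2"]) auto
  qed
qed simp


section \<open>Packed vectors\<close>

lemma int_word_of: "int (word_of b x) = x mod 2 ^ b"
  by (simp add: word_of_def take_bit_eq_mod)

lemma word_of_less: "word_of b x < 2 ^ b"
  using int_word_of[of b x] by (metis of_nat_less_numeral_power_cancel_iff pos_mod_bound zero_less_numeral zero_less_power)

lemma take_bit_word_of [simp]: "take_bit b (word_of b x) = word_of b x"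
  by (simp add: take_bit_nat_eq_self word_of_less)

lemma word_of_eq_iff: "word_of b x = word_of b y \<longleftrightarrow> x mod 2 ^ b = y mod 2 ^ b"
  using int_word_of[of b x] int_word_of[of b y] by (metis of_nat_eq_iff)

lemma word_of_int: "word_of b (int m) = take_bit b m"
  by (simp add: word_of_def take_bit_of_nat)

lemma word_of_int_eq: "m < 2 ^ b \<Longrightarrow> word_of b (int m) = m"
  by (simp add: word_of_int take_bit_nat_eq_self)

lemma word_of_eqI: "int (take_bit b m) = x mod 2 ^ b \<Longrightarrow> take_bit b m = word_of b x"
  using int_word_of[of b x] by simp

lemma word_of_add: "take_bit b (word_of b x + word_of b y) = word_of b (x + y)"
  by (rule word_of_eqI) (simp add: take_bit_eq_mod int_word_of zmod_int mod_simps)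

lemma word_of_mult: "take_bit b (word_of b x * word_of b y) = word_of b (x * y)"
  by (rule word_of_eqI) (simp add: take_bit_eq_mod int_word_of zmod_int mod_simps)

lemma word_of_diff: "take_bit b (word_of b x + 2 ^ b - word_of b y) = word_of b (x - y)"
proof (rule word_of_eqI)
  have "int (word_of b x + 2 ^ b - word_of b y) = (x mod 2 ^ b - y mod 2 ^ b) + 2 ^ b"
    using word_of_less[of b y] by (simp add: int_word_of)
  then have "int (take_bit b (word_of b x + 2 ^ b - word_of b y)) =
      ((x mod 2 ^ b - y mod 2 ^ b) + 2 ^ b) mod 2 ^ b"
    by (simp only: take_bit_eq_mod zmod_int of_nat_power of_nat_numeral)
  also have "\<dots> = (x - y) mod 2 ^ b"
    by (simp only: mod_add_self2 mod_diff_eq)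
  finally show "int (take_bit b (word_of b x + 2 ^ b - word_of b y)) = (x - y) mod 2 ^ b" .
qed

lemma word_of_shift: "take_bit b (push_bit k (word_of b x)) = word_of b (x * 2 ^ k)"
  by (rule word_of_eqI) (simp add: push_bit_eq_mult take_bit_eq_mod int_word_of zmod_int mod_simps)

text \<open>Unlike addition and multiplication, a right shift does not respect residues, so
  \<open>x mod 2 ^ b\<close> has to appear in the result.\<close>

lemma word_of_drop: "take_bit b (drop_bit k (word_of b x)) = word_of b (x mod 2 ^ b div 2 ^ k)"
  by (rule word_of_eqI)
    (simp add: drop_bit_eq_div take_bit_eq_mod int_word_of zmod_int zdiv_int)

lemma word_of_and_mask:
  assumes "w \<le> b"
  shows "take_bit b (and (word_of b x) (word_of b (2 ^ w - 1))) = word_of b (x mod 2 ^ w)"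
proof -
  have "(1::int) \<le> 2 ^ w" "(2::int) ^ w \<le> 2 ^ b"
    using power_increasing[OF assms, of "2::int"] by simp_all
  then have "(0::int) \<le> 2 ^ w - 1 \<and> (2::int) ^ w - 1 < 2 ^ b"
    by linarith
  then have "word_of b (2 ^ w - 1) = mask w"
    by (simp add: word_of_def take_bit_eq_mod mask_eq_exp_minus_1 nat_diff_distrib nat_power_eq)
  moreover have "take_bit b (take_bit w (word_of b x)) = word_of b (x mod 2 ^ w)"
    using assms by (intro word_of_eqI)
      (simp add: min_def take_bit_eq_mod int_word_of zmod_int mod_mod_cancel le_imp_power_dvd
        order_less_le_trans[OF pos_mod_bound power_increasing])
  ultimately show ?thesis by (simp add: take_bit_eq_mask)
qed

lemma word_of_0 [simp]: "word_of b 0 = 0"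
  by (simp add: word_of_def)

lemma word_of_nonneg: "0 \<le> x \<Longrightarrow> x < 2 ^ b \<Longrightarrow> word_of b x = nat x"
  by (simp add: word_of_def take_bit_eq_mod)

text \<open>The fields are arbitrary integers, and a negative field borrows from those above it.
  This keeps \<open>pack\<close> linear, so that an update is plain arithmetic on the word; ranges
  matter only for reading a field.\<close>

definition pack :: "nat \<Rightarrow> nat \<Rightarrow> (nat \<Rightarrow> int) \<Rightarrow> int" where
  "pack w F g = (\<Sum>f<F. g f * 2 ^ (w * f))"

lemma pack_0 [simp]: "pack w 0 g = 0"
  by (simp add: pack_def)

lemma pack_Suc: "pack w (Suc F) g = g 0 + 2 ^ w * pack w F (\<lambda>f. g (Suc f))"
  unfolding pack_def sum.lessThan_Suc_shift by (simp add: sum_distrib_left power_add ac_simps)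

lemma pack_append: "pack w (m + k) g = pack w m g + 2 ^ (w * m) * pack w k (\<lambda>f. g (m + f))"
  by (induction m arbitrary: g) (simp_all add: pack_Suc power_add algebra_simps)

lemma pack_add: "pack w F (\<lambda>f. g f + h f) = pack w F g + pack w F h"
  by (simp add: pack_def sum.distrib distrib_right)

lemma pack_diff: "pack w F (\<lambda>f. g f - h f) = pack w F g - pack w F h"
  by (simp add: pack_def sum_subtractf left_diff_distrib)

lemma pack_mult: "pack w F (\<lambda>f. c * g f) = c * pack w F g"
  by (simp add: pack_def sum_distrib_left mult.assoc)

lemma pack_cong: "(\<And>f. f < F \<Longrightarrow> g f = h f) \<Longrightarrow> pack w F g = pack w F h"
  by (simp add: pack_def)

lemma pack_upd: "r < F \<Longrightarrow> pack w F (g(r := x)) = pack w F g + (x - g r) * 2 ^ (w * r)"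
proof -
  assume r: "r < F"
  have "pack w F (g(r := x)) - pack w F g = (\<Sum>f<F. if f = r then (x - g r) * 2 ^ (w * r) else 0)"
    unfolding pack_def sum_subtractf[symmetric]
    by (rule sum.cong) (auto simp: algebra_simps)
  also have "\<dots> = (x - g r) * 2 ^ (w * r)" using r by simp
  finally show ?thesis by simp
qed

lemma pack_bounds:
  assumes "\<And>f. f < F \<Longrightarrow> 0 \<le> g f \<and> g f < 2 ^ w"
  shows "0 \<le> pack w F g \<and> pack w F g < 2 ^ (w * F)"
  using assms
proof (induction F arbitrary: g)
  case (Suc F)
  have "0 \<le> pack w F (\<lambda>f. g (Suc f))" "pack w F (\<lambda>f. g (Suc f)) + 1 \<le> 2 ^ (w * F)"
    using Suc.IH[of "\<lambda>f. g (Suc f)"] Suc.prems by auto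
  then have "2 ^ w * (pack w F (\<lambda>f. g (Suc f)) + 1) \<le> 2 ^ w * 2 ^ (w * F)"
    by (intro mult_left_mono) auto
  then show ?case
    using Suc.prems[of 0] \<open>0 \<le> pack w F _\<close> by (simp add: pack_Suc power_add algebra_simps)
qed simp

lemma pack_nth:
  assumes "\<And>f. f < F \<Longrightarrow> 0 \<le> g f \<and> g f < 2 ^ w" "r < F"
  shows "pack w F g div 2 ^ (w * r) mod 2 ^ w = g r"
proof -
  obtain k where k: "F = r + Suc k" using less_imp_Suc_add[OF assms(2)] by auto
  have "0 \<le> pack w r g \<and> pack w r g < 2 ^ (w * r)" using pack_bounds[of r g w] assms by auto
  moreover have "pack w F g = pack w r g + 2 ^ (w * r) * (g r + 2 ^ w * pack w k (\<lambda>f. g (r + Suc f)))"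
    unfolding k pack_append[of w r "Suc k"] pack_Suc[of w k] by simp
  ultimately show ?thesis
    using assms(1)[of r] assms(2) by simp
qed

text \<open>The induction step of \<open>and_ones\<close>: a conjunction acts separately on the
  lowest \<open>w\<close> bits, where the ones vector has only bit 0, and on the bits above.\<close>

lemma and_one_plus:
  fixes y o' :: nat
  assumes "1 \<le> w"
  shows "and y (1 + 2 ^ w * o') = y mod 2 + 2 ^ w * and (y div 2 ^ w) o'"
proof -
  let ?z = "and y (1 + 2 ^ w * o')"
  have w: "(2::nat) \<le> 2 ^ w" using assms by (metis one_le_numeral power_increasing power_one_right)
  have t: "take_bit w (1 + 2 ^ w * o') = 1" and d: "drop_bit w (1 + 2 ^ w * o') = o'"
    using w assms by (simp_all only: take_bit_eq_mod drop_bit_eq_div mod_mult_self2 div_mult_self2) simp_all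
  have "take_bit w ?z = take_bit w y mod 2" "drop_bit w ?z = and (y div 2 ^ w) o'"
    unfolding take_bit_and drop_bit_and t d by (simp_all add: and_one_eq drop_bit_eq_div)
  moreover have "take_bit w y mod 2 = y mod 2"
    using assms by (simp add: take_bit_eq_mod mod_mod_cancel)
  moreover have "?z = 2 ^ w * drop_bit w ?z + take_bit w ?z"
    by (metis bits_ident push_bit_eq_mult mult.commute)
  ultimately show ?thesis by presburger
qed

text \<open>The shift brings the top bit of each field to the bottom of the same field, and the ones
  vector masks everything else, including what entered from the field above.\<close>

lemma and_ones:
  assumes "1 \<le> w" "\<And>f. f < F \<Longrightarrow> 0 \<le> g f \<and> g f < 2 ^ w"
  shows "int (and (drop_bit (w - 1) (nat (pack w F g))) (nat (pack w F (\<lambda>_. 1)))) =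
    pack w F (\<lambda>f. g f div 2 ^ (w - 1))"
  using assms(2)
proof (induction F arbitrary: g)
  case (Suc F)
  define X where "X = pack w F (\<lambda>f. g (Suc f))"
  define Y where "Y = pack w F (\<lambda>_. 1)"
  have X: "0 \<le> X" and Y: "0 \<le> Y"
    using pack_bounds[of F "\<lambda>f. g (Suc f)" w] pack_bounds[of F "\<lambda>_. 1" w] Suc.prems assms(1)
    unfolding X_def Y_def by auto
  have g0: "0 \<le> g 0" "g 0 < 2 ^ w" using Suc.prems[of 0] by auto
  have w: "(2::nat) ^ w = 2 * 2 ^ (w - 1)" "(2::int) ^ w = 2 * 2 ^ (w - 1)"
    using assms(1) by (metis power_eq_if not_one_le_zero)+
  have 1: "nat (pack w (Suc F) g) = nat (g 0) + 2 ^ w * nat X"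
    using g0 X by (simp add: pack_Suc X_def[symmetric] nat_add_distrib nat_mult_distrib nat_power_eq)
  have 2: "nat (pack w (Suc F) (\<lambda>_. 1)) = 1 + 2 ^ w * nat Y"
    using Y by (simp add: pack_Suc Y_def[symmetric] nat_add_distrib nat_mult_distrib nat_power_eq)
  have g0w: "nat (g 0) < 2 ^ w" using g0 by (simp add: nat_less_iff)
  have d: "(nat (g 0) + 2 ^ w * nat X) div 2 ^ (w - 1) = nat (g 0) div 2 ^ (w - 1) + 2 * nat X"
    by (simp add: w mult.assoc mult.left_commute[of 2])
  have e: "nat (g 0) div 2 ^ (w - 1) < 2"
    using g0w by (simp add: w less_mult_imp_div_less mult.commute)
  \<comment> \<open>The two divisions commute, and dividing by \<open>2 ^ w\<close> first removes
    \<open>g 0\<close>.\<close>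
  have f: "(nat (g 0) + 2 ^ w * nat X) div 2 ^ (w - 1) div 2 ^ w = nat X div 2 ^ (w - 1)"
    using g0w by (metis add.commute add_cancel_right_left div_less div_mult2_eq div_mult_self2 mult.commute power_not_zero zero_neq_numeral)
  have "and (drop_bit (w - 1) (nat (pack w (Suc F) g))) (nat (pack w (Suc F) (\<lambda>_. 1))) =
      nat (g 0) div 2 ^ (w - 1) + 2 ^ w * and (drop_bit (w - 1) (nat X)) (nat Y)"
    unfolding 1 2 and_one_plus[OF assms(1)] drop_bit_eq_div f unfolding d using e by simp
  then show ?case
    using Suc.IH[of "\<lambda>f. g (Suc f)"] Suc.prems g0(1)
    by (simp add: pack_Suc X_def Y_def zdiv_int)
qed simp

text \<open>Field \<open>F - 1\<close> of the product with the all-ones vector is the sum of all fields.\<close>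

lemma pack_count:
  assumes g: "\<And>f. f < F \<Longrightarrow> g f \<in> {0, 1}" and F: "1 \<le> F" "int F < 2 ^ w"
  shows "(pack w F g * pack w F (\<lambda>_. 1)) div 2 ^ (w * (F - 1)) mod 2 ^ w = (\<Sum>f<F. g f)"
proof -
  define O1 where "O1 k = pack w k (\<lambda>_. 1)" for k
  define L where "L = (\<Sum>f<F. g f * 2 ^ (w * f) * O1 (F - 1 - f))"
  define T where "T = (\<Sum>f<F. g f * O1 f)"
  define cnt where "cnt = (\<Sum>f<F. g f)"
  \<comment> \<open>The ones vector shifted by \<open>f\<close> fields is cut at field
    \<open>F - 1\<close>: it contributes exactly 1 to that field, the fields below are collected in
    \<open>L\<close> and those above in \<open>T\<close>.\<close>
  have O1: "2 ^ (w * f) * O1 F = 2 ^ (w * f) * O1 (F - 1 - f) + 2 ^ (w * (F - 1)) * (1 + 2 ^ w * O1 f)"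
    if "f < F" for f
  proof -
    obtain k where k: "F = Suc (k + f)" using less_imp_Suc_add[OF \<open>f < F\<close>] by (metis add.commute)
    have "O1 F = O1 k + 2 ^ (w * k) * (1 + 2 ^ w * O1 f)"
      using pack_append[of w k "Suc f" "\<lambda>_. 1"] by (simp add: O1_def k pack_Suc)
    then show ?thesis by (simp add: k power_add algebra_simps)
  qed
  have "pack w F g * O1 F = (\<Sum>f<F. g f * (2 ^ (w * f) * O1 F))"
    by (simp add: pack_def sum_distrib_right mult.assoc)
  also have "\<dots> = (\<Sum>f<F. g f * 2 ^ (w * f) * O1 (F - 1 - f) + 2 ^ (w * (F - 1)) * (g f + 2 ^ w * (g f * O1 f)))"
  proof (rule sum.cong)
    fix f assume "f \<in> {..<F}"
    then show "g f * (2 ^ (w * f) * O1 F) = g f * 2 ^ (w * f) * O1 (F - 1 - f) +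
        2 ^ (w * (F - 1)) * (g f + 2 ^ w * (g f * O1 f))"
      by (subst O1) (simp_all add: algebra_simps)
  qed simp
  also have "\<dots> = L + 2 ^ (w * (F - 1)) * (cnt + 2 ^ w * T)"
    unfolding L_def T_def cnt_def sum.distrib sum_distrib_left[symmetric] by simp
  finally have prod: "pack w F g * O1 F = L + 2 ^ (w * (F - 1)) * (cnt + 2 ^ w * T)" .
  have w1: "(0::int) < 2 ^ w" by simp
  have L0: "0 \<le> L"
    unfolding L_def O1_def pack_def using g by (intro sum_nonneg mult_nonneg_nonneg) force+
  \<comment> \<open>No carry may reach field \<open>F - 1\<close> from below. Multiplying
    \<open>L\<close> by \<open>2 ^ w - 1\<close> turns its ones vectors into powers; each of the
    \<open>F\<close> terms is then at most \<open>2 ^ (w * (F - 1)) - 1\<close>, and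
    \<open>F \<le> 2 ^ w - 1\<close>.\<close>
  have geom: "(2 ^ w - 1) * O1 k = 2 ^ (w * k) - 1" for k
    by (induction k) (simp_all add: O1_def pack_Suc power_add algebra_simps)
  have "(2 ^ w - 1) * L = (\<Sum>f<F. g f * (2 ^ (w * f) * (2 ^ (w * (F - 1 - f)) - 1)))"
    unfolding L_def sum_distrib_left geom[symmetric] by (simp add: ac_simps)
  also have "\<dots> \<le> (\<Sum>f<F. 2 ^ (w * (F - 1)) - 1)"
  proof (rule sum_mono)
    fix f assume f: "f \<in> {..<F}"
    then have "w * f + w * (F - 1 - f) = w * (F - 1)"
      by (simp flip: add_mult_distrib2)
    then have e: "2 ^ (w * f) * (2 ^ (w * (F - 1 - f)) - 1) = 2 ^ (w * (F - 1)) - (2::int) ^ (w * f)"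
      by (metis mult.right_neutral power_add right_diff_distrib)
    have "w * f \<le> w * (F - 1)" using f by auto
    then have "(2::int) ^ (w * f) \<le> 2 ^ (w * (F - 1))" by (intro power_increasing) auto
    then show "g f * (2 ^ (w * f) * (2 ^ (w * (F - 1 - f)) - 1)) \<le> 2 ^ (w * (F - 1)) - 1"
      unfolding e using g[of f] f by auto
  qed
  also have "\<dots> = int F * (2 ^ (w * (F - 1)) - 1)" by simp
  also have "\<dots> \<le> (2 ^ w - 1) * (2 ^ (w * (F - 1)) - 1)"
    using F by (intro mult_right_mono) auto
  finally have "(2 ^ w - 1) * L \<le> (2 ^ w - 1) * (2 ^ (w * (F - 1)) - 1)" .
  moreover have "(0::int) < 2 ^ w - 1" using F by linarith
  ultimately have L1: "L < 2 ^ (w * (F - 1))" by simp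
  have "0 \<le> cnt" unfolding cnt_def using g by (intro sum_nonneg) force
  moreover have "cnt \<le> (\<Sum>f<F. 1)" unfolding cnt_def using g by (intro sum_mono) force
  moreover have "(\<Sum>f<F. 1) = int F" by simp
  ultimately have c: "0 \<le> cnt" "cnt < 2 ^ w" using F(2) by linarith+
  show ?thesis
    unfolding O1_def[symmetric] prod cnt_def[symmetric] using L0 L1 c by simp
qed

text \<open>The bias makes all fields nonnegative at once, which undoes the borrows; subtracting it
  from the extracted field restores the sign.\<close>

lemma pack_nth_signed:
  assumes "\<And>f. f < F \<Longrightarrow> - (2 ^ (w - 1)) \<le> g f \<and> g f < 2 ^ (w - 1)"
    and "r < F" "w * F \<le> b" "1 \<le> w"
  shows "(pack w F g + pack w F (\<lambda>_. 2 ^ (w - 1))) mod 2 ^ b div 2 ^ (w * r) mod 2 ^ w - 2 ^ (w - 1) = g r"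
proof -
  have w: "(2::int) ^ w = 2 * 2 ^ (w - 1)" using assms(4) by (simp add: power_eq_if)
  have g: "0 \<le> g f + 2 ^ (w - 1) \<and> g f + 2 ^ (w - 1) < 2 ^ w" if "f < F" for f
    using assms(1)[OF that] w by linarith
  have "0 \<le> pack w F (\<lambda>f. g f + 2 ^ (w - 1)) \<and> pack w F (\<lambda>f. g f + 2 ^ (w - 1)) < 2 ^ b"
    using pack_bounds[of F "\<lambda>f. g f + 2 ^ (w - 1)" w, OF g] power_increasing[OF assms(3), of "2::int"]
    by linarith
  then show ?thesis
    using pack_nth[of F "\<lambda>f. g f + 2 ^ (w - 1)" w r, OF g assms(2)] by (simp add: pack_add)
qed

text \<open>A shift right and back left clears the lowest \<open>c\<close> fields. Multiplied by the
  change of an element, the result updates all prefix sums that contain it.\<close>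

lemma pack_ones_from:
  assumes "c \<le> F" "w * F \<le> b" "1 \<le> w"
  shows "pack w F (\<lambda>_. 1) mod 2 ^ b div 2 ^ (w * c) * 2 ^ (w * c) = pack w F (\<lambda>f. of_bool (c \<le> f))"
proof -
  have 1: "(0::int) \<le> 1 \<and> (1::int) < 2 ^ w" using assms(3) by simp
  obtain k where k: "F = c + k" using assms(1) le_Suc_ex by blast
  have "pack w F (\<lambda>_. 1) < 2 ^ b"
    using pack_bounds[of F "\<lambda>_. 1" w, OF 1] power_increasing[OF assms(2), of "2::int"] by linarith
  moreover have "pack w c (\<lambda>f. of_bool (c \<le> f)) = pack w c (\<lambda>_. 0)"
    by (rule pack_cong) simp
  ultimately show ?thesis
    using pack_bounds[of c "\<lambda>_. 1" w, OF 1] pack_bounds[of F "\<lambda>_. 1" w, OF 1]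
    by (simp add: k pack_append) (simp add: pack_def)
qed

text \<open>A comparison with all fields in parallel: field \<open>f\<close> of \<open>X\<close> is
  \<open>2 ^ (w - 1) + (q - 1 - K f)\<close>, whose top bit is set exactly if
  \<open>K f \<le> q - 1\<close>. The ranges of \<open>q\<close> and \<open>K\<close> keep each
  field in \<open>[0, 2 ^ w)\<close>, so that no borrow crosses a boundary.\<close>

lemma pack_rank:
  assumes "1 \<le> w" "w * F \<le> b" "0 \<le> q" "q \<le> 2 ^ (w - 1)"
    and K: "\<And>f. f < F \<Longrightarrow> 0 \<le> K f \<and> K f < 2 ^ (w - 1)"
  defines "X \<equiv> pack w F (\<lambda>_. 2 ^ (w - 1)) + (q - 1) * pack w F (\<lambda>_. 1) - pack w F K"
  shows "take_bit b (and (word_of b (X mod 2 ^ b div 2 ^ (w - 1))) (word_of b (pack w F (\<lambda>_. 1)))) =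
    word_of b (pack w F (\<lambda>f. of_bool (K f < q)))"
proof -
  have w: "(2::int) ^ w = 2 * 2 ^ (w - 1)" using assms(1) by (simp add: power_eq_if)
  have 1: "(0::int) \<le> 1 \<and> (1::int) < 2 ^ w" using assms(1) by simp
  have wF: "(2::int) ^ (w * F) \<le> 2 ^ b" using assms(2) by (intro power_increasing) auto
  define h where "h f = 2 ^ (w - 1) + (q - 1) - K f" for f
  have X: "X = pack w F h"
    using pack_diff[of w F "\<lambda>_. 2 ^ (w - 1) + (q - 1)" K] pack_add[of w F "\<lambda>_. 2 ^ (w - 1)" "\<lambda>_. q - 1"]
      pack_mult[of w F "q - 1" "\<lambda>_. 1"]
    unfolding X_def h_def by simp
  have h: "0 \<le> h f \<and> h f < 2 ^ w" if "f < F" for f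
    using K[OF that] assms(3,4) w unfolding h_def by linarith
  have hX: "0 \<le> X" "X < 2 ^ b" using pack_bounds[of F h w, OF h] wF unfolding X by linarith+
  have hO: "0 \<le> pack w F (\<lambda>_. 1)" "pack w F (\<lambda>_. 1) < 2 ^ b"
    using pack_bounds[of F "\<lambda>_. 1" w, OF 1] wF by linarith+
  have b: "h f div 2 ^ (w - 1) = of_bool (K f < q)" if "f < F" for f
  proof (cases "K f < q")
    case True
    then have "h f = (q - 1 - K f) + 2 ^ (w - 1)" "0 \<le> q - 1 - K f" "q - 1 - K f < 2 ^ (w - 1)"
      using K[OF that] assms(4) by (auto simp: h_def)
    then show ?thesis using True by simp
  next
    case False
    then have "0 \<le> h f" "h f < 2 ^ (w - 1)" using K[OF that] assms(3) by (auto simp: h_def)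
    then show ?thesis using False by simp
  qed
  have "X div 2 ^ (w - 1) \<le> X" using zdiv_mono2[of X 1 "2 ^ (w - 1)"] hX(1) by simp
  then have "word_of b (X mod 2 ^ b div 2 ^ (w - 1)) = drop_bit (w - 1) (nat X)"
    using hX by (simp add: word_of_nonneg pos_imp_zdiv_nonneg_iff drop_bit_eq_div nat_div_distrib nat_power_eq)
  moreover have "word_of b (pack w F (\<lambda>_. 1)) = nat (pack w F (\<lambda>_. 1))"
    using hO by (simp add: word_of_nonneg)
  ultimately have "int (and (word_of b (X mod 2 ^ b div 2 ^ (w - 1))) (word_of b (pack w F (\<lambda>_. 1)))) =
      pack w F (\<lambda>f. of_bool (K f < q))"
    using and_ones[of w F h, OF assms(1) h] b by (simp add: X cong: pack_cong)
  then show ?thesis by (metis word_of_int)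
qed

lemma div_mod_window: "k + w \<le> b \<Longrightarrow> x mod 2 ^ b div 2 ^ k mod 2 ^ w = x div 2 ^ k mod 2 ^ w" for x :: int
proof -
  assume "k + w \<le> b"
  then have "min w (b - k) = w" by simp
  then show ?thesis
    by (simp add: take_bit_eq_mod[symmetric] drop_bit_eq_div[symmetric] drop_bit_take_bit)
qed


section \<open>The tree\<close>

lemma psum_upd:
  "1 \<le> k \<Longrightarrow> psum (A(k := x)) t = psum A t + (if k \<le> t then x - A k else 0)"
proof (induction t)
  case (Suc t)
  then show ?case by (cases "k = Suc t") (auto simp: psum_def)
qed (simp add: psum_def)

lemma psum_diff_le:
  assumes "u \<le> t" "\<And>i. u < i \<Longrightarrow> i \<le> t \<Longrightarrow> \<bar>A i\<bar> \<le> c"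
  shows "\<bar>psum A t - psum A u\<bar> \<le> int (t - u) * c"
  using assms
proof (induction t rule: dec_induct)
  case (step t)
  have "\<bar>psum A t - psum A u\<bar> \<le> int (t - u) * c" using step by auto
  moreover have "\<bar>A (Suc t)\<bar> \<le> c" using step by auto
  moreover have "psum A (Suc t) = psum A t + A (Suc t)" by (simp add: psum_def)
  moreover have "int (Suc t - u) * c = int (t - u) * c + c"
    using step.hyps by (simp add: Suc_diff_le algebra_simps)
  ultimately show ?case by linarith
qed simp

lemma psum_diff_ge:
  assumes "u \<le> t" "\<And>i. u < i \<Longrightarrow> i \<le> t \<Longrightarrow> 0 < A i"
  shows "int (t - u) \<le> psum A t - psum A u"
  using assms
proof (induction t rule: dec_induct)
  case (step t)
  have "int (t - u) \<le> psum A t - psum A u" using step by auto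
  moreover have "0 < A (Suc t)" using step by auto
  moreover have "psum A (Suc t) = psum A t + A (Suc t)" by (simp add: psum_def)
  ultimately show ?case using step.hyps by linarith
qed simp

text \<open>Division by \<open>B\<close> splits the position of a leaf into its ancestor and the
  child on the path. Through \<open>S_upd\<close>, a changed element thus concerns a single node of
  each level.\<close>

lemma digit_less_iff:
  fixes P d r B m i :: nat
  assumes P: "P = d * B + r" and "r < B" "i \<le> B"
  shows "P < m * B + i \<and> \<not> P < m * B \<longleftrightarrow> d = m \<and> r < i"
proof (cases d m rule: linorder_cases)
  case less
  then have "Suc d * B \<le> m * B" by (intro mult_le_mono1) simp
  then show ?thesis using assms less by simp
next
  case greater
  then have "Suc m * B \<le> d * B" by (intro mult_le_mono1) simp
  then show ?thesis using assms greater by simp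
qed (use assms in simp)

text \<open>
  A node has the proper prefix sums of its \<open>F + 1 = 2 ^ \<beta>\<close> children as \<open>F\<close> fields of width \<open>w\<close>; it is
  low if its children have less than \<open>2 ^ thr\<close> leaves.  The first alternative in \<open>mode\<close> covers a
  bounded quotient \<open>b / \<delta>\<close>: then \<open>F = 1\<close>, and every node is low because \<open>n < 2 ^ b\<close>.
\<close>

locale tree =
  fixes n b \<delta> \<beta> w thr D F :: nat
  assumes n: "1 \<le> n" "n < 2 ^ b" and \<delta>: "1 \<le> \<delta>" "\<delta> \<le> b" and \<beta>: "1 \<le> \<beta>"
    and F_def: "F = 2 ^ \<beta> - 1"
    and D_le: "n \<le> 2 ^ (\<beta> * D)" and D_ge: "0 < D \<Longrightarrow> 2 ^ (\<beta> * (D - 1)) < n"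
    and mode: "\<beta> = 1 \<and> w = b \<and> thr = b \<or> w = 2 * (\<delta> + \<beta>) \<and> thr = \<delta> + \<beta> \<and> 2 ^ \<beta> * w \<le> b"
begin

lemma two_\<beta>: "2 ^ \<beta> = Suc F"
  by (simp add: F_def)

lemma F_ge: "1 \<le> F"
  using \<beta> power_increasing[of 1 \<beta> "2::nat"] by (simp add: F_def)

lemma w_ge: "1 \<le> w"
  using mode \<delta> by auto

lemma wF_le: "w * F \<le> b"
  using mode two_\<beta> by (auto simp: algebra_simps)

lemma w_le: "w \<le> b"
  using wF_le F_ge by (metis le_trans mult.right_neutral mult_le_mono2)

lemma F_less: "int F < 2 ^ w"
proof -
  have "\<beta> \<le> w" using mode \<beta> w_ge by auto
  then have "(2::nat) ^ \<beta> \<le> 2 ^ w" by (intro power_increasing) auto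
  then have "F < 2 ^ w" using two_\<beta> by linarith
  then show ?thesis by (metis of_nat_less_numeral_power_cancel_iff)
qed

lemma b_less: "b < 2 ^ b"
  by (rule less_exp)

lemma \<beta>k_less: "k < D \<Longrightarrow> \<beta> * k < b"
proof -
  assume k: "k < D"
  then have "(2::nat) ^ (\<beta> * (D - 1)) < 2 ^ b" using D_ge n by linarith
  then have "\<beta> * (D - 1) < b" by simp
  moreover have "\<beta> * k \<le> \<beta> * (D - 1)" using k by auto
  ultimately show ?thesis by linarith
qed

text \<open>The height in bits is kept in a register, so it must be a word. It is below
  \<open>b + \<beta>\<close>; for \<open>\<beta> = 1\<close> this is at most \<open>b\<close>, and
  otherwise \<open>\<beta> < b\<close> and \<open>b \<ge> 2\<close>, so that
  \<open>2 * b \<le> 2 ^ b\<close> suffices.\<close>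

lemma \<beta>D_less: "\<beta> * D < 2 ^ b"
proof (cases D)
  case (Suc k)
  then have *: "\<beta> * D < b + \<beta>" using \<beta>k_less[of k] by simp
  show ?thesis
  proof (cases "\<beta> = 1")
    case True
    then show ?thesis using * b_less by linarith
  next
    case False
    then have m: "2 ^ \<beta> * w \<le> b" "w = 2 * (\<delta> + \<beta>)" using mode by auto
    have "\<beta> < b" using m(2) w_le \<delta>(1) by arith
    moreover have "2 \<le> b" using m(2) w_le \<beta> by arith
    then have "2 * b \<le> 2 ^ b"
    proof (induction b rule: nat_induct_at_least)
      case (Suc b)
      then show ?case by simp
    qed simp
    ultimately show ?thesis using * by linarith
  qed
qed simp

text \<open>The minimum pads the array with zeros up to the \<open>2 ^ (\<beta> * D)\<close> leaves
  of the tree.\<close>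

definition pre :: "(nat \<Rightarrow> int) \<Rightarrow> nat \<Rightarrow> nat \<Rightarrow> int" where
  "pre A s j = psum A (min n (j * 2 ^ s))"

text \<open>The sum over the first \<open>i\<close> children of the \<open>m\<close>-th node whose
  children have \<open>2 ^ s\<close> leaves, measured from the left end of the node.\<close>

definition S :: "(nat \<Rightarrow> int) \<Rightarrow> nat \<Rightarrow> nat \<Rightarrow> nat \<Rightarrow> int" where
  "S A s m i = pre A s (m * 2 ^ \<beta> + i) - pre A s (m * 2 ^ \<beta>)"

lemma pre_add: "pre A (s + \<beta>) m = pre A s (m * 2 ^ \<beta>)"
  by (simp add: pre_def power_add ac_simps)

lemma S_0 [simp]: "S A s m 0 = 0"
  by (simp add: S_def)

lemma pre_child: "pre A s (m * 2 ^ \<beta> + i) = pre A (s + \<beta>) m + S A s m i"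
  by (simp add: S_def pre_add)

lemma pre_upd:
  assumes "k \<in> {1..n}"
  shows "pre (A(k := x)) s j = pre A s j + (if (k - 1) div 2 ^ s < j then x - A k else 0)"
proof -
  have "k \<le> min n (j * 2 ^ s) \<longleftrightarrow> k - 1 < j * 2 ^ s" using assms by auto
  also have "\<dots> \<longleftrightarrow> (k - 1) div 2 ^ s < j"
    by (metis div_less_iff_less_mult zero_less_numeral zero_less_power)
  finally show ?thesis using assms psum_upd[of k A x] by (simp add: pre_def)
qed

lemma S_upd:
  assumes "k \<in> {1..n}" "i \<le> 2 ^ \<beta>"
  shows "S (A(k := x)) s m i = S A s m i +
    (if (k - 1) div 2 ^ (s + \<beta>) = m \<and> (k - 1) div 2 ^ s mod 2 ^ \<beta> < i then x - A k else 0)"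
proof -
  define P where "P = (k - 1) div 2 ^ s"
  have d: "(k - 1) div 2 ^ (s + \<beta>) = P div 2 ^ \<beta>"
    by (simp add: P_def power_add div_mult2_eq)
  have "P = P div 2 ^ \<beta> * 2 ^ \<beta> + P mod 2 ^ \<beta>" by (rule div_mult_mod_eq[symmetric])
  from digit_less_iff[OF this _ assms(2)]
  have "(P < m * 2 ^ \<beta> + i \<and> \<not> P < m * 2 ^ \<beta>) \<longleftrightarrow> P div 2 ^ \<beta> = m \<and> P mod 2 ^ \<beta> < i"
    by simp
  then show ?thesis
    unfolding S_def pre_upd[OF assms(1)] d P_def[symmetric] by auto
qed

definition bounded :: "(nat \<Rightarrow> int) \<Rightarrow> bool" where
  "bounded A \<longleftrightarrow> (\<forall>k\<in>{1..n}. fits \<delta> (A k) \<and> fits b (psum A k))"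

lemma S_bound:
  assumes "bounded A"
  shows "\<bar>S A s m i\<bar> \<le> int i * 2 ^ s * 2 ^ (\<delta> - 1)"
proof -
  let ?u = "min n (m * 2 ^ \<beta> * 2 ^ s)" and ?t = "min n ((m * 2 ^ \<beta> + i) * 2 ^ s)"
  have "\<bar>psum A ?t - psum A ?u\<bar> \<le> int (?t - ?u) * 2 ^ (\<delta> - 1)"
  proof (rule psum_diff_le)
    show "?u \<le> ?t" by (auto simp: min_def algebra_simps)
    show "\<bar>A j\<bar> \<le> 2 ^ (\<delta> - 1)" if "?u < j" "j \<le> ?t" for j
    proof -
      have "fits \<delta> (A j)" using assms that unfolding bounded_def by simp
      then show ?thesis by (simp add: fits_def abs_le_iff)
    qed
  qed
  also have "?t - ?u \<le> i * 2 ^ s" by (auto simp: min_def algebra_simps)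
  then have "int (?t - ?u) * 2 ^ (\<delta> - 1) \<le> int (i * 2 ^ s) * 2 ^ (\<delta> - 1)"
    by (intro mult_right_mono) (simp_all only: of_nat_le_iff zero_le_power zero_le_numeral)
  finally show ?thesis by (simp add: S_def pre_def)
qed

text \<open>This bound is the origin of the width \<open>w\<close>: with
  \<open>s \<le> \<delta> + \<beta> - 1\<close> the exponent
  \<open>\<beta> + s + (\<delta> - 1)\<close> is at most
  \<open>2 * (\<delta> + \<beta>) - 2\<close>.\<close>

lemma S_low:
  assumes "bounded A" "s < \<delta> + \<beta>" "w = 2 * (\<delta> + \<beta>)" "i \<le> 2 ^ \<beta>"
  shows "\<bar>S A s m i\<bar> < 2 ^ (w - 1)"
proof -
  have "int i * 2 ^ s * 2 ^ (\<delta> - 1) \<le> 2 ^ \<beta> * 2 ^ s * 2 ^ (\<delta> - 1)"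
    using assms(4) by (intro mult_right_mono) (simp_all flip: of_nat_le_iff)
  also have "\<dots> = 2 ^ (\<beta> + s + (\<delta> - 1))" by (simp add: power_add)
  also have "\<dots> < 2 ^ (w - 1)"
    using assms \<delta> \<beta> by (intro power_strict_increasing) auto
  finally show ?thesis using S_bound[OF assms(1), of s m i] by linarith
qed

text \<open>Vertices are numbered as in a heap; level \<open>k\<close> consists of the vertices with \<open>2 ^ (\<beta> * k)\<close> leaves.\<close>

definition vertex :: "nat \<Rightarrow> nat \<Rightarrow> nat" where
  "vertex k m = 2 ^ (\<beta> * (D - k)) + m"

text \<open>Here \<open>k\<close> is the level of the children; the node itself is
  \<open>vertex (Suc k) m\<close>.\<close>

definition node :: "nat \<Rightarrow> nat \<Rightarrow> bool" where
  "node k m \<longleftrightarrow> k < D \<and> m < 2 ^ (\<beta> * (D - Suc k))"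

lemma vertex_child: "k < D \<Longrightarrow> vertex (Suc k) m * 2 ^ \<beta> + i = vertex k (m * 2 ^ \<beta> + i)"
proof -
  assume "k < D"
  then have "D - k = Suc (D - Suc k)" by linarith
  then show ?thesis by (simp add: vertex_def power_add algebra_simps)
qed

lemma vertex_less: "node k m \<Longrightarrow> vertex (Suc k) m < 2 ^ b"
proof -
  assume *: "node k m"
  then have "\<beta> * (D - Suc k) < b" by (intro \<beta>k_less) (auto simp: node_def)
  then have "(2::nat) ^ Suc (\<beta> * (D - Suc k)) \<le> 2 ^ b" by (intro power_increasing) auto
  then show ?thesis using * by (simp add: vertex_def node_def)
qed

lemma node_child: "node (Suc k) m \<Longrightarrow> i \<le> F \<Longrightarrow> node k (m * 2 ^ \<beta> + i)"
proof -
  assume *: "node (Suc k) m" "i \<le> F"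
  then have "D - Suc k = Suc (D - Suc (Suc k))" by (auto simp: node_def)
  then have "2 ^ (\<beta> * (D - Suc k)) = 2 ^ (\<beta> * (D - Suc (Suc k))) * (2::nat) ^ \<beta>"
    by (simp add: power_add)
  moreover have "Suc m * 2 ^ \<beta> \<le> 2 ^ (\<beta> * (D - Suc (Suc k))) * 2 ^ \<beta>"
    using * by (intro mult_right_mono) (auto simp: node_def)
  ultimately show ?thesis using * two_\<beta> by (simp add: node_def)
qed

text \<open>The nodes of a level lie between a power of \<open>2 ^ \<beta>\<close> and its double,
  and as \<open>\<beta> \<ge> 1\<close> these intervals are disjoint for different levels.\<close>

lemma vertex_inj:
  assumes "node k m" "node k' m'" "vertex (Suc k) m = vertex (Suc k') m'"
  shows "k = k' \<and> m = m'"
proof -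
  have *: False if "node k m" "node k' m'" "vertex (Suc k) m = vertex (Suc k') m'" "k < k'" for k m k' m'
  proof -
    have "D - Suc k' < D - Suc k" using that by (auto simp: node_def)
    then have "\<beta> * Suc (D - Suc k') \<le> \<beta> * (D - Suc k)" by (intro mult_le_mono2) simp
    then have "Suc (\<beta> * (D - Suc k')) \<le> \<beta> * (D - Suc k)" using \<beta> by simp
    then have "(2::nat) ^ Suc (\<beta> * (D - Suc k')) \<le> 2 ^ (\<beta> * (D - Suc k))"
      by (intro power_increasing) auto
    then show False using that by (simp add: vertex_def node_def)
  qed
  have "k = k'"
    using *[OF assms] *[OF assms(2,1)] assms(3) by (metis linorder_cases)
  then show ?thesis using assms(3) by (simp add: vertex_def)
qed

text \<open>High nodes occur only in the second alternative of \<open>mode\<close>, since the first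
  has \<open>thr = b\<close> and \<open>\<beta> * k < b\<close> at every node.\<close>

lemma high_mode:
  assumes "node k m" "\<not> \<beta> * k < thr"
  shows "w = 2 * (\<delta> + \<beta>)" "\<delta> + \<beta> \<le> \<beta> * k" "0 < k"
proof -
  show 1: "w = 2 * (\<delta> + \<beta>)" and 2: "\<delta> + \<beta> \<le> \<beta> * k"
    using mode \<beta>k_less[of k] assms by (auto simp: node_def)
  show "0 < k" using 2 \<beta> by (cases k) auto
qed

text \<open>Array 3 is addressed by children. Those of a high node are inner nodes themselves
  because \<open>0 < k\<close>, and numbers of inner nodes fit into a word, whereas numbers of
  leaves may not.\<close>

lemma vertex_child_less:
  assumes "node k m" "\<not> \<beta> * k < thr" "i \<le> F"
  shows "vertex (Suc k) m * 2 ^ \<beta> + i < 2 ^ b"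
proof -
  obtain k' where k': "k = Suc k'" using high_mode(3)[OF assms(1,2)] by (cases k) auto
  have "node k' (m * 2 ^ \<beta> + i)" using node_child assms k' by simp
  then show ?thesis
    using vertex_less vertex_child[of k m i] assms(1) k' by (simp add: node_def)
qed

text \<open>Number of updates since the last refresh of field \<open>f\<close>, if field \<open>r\<close> is the next one to be refreshed.\<close>

definition age :: "nat \<Rightarrow> nat \<Rightarrow> nat" where
  "age f r = (if f < r then r - 1 - f else r + F - 1 - f)"

text \<open>This depends only on the residue of \<open>v\<close> modulo \<open>2 ^ b\<close>, hence
  it describes what \<open>refresh\<close> stores whatever the signs of the elements are. That it is
  a true quotient is shown in \<open>high_node_keys\<close> for positive arrays.\<close>

definition key :: "nat \<Rightarrow> int \<Rightarrow> int" where
  "key s v = (2 ^ s + v) mod 2 ^ b div 2 ^ s mod 2 ^ w"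

text \<open>
  In a high node a prefix sum \<open>S\<close> is split into a word \<open>S - c\<close> of its own in array 3 and a correction
  \<open>c\<close> packed with the others in array 1.  The key \<open>K\<close> in array 2 holds the leading bits of \<open>S - c\<close>,
  raised by one unit because \<open>S - c\<close> may be slightly negative even if all elements are positive.
  The second alternative for \<open>K\<close> describes blank memory, which is never initialised.
\<close>

definition high_node ::
  "(nat \<Rightarrow> int) \<Rightarrow> nat \<Rightarrow> nat \<Rightarrow> memory \<Rightarrow> (nat \<Rightarrow> int) \<Rightarrow> (nat \<Rightarrow> int) \<Rightarrow> bool" where
  "high_node A k m M c K \<longleftrightarrow>
     M 1 (vertex (Suc k) m) = word_of b (pack w F c) \<and>
     M 2 (vertex (Suc k) m) = word_of b (pack w F K) \<and>
     M 4 (vertex (Suc k) m) < F \<and>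
     (\<forall>f<F. \<bar>c f\<bar> \<le> int (age f (M 4 (vertex (Suc k) m))) * 2 ^ \<delta> \<and> 0 \<le> K f \<and> K f < 2 ^ w \<and>
        M 3 (vertex (Suc k) m * 2 ^ \<beta> + Suc f) = word_of b (S A (\<beta> * k) m (Suc f) - c f) \<and>
        (K f = key (\<beta> * k) (S A (\<beta> * k) m (Suc f) - c f) \<or>
         K f = 0 \<and> c f = S A (\<beta> * k) m (Suc f)))"

definition node_ok :: "(nat \<Rightarrow> int) \<Rightarrow> nat \<Rightarrow> nat \<Rightarrow> memory \<Rightarrow> bool" where
  "node_ok A k m M \<longleftrightarrow>
     (if \<beta> * k < thr
      then M 1 (vertex (Suc k) m) = word_of b (pack w F (\<lambda>f. S A (\<beta> * k) m (Suc f)))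
      else \<exists>c K. high_node A k m M c K)"

text \<open>Between two refreshes of a field each other field has one turn, so at its own refresh a
  correction has collected at most \<open>F\<close> changes, the current one included.\<close>

lemma age_less: "f < F \<Longrightarrow> r < F \<Longrightarrow> age f r < F"
  by (auto simp: age_def)

lemma age_next:
  assumes "f < F" "r < F" "f \<noteq> r"
  shows "age f (if Suc r < F then Suc r else 0) = Suc (age f r)"
  using assms by (auto simp: age_def)

text \<open>The first bound makes a correction fit into a signed field; the second keeps it below
  the unit of the keys, as \<open>rank_high\<close> requires.\<close>

lemma age_bound:
  assumes "node k m" "\<not> \<beta> * k < thr" "a \<le> F"
  shows "int a * 2 ^ \<delta> < 2 ^ (w - 1)" "int a * 2 ^ \<delta> < 2 ^ (\<beta> * k)"
proof -
  note h = high_mode[OF assms(1,2)]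
  have "a < 2 ^ \<beta>" using assms(3) two_\<beta> by simp
  then have "int a < 2 ^ \<beta>" by (metis of_nat_less_numeral_power_cancel_iff)
  then have *: "int a * 2 ^ \<delta> < 2 ^ (\<delta> + \<beta>)" by (simp add: power_add mult.commute)
  have "(2::int) ^ (\<delta> + \<beta>) \<le> 2 ^ (w - 1)" using h \<delta> \<beta> by (intro power_increasing) auto
  then show "int a * 2 ^ \<delta> < 2 ^ (w - 1)" using * by linarith
  have "(2::int) ^ (\<delta> + \<beta>) \<le> 2 ^ (\<beta> * k)" using h by (intro power_increasing) auto
  then show "int a * 2 ^ \<delta> < 2 ^ (\<beta> * k)" using * by linarith
qed

lemma extract_low:
  assumes "bounded A" "node k m" "\<beta> * k < thr" "r < F"
  shows "word_of b ((pack w F (\<lambda>f. S A (\<beta> * k) m (Suc f)) + pack w F (\<lambda>_. 2 ^ (w - 1))) mod 2 ^ b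
      div 2 ^ (w * r) mod 2 ^ w - 2 ^ (w - 1)) = word_of b (S A (\<beta> * k) m (Suc r))"
proof (cases "w = 2 * (\<delta> + \<beta>) \<and> thr = \<delta> + \<beta>")
  case True
  have "- (2 ^ (w - 1)) \<le> S A (\<beta> * k) m (Suc f) \<and> S A (\<beta> * k) m (Suc f) < 2 ^ (w - 1)" if "f < F" for f
    using S_low[OF assms(1), of "\<beta> * k" "Suc f" m] True assms(3) that two_\<beta> by force
  from pack_nth_signed[OF this assms(4) wF_le w_ge] show ?thesis by simp
next
  case False
  \<comment> \<open>The only field is the whole word. Bias and its removal cancel modulo
    \<open>2 ^ b\<close>, so the prefix sum may have any size.\<close>
  then have m: "\<beta> = 1" "w = b" using mode by auto
  then have F: "F = 1" by (simp add: F_def)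
  then show ?thesis
    using assms(4) by (simp add: m pack_def word_of_eq_iff mod_simps)
qed

lemma extract_high:
  assumes "node k m" "\<not> \<beta> * k < thr" "r < F" "\<And>f. f < F \<Longrightarrow> \<bar>c f\<bar> \<le> int F * 2 ^ \<delta>"
  shows "(pack w F c + pack w F (\<lambda>_. 2 ^ (w - 1))) mod 2 ^ b
      div 2 ^ (w * r) mod 2 ^ w - 2 ^ (w - 1) = c r"
proof -
  have "- (2 ^ (w - 1)) \<le> c f \<and> c f < 2 ^ (w - 1)" if "f < F" for f
    using age_bound(1)[OF assms(1,2) order_refl] assms(4)[OF that] by linarith
  from pack_nth_signed[OF this assms(3) wF_le w_ge] show ?thesis by simp
qed

end


section \<open>Prefix sums in a node\<close>

lemma alu_val_word:
  "alu_val b Add (word_of b x) (word_of b y) = word_of b (x + y)"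
  "alu_val b Sub (word_of b x) (word_of b y) = word_of b (x - y)"
  "alu_val b Mul (word_of b x) (word_of b y) = word_of b (x * y)"
  "alu_val b Shl (word_of b x) k = word_of b (x * 2 ^ k)"
  "alu_val b Shr (word_of b x) k = word_of b (x mod 2 ^ b div 2 ^ k)"
  by (simp_all only: alu_val_def alu_result.simps word_of_add word_of_diff word_of_mult
      word_of_shift word_of_drop)

lemma alu_val_mask:
  "w \<le> b \<Longrightarrow> alu_val b And (word_of b x) (word_of b (2 ^ w - 1)) = word_of b (x mod 2 ^ w)"
  by (simp only: alu_val_def alu_result.simps word_of_and_mask)

lemma alu_val_add: "x + y < 2 ^ b \<Longrightarrow> alu_val b Add x y = x + y"
  by (simp add: alu_val_def take_bit_nat_eq_self)

lemma alu_val_mult: "x * y < 2 ^ b \<Longrightarrow> alu_val b Mul x y = x * y"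
  by (simp add: alu_val_def take_bit_nat_eq_self)

lemma alu_val_diff: "y \<le> x \<Longrightarrow> x < 2 ^ b \<Longrightarrow> alu_val b Sub x y = x - y"
proof -
  assume *: "y \<le> x" "x < 2 ^ b"
  then have "x + 2 ^ b - y = x - y + 2 ^ b" "x - y < 2 ^ b" by simp_all
  then show ?thesis
    by (simp only: alu_val_def alu_result.simps take_bit_eq_mod mod_add_self2 mod_less)
qed

lemma alu_val_shl: "x * 2 ^ k < 2 ^ b \<Longrightarrow> alu_val b Shl x k = x * 2 ^ k"
  by (simp only: alu_val_def alu_result.simps push_bit_eq_mult take_bit_nat_eq_self)

lemma alu_val_shr: "x < 2 ^ b \<Longrightarrow> alu_val b Shr x k = x div 2 ^ k"
  using div_le_dividend[of x "2 ^ k"]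
  by (simp only: alu_val_def alu_result.simps drop_bit_eq_div take_bit_nat_eq_self)

text \<open>
  Array 0 holds the elements, arrays 1 to 4 the nodes, arrays 10 to 14 one parameter each at address 0
  (addresses above 1 are not words if \<open>b = 1\<close>).  Registers 20 to 32 are constant after the prologue, those from
  100 on are temporary.  While descending, register 3 holds the vertex, 4 the number of the child on the
  path, 5 the packed word of array 1, and 6 the binary logarithm of the number of leaves of that child.
\<close>

definition prologue :: com where
  "prologue = Do
    [Const 20 1, Const 21 0,
     Load 22 10 21, Load 23 11 21, Load 29 12 21, Load 28 13 21, Load 32 14 21,
     Alu Shl 24 20 22, Alu Sub 24 24 20,
     Alu Shl 25 20 23, Alu Sub 25 25 20,
     Alu Sub 30 23 20, Alu Shl 26 20 30, Alu Shl 27 28 30,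
     Alu Sub 31 24 20, Alu Mul 31 31 23]"

text \<open>Child 0 has the empty prefix and no field; child \<open>i > 0\<close> uses field
  \<open>i - 1\<close>. In a high node the field is only the correction, to which the word in array
  3 is added. The result is in register 101.\<close>

definition child_prefix :: com where
  "child_prefix =
     Cond 21 4
      (Do [Alu Sub 100 4 20, Alu Mul 100 23 100, Alu Add 101 5 27, Alu Shr 101 101 100,
           Alu And 101 101 25, Alu Sub 101 101 26] ;;
       Cond 6 29 (Do [])
        (Do [Alu Shl 102 3 22, Alu Add 102 102 4, Load 102 3 102, Alu Add 101 101 102]))
      (Do [Const 101 0])"

context tree
begin

definition params_ok :: "memory \<Rightarrow> bool" where
  "params_ok M \<longleftrightarrow> M 10 0 = \<beta> \<and> M 11 0 = w \<and> M 12 0 = thr \<and>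
     M 13 0 = word_of b (pack w F (\<lambda>_. 1)) \<and> M 14 0 = \<beta> * D"

definition const_regs :: "registers \<Rightarrow> bool" where
  "const_regs R \<longleftrightarrow> R 20 = 1 \<and> R 21 = 0 \<and> R 22 = \<beta> \<and> R 23 = w \<and> R 24 = F \<and>
     R 25 = word_of b (2 ^ w - 1) \<and> R 26 = word_of b (2 ^ (w - 1)) \<and>
     R 27 = word_of b (pack w F (\<lambda>_. 2 ^ (w - 1))) \<and> R 28 = word_of b (pack w F (\<lambda>_. 1)) \<and>
     R 29 = thr \<and> R 30 = w - 1 \<and> R 31 = w * (F - 1) \<and> R 32 = \<beta> * D"

lemma small: "1 < (2::nat) ^ b" "\<beta> < 2 ^ b" "w < 2 ^ b" "F < 2 ^ b" "thr < 2 ^ b" "f \<le> F \<Longrightarrow> w * f < 2 ^ b"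
proof -
  have w: "w * f \<le> b" if "f \<le> F" for f
    using that wF_le by (meson le_trans mult_le_mono2)
  have "F \<le> w * F" using w_ge by simp
  then have "F \<le> b" using wF_le by linarith
  moreover have "\<beta> < 2 ^ \<beta>" by (rule less_exp)
  then have "\<beta> \<le> F" using two_\<beta> by linarith
  moreover have "thr \<le> b" using mode w_le by auto
  moreover have "1 \<le> b" using \<delta> by linarith
  ultimately show "1 < (2::nat) ^ b" "\<beta> < 2 ^ b" "w < 2 ^ b" "F < 2 ^ b" "thr < 2 ^ b"
    "f \<le> F \<Longrightarrow> w * f < 2 ^ b"
    using b_less w_le w[of f] by linarith+
qed

lemma word_of_1 [simp]: "word_of b 1 = Suc 0"
  using word_of_int_eq[of 1 b] small(1) by simp

lemma alu_val_1:
  "alu_val b Shl 1 k = word_of b (2 ^ k)"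
  "alu_val b Sub (word_of b x) 1 = word_of b (x - 1)"
  "alu_val b Add (word_of b x) 1 = word_of b (x + 1)"
  using alu_val_word(4)[of b 1 k] alu_val_word(2)[of b x 1] alu_val_word(1)[of b x 1]
  by simp_all

lemma word_of_F: "word_of b (2 ^ \<beta> - 1) = F"
proof -
  have "(2::int) ^ \<beta> - 1 = int F"
    using arg_cong[OF two_\<beta>, of int] by simp
  then show ?thesis using word_of_int_eq[of F b] small(4) by simp
qed

lemma high_address:
  assumes "node k m" "\<not> \<beta> * k < thr" "i \<le> F"
  shows "alu_val b Add (alu_val b Shl (vertex (Suc k) m) \<beta>) i = vertex (Suc k) m * 2 ^ \<beta> + i"
  using vertex_child_less[OF assms] by (simp add: alu_val_shl alu_val_add)

lemma prologue_ok:
  assumes "params_ok M"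
    and "\<And>R'. const_regs R' \<Longrightarrow> (\<And>r. r < 20 \<Longrightarrow> R' r = R r) \<Longrightarrow> Q R' M"
  shows "wp b prologue Q R M"
proof -
  have 1: "take_bit b (Suc 0) = Suc 0" using small(1) take_bit_nat_eq_self[of 1 b] by simp
  have 2: "alu_val b Sub w 1 = w - 1" "alu_val b Sub F 1 = F - 1"
    using small w_ge F_ge by (simp_all add: alu_val_diff)
  have 3: "alu_val b Mul (F - 1) w = w * (F - 1)"
    using small(6)[of "F - 1"] by (simp add: alu_val_mult mult.commute)
  have 4: "pack w F (\<lambda>_. 1) * 2 ^ (w - 1) = pack w F (\<lambda>_. 2 ^ (w - 1))"
    using pack_mult[of w F "2 ^ (w - 1)" "\<lambda>_. 1"] by simp
  have "b \<noteq> 0" using \<delta> by simp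
  then show ?thesis
    unfolding prologue_def
    using assms(1)
    by (simp add: params_ok_def take_bit_nat_eq_self small \<beta>D_less 1 2[simplified] 3[simplified] 4[simplified] alu_val_1[simplified] word_of_F alu_val_word assms(2) const_regs_def)
qed

lemma child_prefix_ok:
  assumes "bounded A" "node k m" "node_ok A k m M" "const_regs R"
    and "R 3 = vertex (Suc k) m" "R 4 \<le> F" "R 5 = M 1 (R 3)" "R 6 = \<beta> * k"
    and "\<And>R'. (\<And>r. r < 100 \<Longrightarrow> R' r = R r) \<Longrightarrow> R' 101 = word_of b (S A (\<beta> * k) m (R 4)) \<Longrightarrow> Q R' M"
  shows "wp b child_prefix Q R M"
proof (cases "R 4")
  note c = assms(4)[unfolded const_regs_def]
  case 0
  then show ?thesis unfolding child_prefix_def by (simp add: c assms(9))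
next
  note c = assms(4)[unfolded const_regs_def]
  case (Suc f)
  then have f: "f < F" using assms(6) by simp
  have c1: "alu_val b Sub (Suc f) (Suc 0) = f"
    using small(4) f by (simp add: alu_val_diff)
  have c2: "alu_val b Mul w f = w * f" using small(6) f by (simp add: alu_val_mult)
  show ?thesis
  proof (cases "\<beta> * k < thr")
    case True
    then have M: "M (Suc 0) (vertex (Suc k) m) = word_of b (pack w F (\<lambda>f. S A (\<beta> * k) m (Suc f)))"
      using assms(3,5) by (simp add: node_ok_def)
    note e = extract_low[OF assms(1,2) True f]
    show ?thesis
      unfolding child_prefix_def
      by (simp add: c assms(5-8) Suc True c1 c2 M alu_val_word alu_val_mask w_le assms(9) e[simplified])
  next
    case False
    then obtain c' K where h: "high_node A k m M c' K"
      using assms(3) by (auto simp: node_ok_def)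
    then have M: "M (Suc 0) (vertex (Suc k) m) = word_of b (pack w F c')"
      and V: "M 3 (vertex (Suc k) m * 2 ^ \<beta> + Suc f) = word_of b (S A (\<beta> * k) m (Suc f) - c' f)"
      and r: "M 4 (vertex (Suc k) m) < F"
      using f by (simp_all add: high_node_def)
    have "\<bar>c' g\<bar> \<le> int F * 2 ^ \<delta>" if "g < F" for g
    proof -
      have "int (age g (M 4 (vertex (Suc k) m))) * 2 ^ \<delta> \<le> int F * 2 ^ \<delta>"
        using age_less[OF that r] by (intro mult_right_mono) auto
      moreover have "\<bar>c' g\<bar> \<le> int (age g (M 4 (vertex (Suc k) m))) * 2 ^ \<delta>"
        using h that by (simp add: high_node_def)
      ultimately show ?thesis by linarith
    qed
    note e = extract_high[OF assms(2) False f this]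
    have a: "alu_val b Add (alu_val b Shl (vertex (Suc k) m) \<beta>) (Suc f) = vertex (Suc k) m * 2 ^ \<beta> + Suc f"
      using high_address[OF assms(2) False, of "Suc f"] f by simp
    show ?thesis
      unfolding child_prefix_def
      by (simp add: c assms(5-8) Suc False c1 c2 M alu_val_word alu_val_mask w_le assms(9) e[simplified] V[simplified] a[simplified])
  qed
qed

end


section \<open>Selecting a child\<close>

lemma div_power_bounds:
  fixes x :: int
  shows "x div 2 ^ s * 2 ^ s \<le> x" "x < (x div 2 ^ s + 1) * 2 ^ s"
proof -
  have "0 \<le> x mod 2 ^ s" "x mod 2 ^ s < 2 ^ s" by simp_all
  then show "x div 2 ^ s * 2 ^ s \<le> x" "x < (x div 2 ^ s + 1) * 2 ^ s"
    using div_mult_mod_eq[of x "2 ^ s"] unfolding distrib_right by linarith+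
qed

context tree
begin

definition positive :: "(nat \<Rightarrow> int) \<Rightarrow> bool" where
  "positive A \<longleftrightarrow> (\<forall>i\<in>{1..n}. 0 < A i)"

lemma psum_mono:
  assumes "positive A" "u \<le> t" "t \<le> n"
  shows "psum A u + int (t - u) \<le> psum A t"
  using psum_diff_ge[of u t A] assms by (auto simp: positive_def)

lemma psum_total: "bounded A \<Longrightarrow> psum A n < 2 ^ (b - 1)"
  using n by (auto simp: bounded_def fits_def)

lemma S_mono: "positive A \<Longrightarrow> i \<le> j \<Longrightarrow> S A s m i \<le> S A s m j"
proof -
  assume *: "positive A" "i \<le> j"
  have "min n ((m * 2 ^ \<beta> + i) * 2 ^ s) \<le> min n ((m * 2 ^ \<beta> + j) * 2 ^ s)"
    using *(2) by (intro min.mono mult_le_mono1) auto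
  from psum_mono[OF *(1) this] show ?thesis by (simp add: S_def pre_def)
qed

lemma S_nonneg: "positive A \<Longrightarrow> 0 \<le> S A s m i"
  using S_mono[of A 0 i s m] by simp

lemma S_total: "positive A \<Longrightarrow> S A s m i \<le> psum A n"
proof -
  assume *: "positive A"
  have "psum A (min n ((m * 2 ^ \<beta> + i) * 2 ^ s)) \<le> psum A n"
    using psum_mono[OF *, of "min n ((m * 2 ^ \<beta> + i) * 2 ^ s)" n] by simp
  moreover have "0 \<le> psum A (min n (m * 2 ^ \<beta> * 2 ^ s))"
    using psum_mono[OF *, of 0 "min n (m * 2 ^ \<beta> * 2 ^ s)"] by (simp add: psum_def)
  ultimately show ?thesis by (simp add: S_def pre_def)
qed

lemma S_word: "bounded A \<Longrightarrow> positive A \<Longrightarrow> 0 \<le> S A s m i \<and> S A s m i < 2 ^ (b - 1)"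
  using S_total[of A s m i] S_nonneg[of A s m i] psum_total[of A] by linarith

text \<open>The strict inequality with some \<open>j'\<close> shows that the first \<open>j\<close>
  children end inside the array: past its end the prefix sums are constant and maximal. Hence each
  child from \<open>i\<close> up to \<open>j\<close> has all of its \<open>2 ^ s\<close> leaves, and
  each leaf contributes at least 1.\<close>

lemma S_gap:
  assumes "positive A" "i \<le> j" "S A s m j < S A s m j'"
  shows "int (j - i) * 2 ^ s \<le> S A s m j - S A s m i"
proof -
  have "(m * 2 ^ \<beta> + j) * 2 ^ s \<le> n"
  proof (rule ccontr)
    assume "\<not> ?thesis"
    then have "pre A s (m * 2 ^ \<beta> + j) = psum A n" by (simp add: pre_def)
    moreover have "pre A s (m * 2 ^ \<beta> + j') \<le> psum A n"
      using psum_mono[OF assms(1), of "min n ((m * 2 ^ \<beta> + j') * 2 ^ s)" n] by (simp add: pre_def)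
    ultimately show False using assms(3) by (simp add: S_def)
  qed
  moreover have "(m * 2 ^ \<beta> + i) * 2 ^ s \<le> (m * 2 ^ \<beta> + j) * 2 ^ s"
    using assms(2) by (intro mult_le_mono1) simp
  moreover have "int ((m * 2 ^ \<beta> + j) * 2 ^ s - (m * 2 ^ \<beta> + i) * 2 ^ s) = int (j - i) * 2 ^ s"
    using assms(2) by (simp add: diff_mult_distrib[symmetric])
  ultimately show ?thesis
    using psum_mono[OF assms(1), of "(m * 2 ^ \<beta> + i) * 2 ^ s" "(m * 2 ^ \<beta> + j) * 2 ^ s"]
    unfolding S_def pre_def by (simp only: min_absorb2 le_trans[of _ "(m * 2 ^ \<beta> + j) * 2 ^ s" n] True_implies_equals)
qed

lemma select_child:
  assumes "positive A" "0 < \<sigma>" "\<sigma> \<le> S A s m (2 ^ \<beta>)"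
  obtains c where "c \<le> F" "\<And>i. S A s m i < \<sigma> \<longleftrightarrow> i \<le> c"
proof
  define l where "l = (LEAST i. \<sigma> \<le> S A s m i)"
  have l: "\<sigma> \<le> S A s m l" "l \<le> 2 ^ \<beta>"
    unfolding l_def using assms(3) by (auto intro: LeastI Least_le)
  have "l \<noteq> 0" using l(1) assms(2) by (cases "l = 0") auto
  then show "l - 1 \<le> F" using l(2) two_\<beta> by simp
  show "S A s m i < \<sigma> \<longleftrightarrow> i \<le> l - 1" for i
  proof (cases "i < l")
    case True
    then show ?thesis using not_less_Least[of i "\<lambda>i. \<sigma> \<le> S A s m i"] by (auto simp: l_def)
  next
    case False
    then show ?thesis using S_mono[OF assms(1), of l i s m] l(1) \<open>l \<noteq> 0\<close> by auto
  qed
qed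

text \<open>
  A key is off by less than two units of \<open>2 ^ s\<close>, while consecutive prefix sums below \<open>\<sigma>\<close> differ by
  at least one unit; so only a bounded number of children is missed by comparing keys.
\<close>

lemma rank_high:
  assumes "positive A" "0 < \<sigma>" "\<sigma> \<le> S A s m (2 ^ \<beta>)"
    and c: "c \<le> F" "\<And>i. S A s m i < \<sigma> \<longleftrightarrow> i \<le> c"
    and e: "\<And>f. f < F \<Longrightarrow> \<bar>e f\<bar> < 2 ^ s"
    and K: "\<And>f. f < F \<Longrightarrow> (K f - 1) * 2 ^ s \<le> S A s m (Suc f) - e f \<and> S A s m (Suc f) - e f \<le> K f * 2 ^ s"
  defines "r \<equiv> card {f. f < F \<and> K f < \<sigma> div 2 ^ s}"
  shows "r \<le> c \<and> c \<le> r + 3"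
proof -
  define q where "q = \<sigma> div 2 ^ s"
  have q: "q * 2 ^ s \<le> \<sigma>" "\<sigma> < (q + 1) * 2 ^ s"
    unfolding q_def by (rule div_power_bounds)+
  let ?R = "{f. f < F \<and> K f < q}"
  define T where "T = {..<c} - ?R"
  have sub: "?R \<subseteq> {..<c}"
  proof
    fix f assume "f \<in> ?R"
    then have f: "f < F" and "K f + 1 \<le> q" by auto
    then have "(K f + 1) * 2 ^ s \<le> q * 2 ^ s" by (intro mult_right_mono) auto
    then have "S A s m (Suc f) < \<sigma>"
      using K[OF f] e[OF f] q(1) unfolding distrib_right by linarith
    then show "f \<in> {..<c}" using c(2) by simp
  qed
  \<comment> \<open>The children missed have prefix sums in an open interval of length
    \<open>3 * 2 ^ s\<close>: of the two units below \<open>q\<close>, one is lost by rounding the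
    key and one by the correction, and the unit above by rounding \<open>\<sigma>\<close>. By
    \<open>S_gap\<close> at most three fit, hence three runs of \<open>advance\<close>.\<close>
  have T: "(q - 2) * 2 ^ s < S A s m (Suc f)" "S A s m (Suc f) < (q + 1) * 2 ^ s" if "f \<in> T" for f
  proof -
    have f: "f < F" "f < c" "q \<le> K f" using that c(1) by (auto simp: T_def)
    then have "(q - 1) * 2 ^ s \<le> (K f - 1) * 2 ^ s" by (intro mult_right_mono) auto
    then show "(q - 2) * 2 ^ s < S A s m (Suc f)"
      using K[OF f(1)] e[OF f(1)] unfolding left_diff_distrib by linarith
    show "S A s m (Suc f) < (q + 1) * 2 ^ s"
      using c(2)[of "Suc f"] f q(2) by simp
  qed
  have "card T \<le> 3"
  proof (cases "T = {}")
    case False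
    have fin: "finite T" by (simp add: T_def)
    define a where "a = Min T"
    have a: "a \<in> T" using False fin by (simp add: a_def)
    have "T \<subseteq> {a..a + 2}"
    proof
      fix f assume f: "f \<in> T"
      have le: "a \<le> f" using f fin by (simp add: a_def)
      have "Suc f \<le> c" using f by (simp add: T_def)
      then have "S A s m (Suc f) < S A s m (2 ^ \<beta>)" using c(2)[of "Suc f"] assms(3) by simp
      from S_gap[OF assms(1) _ this, of "Suc a"] le
      have "int (f - a) * 2 ^ s \<le> S A s m (Suc f) - S A s m (Suc a)" by simp
      also have "\<dots> < 3 * 2 ^ s"
        using T[OF f] T[OF a] unfolding left_diff_distrib distrib_right by linarith
      finally have "int (f - a) < 3" by simp
      then show "f \<in> {a..a + 2}" using le by auto
    qed
    then have "card T \<le> card {a..a + 2}" by (intro card_mono) auto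
    then show ?thesis by simp
  qed simp
  moreover have "card T = c - card ?R" "card ?R \<le> c"
    unfolding T_def using sub card_mono[OF _ sub] by (simp_all add: card_Diff_subset finite_subset)
  ultimately show ?thesis unfolding r_def q_def[symmetric] by linarith
qed

text \<open>The first bound limits the keys. The second prevents \<open>2 ^ s\<close> plus a prefix
  sum with a pending correction from wrapping around. It rests on positivity:
  \<open>n \<le> psum A n < 2 ^ (b - 1)\<close>, while a child of a node has fewer than
  \<open>n\<close> leaves.\<close>

lemma S_high:
  assumes "bounded A" "positive A" "node k m" "\<not> \<beta> * k < thr" "i \<le> 2 ^ \<beta>"
  shows "S A (\<beta> * k) m i \<le> 2 ^ (\<beta> * k) * 2 ^ (\<delta> + \<beta> - 1)"
    and "S A (\<beta> * k) m i + 2 * 2 ^ (\<beta> * k) < 2 ^ b"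
proof -
  have "int i * 2 ^ (\<beta> * k) * 2 ^ (\<delta> - 1) \<le> 2 ^ \<beta> * 2 ^ (\<beta> * k) * 2 ^ (\<delta> - 1)"
    using assms(5) by (intro mult_right_mono) (simp_all flip: of_nat_le_iff)
  also have "\<dots> = 2 ^ (\<beta> * k) * 2 ^ (\<delta> + \<beta> - 1)"
    using \<delta> by (simp flip: power_add)
  finally show "S A (\<beta> * k) m i \<le> 2 ^ (\<beta> * k) * 2 ^ (\<delta> + \<beta> - 1)"
    using S_bound[OF assms(1), of "\<beta> * k" m i] by linarith
  have "k < D" using assms(3) by (simp add: node_def)
  then have "(2::nat) ^ (\<beta> * k) \<le> 2 ^ (\<beta> * (D - 1))" by (intro power_increasing mult_le_mono2) auto
  also have "\<dots> < n" using D_ge \<open>k < D\<close> by simp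
  finally have "int (2 ^ (\<beta> * k)) < int n" by (simp only: of_nat_less_iff)
  also have "int n < 2 ^ (b - 1)"
  proof -
    have "psum A 0 = 0" by (simp add: psum_def)
    then show ?thesis
      using psum_mono[OF assms(2), of 0 n, simplified] psum_total[OF assms(1)] by linarith
  qed
  finally have "\<beta> * k < b - 1" by simp
  then have "(2::int) ^ Suc (\<beta> * k) \<le> 2 ^ (b - 1)" by (intro power_increasing) auto
  moreover have "(2::int) ^ b = 2 * 2 ^ (b - 1)" using \<delta> by (simp add: power_eq_if)
  ultimately show "S A (\<beta> * k) m i + 2 * 2 ^ (\<beta> * k) < 2 ^ b"
    using S_word[OF assms(1,2), of "\<beta> * k" m i] by simp
qed

text \<open>Positivity now confines the prefix sum, hence also the stored difference, to a range in
  which both reductions in \<open>key\<close> are the identity. No history enters, so earlier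
  negative elements do no harm.\<close>

lemma high_node_keys:
  assumes "bounded A" "positive A" "node k m" "\<not> \<beta> * k < thr" "high_node A k m M c K" "f < F"
  shows "\<bar>c f\<bar> < 2 ^ (\<beta> * k)"
    and "(K f - 1) * 2 ^ (\<beta> * k) \<le> S A (\<beta> * k) m (Suc f) - c f"
    and "S A (\<beta> * k) m (Suc f) - c f \<le> K f * 2 ^ (\<beta> * k)"
    and "0 \<le> K f" "K f < 2 ^ (w - 1)"
proof -
  define s where "s = \<beta> * k"
  define v where "v = S A s m (Suc f) - c f"
  note h = assms(5)[unfolded high_node_def, folded s_def]
  have "\<bar>c f\<bar> \<le> int (age f (M 4 (vertex (Suc k) m))) * 2 ^ \<delta>" using h assms(6) by blast
  moreover have "age f (M 4 (vertex (Suc k) m)) \<le> F"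
    using age_less[of f "M 4 (vertex (Suc k) m)"] h assms(6) by auto
  ultimately show c: "\<bar>c f\<bar> < 2 ^ (\<beta> * k)"
    using age_bound(2)[OF assms(3,4)] by (meson le_less_trans)
  have i: "Suc f \<le> 2 ^ \<beta>" using assms(6) two_\<beta> by simp
  note S = S_high[OF assms(1-4) i, folded s_def]
  have v: "0 \<le> 2 ^ s + v" "2 ^ s + v < 2 ^ b" "2 ^ s + v < 2 ^ s * (2 ^ (\<delta> + \<beta> - 1) + 2)"
    using c S S_nonneg[OF assms(2), of s m "Suc f"] unfolding v_def s_def distrib_left by linarith+
  have t: "(2::int) ^ (\<delta> + \<beta> - 1) + 2 \<le> 2 ^ (w - 1)"
  proof -
    have "(2::int) ^ 1 \<le> 2 ^ (\<delta> + \<beta> - 1)" using \<delta> \<beta> by (intro power_increasing) auto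
    then have "(2::int) ^ (\<delta> + \<beta> - 1) + 2 \<le> 2 ^ Suc (\<delta> + \<beta> - 1)" by simp
    also have "\<dots> \<le> 2 ^ (w - 1)"
      using high_mode(1)[OF assms(3,4)] \<delta> \<beta> by (intro power_increasing) auto
    finally show ?thesis .
  qed
  have "(2 ^ s + v) div 2 ^ s < 2 ^ (\<delta> + \<beta> - 1) + 2"
  proof -
    have "(2 ^ s + v) div 2 ^ s * 2 ^ s < (2 ^ (\<delta> + \<beta> - 1) + 2) * 2 ^ s"
      using le_less_trans[OF div_power_bounds(1) v(3)] by (simp only: mult.commute)
    then show ?thesis by (rule mult_right_less_imp_less) simp
  qed
  then have d: "(2 ^ s + v) div 2 ^ s < 2 ^ (w - 1)" "0 \<le> (2 ^ s + v) div 2 ^ s"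
    using t pos_imp_zdiv_nonneg_iff[THEN iffD2, OF _ v(1), of "2 ^ s"] by (linarith, simp)
  moreover have "(2::int) ^ (w - 1) < 2 ^ w" using w_ge by (intro power_strict_increasing) auto
  ultimately have key: "key s v = (2 ^ s + v) div 2 ^ s"
    unfolding key_def mod_pos_pos_trivial[OF v(1,2)] by (intro mod_pos_pos_trivial) linarith+
  have bounds: "(key s v - 1) * 2 ^ s \<le> v" "v \<le> key s v * 2 ^ s"
    using div_power_bounds[where x = "2 ^ s + v" and s = s]
    unfolding key left_diff_distrib distrib_right by linarith+
  \<comment> \<open>A blank field has key 0, not the 1 that \<open>key\<close> gives for the value
    0, but 0 satisfies both inequalities as well.\<close>
  have K: "K f = key s v \<or> K f = 0 \<and> v = 0"
    using h assms(6) unfolding v_def by auto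
  show "(K f - 1) * 2 ^ (\<beta> * k) \<le> S A (\<beta> * k) m (Suc f) - c f"
    and "S A (\<beta> * k) m (Suc f) - c f \<le> K f * 2 ^ (\<beta> * k)"
    using K bounds unfolding v_def s_def by auto
  show "0 \<le> K f" "K f < 2 ^ (w - 1)"
    using K d key by auto
qed

end


section \<open>Sum and select\<close>

definition descend :: com where
  "descend = Do [Alu Sub 6 6 22, Alu Shr 4 2 6, Alu And 4 4 24, Load 5 1 3]"

definition child :: com where
  "child = Do [Alu Shl 3 3 22, Alu Add 3 3 4]"

text \<open>The element \<open>A[k]\<close> is taken from array 0 and the path leads to leaf
  \<open>k - 1\<close>, which exists even if \<open>k = n\<close> fills the tree. For
  \<open>k = 0\<close> the level is set to 0 and the loop is skipped.\<close>

definition sum_start :: com where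
  "sum_start =
     Cond 21 0 (Do [Load 8 0 0, Alu Sub 2 0 20, Alu Add 6 32 21, Alu Add 3 20 21])
       (Do [Const 8 0, Const 6 0])"

definition sum_body :: com where
  "sum_body = descend ;; child_prefix ;; Do [Alu Add 8 8 101] ;; child"

definition sum_com :: com where
  "sum_com = (prologue ;; sum_start) ;; (While 21 6 sum_body ;; Do [Alu Add 0 8 21])"

text \<open>The comparison of \<open>pack_rank\<close>, with the keys in register 10 and the bound
  in register 11, followed by the summation of \<open>pack_count\<close>, whose result is read from
  field \<open>F - 1\<close>.\<close>

definition rank :: com where
  "rank = Do [Alu Sub 11 11 20, Alu Mul 11 11 28, Alu Add 11 27 11, Alu Sub 11 11 10,
     Alu Shr 11 11 30, Alu And 11 11 28, Alu Mul 11 11 28, Alu Shr 11 11 31, Alu And 12 11 25]"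

text \<open>Register 12 holds a candidate child that is never too far right; it moves one sibling to
  the right if the prefix before that sibling is still below the rank sought.\<close>

definition advance :: com where
  "advance =
     Cond 12 24
       (Do [Alu Add 4 12 20] ;; child_prefix ;; Cond 101 0 (Do [Alu Add 12 4 21]) (Do []))
       (Do [])"

text \<open>Register 0 holds the rank relative to the current node. The prefix is computed afresh
  before the subtraction because the last \<open>advance\<close> may have left that of a rejected
  sibling in register 101.\<close>

definition select_body :: com where
  "select_body =
     Do [Alu Sub 6 6 22, Load 5 1 3] ;;
     Cond 6 29 (Do [Alu Add 10 5 21, Alu Add 11 0 21]) (Do [Load 10 2 3, Alu Shr 11 0 6]) ;;
     rank ;; advance ;; advance ;; advance ;;
     Do [Alu Add 4 12 21] ;; child_prefix ;; Do [Alu Sub 0 0 101] ;; child"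

definition select_com :: com where
  "select_com =
     (prologue ;; Do [Alu Add 6 32 21, Alu Add 3 20 21]) ;;
     (While 21 6 select_body ;; Do [Alu Shl 100 20 32, Alu Sub 0 3 100, Alu Add 0 0 20])"

section \<open>Correctness of prefix sums\<close>

context tree
begin

definition mem_ok :: "(nat \<Rightarrow> int) \<Rightarrow> memory \<Rightarrow> bool" where
  "mem_ok A M \<longleftrightarrow> params_ok M \<and> bounded A \<and> (\<forall>k\<in>{1..n}. M 0 k = word_of b (A k)) \<and>
     (\<forall>k m. node k m \<longrightarrow> node_ok A k m M)"

lemma and_F: "x < 2 ^ b \<Longrightarrow> alu_val b And x F = x mod 2 ^ \<beta>"
proof -
  assume "x < 2 ^ b"
  then have "x mod 2 ^ \<beta> < 2 ^ b" by (meson le_less_trans mod_less_eq_dividend)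
  moreover have "and x F = x mod 2 ^ \<beta>"
    by (metis F_def mask_eq_exp_minus_1 take_bit_eq_mask take_bit_eq_mod)
  ultimately show ?thesis by (simp only: alu_val_def alu_result.simps take_bit_nat_eq_self)
qed

lemma node_ok_word: "node_ok A k m M \<Longrightarrow> take_bit b (M 1 (vertex (Suc k) m)) = M 1 (vertex (Suc k) m)"
  by (auto simp: node_ok_def high_node_def split: if_splits)

lemma path_node:
  assumes "p < n" "k < D"
  shows "node k (p div 2 ^ (\<beta> * Suc k))"
proof -
  have "\<beta> * D = \<beta> * Suc k + \<beta> * (D - Suc k)"
    using assms(2) by (simp add: add_mult_distrib2[symmetric] del: mult_Suc_right)
  then have "p < 2 ^ (\<beta> * Suc k) * 2 ^ (\<beta> * (D - Suc k))"
    using assms(1) D_le by (simp add: power_add[symmetric] del: mult_Suc_right)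
  then show ?thesis
    using assms(2) by (simp add: node_def less_mult_imp_div_less mult.commute del: mult_Suc_right)
qed

lemma path_child: "(p::nat) div 2 ^ (\<beta> * k) = p div 2 ^ (\<beta> * Suc k) * 2 ^ \<beta> + p div 2 ^ (\<beta> * k) mod 2 ^ \<beta>"
proof -
  have "p div 2 ^ (\<beta> * Suc k) = p div 2 ^ (\<beta> * k) div 2 ^ \<beta>"
    by (simp add: power_add mult.commute[of "2 ^ \<beta>"] div_mult2_eq)
  then show ?thesis using div_mult_mod_eq by metis
qed

lemma \<beta>k_step: "k < D \<Longrightarrow> alu_val b Sub (\<beta> * Suc k) \<beta> = \<beta> * k"
proof -
  assume "k < D"
  then have "\<beta> * Suc k \<le> \<beta> * D" by (intro mult_le_mono2) simp
  then have "\<beta> * Suc k < 2 ^ b" using \<beta>D_less by linarith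
  then show ?thesis by (simp add: alu_val_diff)
qed

lemma descend_ok:
  assumes "const_regs R" "k < D" "p < n" "R 2 = p" "R 6 = \<beta> * Suc k" "R 3 = vertex (Suc k) m"
    "node_ok A k m M"
    and "Q (R(6 := \<beta> * k, 4 := p div 2 ^ (\<beta> * k) mod 2 ^ \<beta>, 5 := M 1 (R 3))) M"
  shows "wp b descend Q R M"
proof -
  note c = assms(1)[unfolded const_regs_def]
  have p: "p < 2 ^ b" using assms(3) n by simp
  moreover have "p div 2 ^ (\<beta> * k) < 2 ^ b" using p by (meson div_le_dividend le_less_trans)
  ultimately show ?thesis
    using assms(8) node_ok_word[OF assms(7)]
    unfolding descend_def
    by (simp add: c assms(2-6) \<beta>k_step[simplified] and_F alu_val_shr)
qed

text \<open>The number of a leaf may exceed a word, so the register is only said to hold its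
  residue; at inner nodes \<open>word_of_vertex\<close> recovers the number.\<close>

lemma child_ok:
  assumes "const_regs R" "k < D" "R 3 = vertex (Suc k) m" "node k m" "R 4 \<le> F"
    and "Q (R(3 := word_of b (int (vertex k (m * 2 ^ \<beta> + R 4))))) M"
  shows "wp b child Q R M"
proof -
  note c = assms(1)[unfolded const_regs_def]
  have 1: "alu_val b Shl (vertex (Suc k) m) \<beta> = word_of b (int (vertex (Suc k) m * 2 ^ \<beta>))"
    using alu_val_word(4)[of b "int (vertex (Suc k) m)" \<beta>] vertex_less[OF assms(4)]
    by (simp add: word_of_int_eq)
  have "word_of b (int (R 4)) = R 4" using assms(5) small(4) by (intro word_of_int_eq) simp
  then have 2: "alu_val b Add (word_of b x) (R 4) = word_of b (x + int (R 4))" for x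
    using alu_val_word(1)[of b x "int (R 4)"] by simp
  show ?thesis
    using assms(6) unfolding child_def vertex_child[OF assms(2), symmetric]
    by (simp add: c assms(3) 1[simplified] 2[simplified])
qed

lemma word_of_vertex: "node k m \<Longrightarrow> word_of b (int (vertex (Suc k) m)) = vertex (Suc k) m"
  by (simp add: word_of_int_eq vertex_less)

lemma alu_add_0 [simp]: "x < 2 ^ b \<Longrightarrow> alu_val b Add x 0 = x"
  by (simp add: alu_val_add)

definition sum_inv :: "(nat \<Rightarrow> int) \<Rightarrow> memory \<Rightarrow> nat \<Rightarrow> int \<Rightarrow> nat \<Rightarrow> registers \<Rightarrow> memory \<Rightarrow> bool" where
  "sum_inv A M0 p a k R M \<longleftrightarrow> M = M0 \<and> const_regs R \<and> k \<le> D \<and> R 2 = p \<and> R 6 = \<beta> * k \<and>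
     R 3 = word_of b (int (vertex k (p div 2 ^ (\<beta> * k)))) \<and>
     R 8 = word_of b (a + pre A (\<beta> * k) (p div 2 ^ (\<beta> * k)))"

lemma sum_body_ok:
  assumes "mem_ok A M0" "p < n" "sum_inv A M0 p a (Suc k) R M"
  shows "wp b sum_body (sum_inv A M0 p a k) R M"
proof -
  define m where "m = p div 2 ^ (\<beta> * Suc k)"
  define i where "i = p div 2 ^ (\<beta> * k) mod 2 ^ \<beta>"
  note inv = assms(3)[unfolded sum_inv_def, folded m_def]
  have k: "k < D" using inv by simp
  have node: "node k m" unfolding m_def using path_node[OF assms(2) k] .
  have ok: "node_ok A k m M" and bd: "bounded A" using assms(1) node inv by (auto simp: mem_ok_def)
  have i: "i \<le> F" using two_\<beta> by (simp add: i_def flip: less_Suc_eq_le)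
  have R3: "R 3 = vertex (Suc k) m" using inv word_of_vertex[OF node] by simp
  have child: "p div 2 ^ (\<beta> * k) = m * 2 ^ \<beta> + i" unfolding m_def i_def by (rule path_child)
  have pre: "pre A (\<beta> * k) (m * 2 ^ \<beta> + i) = pre A (\<beta> * Suc k) m + S A (\<beta> * k) m i"
    using pre_child[of A "\<beta> * k" m i] by (simp add: add.commute)
  show ?thesis
    unfolding sum_body_def wp.simps
    apply (rule descend_ok[where R = R and p = p, OF _ k assms(2) _ _ R3 ok])
    using inv apply (simp_all)[3]
    unfolding i_def[symmetric]
    apply (rule child_prefix_ok[OF bd node ok])
    using inv R3 i apply (simp_all add: const_regs_def)[5]
    apply (simp only: wp_block.simps)
    apply (rule child_ok[OF _ k _ node])
    using inv R3 i apply (simp_all add: const_regs_def)[3]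
    using inv R3 i k apply (simp add: sum_inv_def const_regs_def child pre alu_val_word add.assoc)
    done
qed

lemma sum_ok:
  assumes "mem_ok A M" "k \<le> n" "R 0 = k" 
  shows "wpt b sum_com (len (prologue ;; sum_start) + ((D * (len sum_body + 2) + 2) + len (Do [Alu Add 0 8 21])))
    (\<lambda>R' M'. M' = M \<and> R' 0 = word_of b (psum A k)) R M"
proof -
  define p where "p = k - 1"
  define a where "a = (if k = 0 then 0 else A k)"
  have p: "p < n" using assms(2) n by (auto simp: p_def)
  have par: "params_ok M" using assms(1) by (simp add: mem_ok_def)
  define d where "d = (if k = 0 then 0 else D)"
  define Q where "Q = (if k = 0 then (\<lambda>R M'. M' = M \<and> const_regs R \<and> R 6 = 0 \<and> R 8 = 0) else sum_inv A M p a D)"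
  have "wp b (prologue ;; sum_start) Q R M"
    unfolding wp.simps
  proof (rule prologue_ok[OF par])
    fix R' assume R': "const_regs R'" "\<And>r. r < 20 \<Longrightarrow> R' r = R r"
    have "p < 2 ^ (\<beta> * D)" using p D_le by linarith
    moreover have "k \<noteq> 0 \<Longrightarrow> M 0 k = word_of b (A k)" using assms by (auto simp: mem_ok_def)
    moreover have "k < 2 ^ b" using assms(2) n by simp
    moreover have "k \<noteq> 0 \<Longrightarrow> alu_val b Sub k (Suc 0) = k - 1" using \<open>k < 2 ^ b\<close> by (simp add: alu_val_diff)
    ultimately show "wp b sum_start Q R' M"
      using R' assms(3) \<beta>D_less small(1) unfolding sum_start_def Q_def
      by (auto simp: sum_inv_def const_regs_def p_def a_def vertex_def pre_def psum_def)
  qed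
  then have 1: "wpt b (prologue ;; sum_start) (len (prologue ;; sum_start)) Q R M"
    by (rule wp_imp_wpt)
  have 2: "wpt b (While 21 6 sum_body) (D * (len sum_body + 2) + 2)
      (\<lambda>R M'. M' = M \<and> const_regs R \<and> R 8 = word_of b (psum A k)) R M'" if "Q R M'" for R M'
  proof (cases "k = 0")
    case True
    define I where "I j R M' \<longleftrightarrow> j = 0 \<and> M' = M \<and> const_regs R \<and> R 6 = 0 \<and> R 8 = 0" for j :: nat and R M'
    have "I 0 R M'" using that True by (simp add: Q_def I_def)
    then have "wpt b (While 21 6 sum_body) (0 * (0 + 2) + 2) (I 0) R M'"
      by (rule wpt_While[where Inv = I]) (simp_all add: I_def const_regs_def)
    then show ?thesis
      using True by (elim wpt_weaken) (auto simp: I_def psum_def)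
  next
    case False
    then have "sum_inv A M p a D R M'" using that by (simp add: Q_def)
    then have "wpt b (While 21 6 sum_body) (D * (len sum_body + 2) + 2) (sum_inv A M p a 0) R M'"
    proof (rule wpt_While[where Inv = "sum_inv A M p a"])
      fix k R M' assume *: "sum_inv A M p a (Suc k) R M'"
      show "R 21 < R 6 \<and> wpt b sum_body (len sum_body) (sum_inv A M p a k) R M'"
        using sum_body_ok[OF assms(1) p *] * \<beta> by (auto simp: sum_inv_def const_regs_def intro: wp_imp_wpt)
    next
      fix R M' assume "sum_inv A M p a 0 R M'"
      then show "\<not> R 21 < R 6" by (simp add: sum_inv_def const_regs_def)
    qed
    moreover have "a + psum A p = psum A k" using False by (cases k) (auto simp: a_def p_def psum_def)
    ultimately show ?thesis
      using p by (elim wpt_weaken) (auto simp: sum_inv_def pre_def)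
  qed
  have 3: "wpt b (Do [Alu Add 0 8 21]) (len (Do [Alu Add 0 8 21]))
      (\<lambda>R' M'. M' = M \<and> R' 0 = word_of b (psum A k)) R M'"
    if "M' = M \<and> const_regs R \<and> R 8 = word_of b (psum A k)" for R M'
    by (rule wp_imp_wpt) (use that in \<open>simp add: const_regs_def word_of_less\<close>)
  show ?thesis
    unfolding sum_com_def by (intro wpt_Seq[OF 1] wpt_Seq[OF 2] 3)
qed

end

section \<open>Correctness of selection\<close>

context tree
begin

lemma rank_ok:
  assumes c: "const_regs R" and R: "R 10 = word_of b (pack w F K)" "R 11 = word_of b q"
    and q: "0 \<le> q" "q \<le> 2 ^ (w - 1)"
    and K: "\<And>f. f < F \<Longrightarrow> 0 \<le> K f \<and> K f < 2 ^ (w - 1)"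
    and Q: "\<And>x. Q (R(11 := x, 12 := card {f. f < F \<and> K f < q})) M"
  shows "wp b rank Q R M"
proof -
  note c = c[unfolded const_regs_def]
  define B where "B = pack w F (\<lambda>f. of_bool (K f < q))"
  have 1: "alu_val b And (word_of b ((pack w F (\<lambda>_. 2 ^ (w - 1)) + (q - 1) * pack w F (\<lambda>_. 1) - pack w F K) mod 2 ^ b
      div 2 ^ (w - 1))) (word_of b (pack w F (\<lambda>_. 1))) = word_of b B"
    unfolding alu_val_def alu_result.simps B_def
    by (rule pack_rank[OF w_ge wF_le q K])
  have "w * (F - 1) + w \<le> b"
    using wF_le F_ge by (simp add: right_diff_distrib')
  then have "B * pack w F (\<lambda>_. 1) mod 2 ^ b div 2 ^ (w * (F - 1)) mod 2 ^ w =
      (\<Sum>f<F. of_bool (K f < q))"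
    unfolding B_def by (subst div_mod_window) (use pack_count[of F _ w, OF _ F_ge F_less] in auto)
  also have "\<dots> = int (card {f. f < F \<and> K f < q})"
    by (simp add: sum.If_cases of_bool_def Int_def)
  finally have 2: "B * pack w F (\<lambda>_. 1) mod 2 ^ b div 2 ^ (w * (F - 1)) mod 2 ^ w =
      int (card {f. f < F \<and> K f < q})" .
  have "card {f. f < F \<and> K f < q} \<le> card {..<F}" by (intro card_mono) auto
  then have 3: "word_of b (int (card {f. f < F \<and> K f < q})) = card {f. f < F \<and> K f < q}"
    using small(4) by (intro word_of_int_eq) simp
  show ?thesis
    unfolding rank_def using Q
    by (simp add: c R alu_val_1[simplified] alu_val_word 1[simplified] alu_val_mask w_le 2[simplified] 3)
qed

lemma advance_ok:
  assumes A: "bounded A" "positive A" "node k m" "node_ok A k m M"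
    and c: "c \<le> F" "\<And>i. S A (\<beta> * k) m i < \<sigma> \<longleftrightarrow> i \<le> c" and \<sigma>: "0 < \<sigma>" "\<sigma> < 2 ^ b"
    and R: "const_regs R" "R 3 = vertex (Suc k) m" "R 5 = M 1 (R 3)" "R 6 = \<beta> * k" "R 0 = word_of b \<sigma>"
      "R 12 \<le> c"
    and Q: "\<And>R'. (\<And>r. r < 100 \<Longrightarrow> r \<noteq> 4 \<Longrightarrow> r \<noteq> 12 \<Longrightarrow> R' r = R r) \<Longrightarrow>
      R' 12 = min c (Suc (R 12)) \<Longrightarrow> Q R' M"
  shows "wp b advance Q R M"
proof (cases "R 12 < F")
  case False
  then have "c = F" "R 12 = F" using c(1) R(6) by linarith+
  moreover have "Q R M" by (rule Q) (use calculation in auto)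
  ultimately show ?thesis using R(1) by (simp add: advance_def const_regs_def)
next
  case True
  define i where "i = Suc (R 12)"
  have i: "alu_val b Add (R 12) (Suc 0) = i" "i \<le> F"
    using True small(4) by (simp_all add: alu_val_add i_def)
  have Si: "0 \<le> S A (\<beta> * k) m i \<and> S A (\<beta> * k) m i < 2 ^ b"
  proof -
    have "(2::int) ^ (b - 1) \<le> 2 ^ b" by (intro power_increasing) auto
    then show ?thesis using S_word[OF A(1,2), of "\<beta> * k" m i] by linarith
  qed
  have cmp: "word_of b (S A (\<beta> * k) m i) < word_of b \<sigma> \<longleftrightarrow> i \<le> c"
    using Si \<sigma> c(2)[of i] by (simp add: word_of_nonneg nat_less_eq_zless)
  have iF: "alu_val b Add i 0 = i" using i(2) small(4) by simp
  note cr = R(1)[unfolded const_regs_def]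
  have "wp b child_prefix (wp b (Cond 101 0 (Do [Alu Add 12 4 21]) (Do [])) Q) (R(4 := i)) M"
  proof (rule child_prefix_ok[OF A(1,3,4)])
    fix R' assume R': "\<And>r. r < 100 \<Longrightarrow> R' r = (R(4 := i)) r"
      "R' 101 = word_of b (S A (\<beta> * k) m ((R(4 := i)) 4))"
    have "Q R' M" if "\<not> i \<le> c"
      by (rule Q) (use R' that R(6) in \<open>auto simp: i_def\<close>)
    moreover have "Q (R'(12 := i)) M" if "i \<le> c"
      by (rule Q) (use R' that R(6) in \<open>auto simp: i_def\<close>)
    ultimately show "wp b (Cond 101 0 (Do [Alu Add 12 4 21]) (Do [])) Q R' M"
      using R' R(5) cmp iF cr by simp
  qed (use R i(2) cr in \<open>simp_all add: const_regs_def\<close>)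
  then show ?thesis
    using True i(1) cr by (simp add: advance_def)
qed

definition select_inv :: "(nat \<Rightarrow> int) \<Rightarrow> memory \<Rightarrow> int \<Rightarrow> nat \<Rightarrow> registers \<Rightarrow> memory \<Rightarrow> bool" where
  "select_inv A M0 \<sigma> k R M \<longleftrightarrow> M = M0 \<and> const_regs R \<and> k \<le> D \<and> R 6 = \<beta> * k \<and>
     (\<exists>m<2 ^ (\<beta> * (D - k)). R 3 = word_of b (int (vertex k m)) \<and>
        R 0 = word_of b (\<sigma> - pre A (\<beta> * k) m) \<and>
        pre A (\<beta> * k) m < \<sigma> \<and> \<sigma> \<le> pre A (\<beta> * k) (Suc m))"

definition select_rank :: com where
  "select_rank = Cond 6 29 (Do [Alu Add 10 5 21, Alu Add 11 0 21]) (Do [Load 10 2 3, Alu Shr 11 0 6]) ;; rank"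

text \<open>In a low node the fields are the prefix sums themselves and the count is exact; the
  slack of 3 comes from \<open>rank_high\<close>.\<close>

lemma select_rank_ok:
  assumes A: "bounded A" "positive A" "node k m" "node_ok A k m M"
    and \<sigma>: "0 < \<sigma>" "\<sigma> \<le> S A (\<beta> * k) m (2 ^ \<beta>)"
    and c: "c \<le> F" "\<And>i. S A (\<beta> * k) m i < \<sigma> \<longleftrightarrow> i \<le> c"
    and R: "const_regs R" "R 3 = vertex (Suc k) m" "R 5 = M 1 (R 3)" "R 6 = \<beta> * k" "R 0 = word_of b \<sigma>"
    and Q: "\<And>x y r. r \<le> c \<Longrightarrow> c \<le> r + 3 \<Longrightarrow> Q (R(10 := x, 11 := y, 12 := r)) M"
  shows "wp b select_rank Q R M"
proof -
  note cr = R(1)[unfolded const_regs_def]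
  have \<sigma>b: "\<sigma> < 2 ^ (b - 1)" using \<sigma>(2) S_word[OF A(1,2), of "\<beta> * k" m "2 ^ \<beta>"] by linarith
  moreover have "(2::int) ^ (b - 1) \<le> 2 ^ b" by (intro power_increasing) auto
  ultimately have \<sigma>_less: "\<sigma> < 2 ^ b" by linarith
  show ?thesis
  proof (cases "\<beta> * k < thr")
    case True
    define K where "K = (\<lambda>f. S A (\<beta> * k) m (Suc f))"
    have M: "M 1 (vertex (Suc k) m) = word_of b (pack w F K)"
      using A(4) True by (simp add: node_ok_def K_def)
    have lim: "S A (\<beta> * k) m i < 2 ^ (w - 1)" if "i \<le> 2 ^ \<beta>" for i
    proof (cases "w = 2 * (\<delta> + \<beta>) \<and> thr = \<delta> + \<beta>")
      case True
      then show ?thesis using S_low[OF A(1), of "\<beta> * k" i m] \<open>\<beta> * k < thr\<close> that by auto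
    next
      case False
      then show ?thesis using S_word[OF A(1,2), of "\<beta> * k" m i] mode by auto
    qed
    have K: "0 \<le> K f \<and> K f < 2 ^ (w - 1)" if "f < F" for f
      using S_nonneg[OF A(2)] lim[of "Suc f"] that two_\<beta> by (simp add: K_def)
    have q0: "0 \<le> \<sigma>" using \<sigma>(1) by (rule less_imp_le)
    have q1: "\<sigma> \<le> 2 ^ (w - 1)"
      by (rule order_trans[OF \<sigma>(2) less_imp_le[OF lim[OF order_refl]]])
    have "{f. f < F \<and> K f < \<sigma>} = {..<c}" using c(1) by (auto simp: K_def c(2))
    then have r: "card {f. f < F \<and> K f < \<sigma>} = c" by simp
    have Q': "Q (R(10 := u, 11 := x, 12 := card {f. f < F \<and> K f < \<sigma>})) M" for u x
      unfolding r by (rule Q) simp_all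
    have "wp b rank Q (R(10 := word_of b (pack w F K), 11 := word_of b \<sigma>)) M"
      by (rule rank_ok[OF _ _ _ q0 q1 K]) (use Q' cr in \<open>simp_all add: const_regs_def\<close>)
    then show ?thesis
      using M True R cr by (simp add: select_rank_def word_of_less)
  next
    case False
    then obtain e K where h: "high_node A k m M e K"
      using A(4) by (auto simp: node_ok_def)
    note keys = high_node_keys[OF A(1-3) False h]
    have M: "M 2 (vertex (Suc k) m) = word_of b (pack w F K)"
      using h by (simp add: high_node_def)
    define q where "q = \<sigma> div 2 ^ (\<beta> * k)"
    have q0: "0 \<le> q" using \<sigma>(1) by (simp add: q_def pos_imp_zdiv_nonneg_iff)
    have "q * 2 ^ (\<beta> * k) \<le> 2 ^ (\<delta> + \<beta> - 1) * 2 ^ (\<beta> * k)"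
      using div_power_bounds(1)[of \<sigma> "\<beta> * k"] \<sigma>(2) S_high(1)[OF A(1-3) False order_refl]
      unfolding q_def mult.commute[of "2 ^ (\<beta> * k)" "2 ^ (\<delta> + \<beta> - 1)"] by linarith
    then have "q \<le> 2 ^ (\<delta> + \<beta> - 1)" by simp
    also have "\<dots> \<le> 2 ^ (w - 1)"
      using high_mode(1)[OF A(3) False] by (intro power_increasing) auto
    finally have q1: "q \<le> 2 ^ (w - 1)" .
    have r: "card {f. f < F \<and> K f < q} \<le> c \<and> c \<le> card {f. f < F \<and> K f < q} + 3"
      unfolding q_def by (rule rank_high[OF A(2) \<sigma> c, of e]) (use keys in auto)
    have Q': "Q (R(10 := u, 11 := x, 12 := card {f. f < F \<and> K f < q})) M" for u x
      by (rule Q) (use r in simp_all)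
    have "wp b rank Q (R(10 := word_of b (pack w F K), 11 := word_of b q)) M"
      by (rule rank_ok[OF _ _ _ q0 q1, of _ K]) (use Q' keys(4,5) cr in \<open>simp_all add: const_regs_def\<close>)
    moreover have "alu_val b Shr (word_of b \<sigma>) (\<beta> * k) = word_of b q"
      unfolding q_def alu_val_word using \<sigma>(1) \<sigma>_less by simp
    ultimately show ?thesis
      using M False R cr by (simp add: select_rank_def)
  qed
qed

lemma select_body_ok:
  assumes "mem_ok A M0" "positive A" "select_inv A M0 \<sigma> (Suc k) R M"
  shows "wp b select_body (select_inv A M0 \<sigma> k) R M"
proof -
  note inv = assms(3)[unfolded select_inv_def]
  obtain m where m: "m < 2 ^ (\<beta> * (D - Suc k))" "R 3 = word_of b (int (vertex (Suc k) m))"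
    "R 0 = word_of b (\<sigma> - pre A (\<beta> * Suc k) m)" "pre A (\<beta> * Suc k) m < \<sigma>" "\<sigma> \<le> pre A (\<beta> * Suc k) (Suc m)"
    using inv by blast
  have k: "k < D" using inv by simp
  have node: "node k m" using m k by (simp add: node_def)
  have ok: "node_ok A k m M" and bd: "bounded A" using assms(1) node inv by (auto simp: mem_ok_def)
  have R3: "R 3 = vertex (Suc k) m" using m word_of_vertex[OF node] by simp
  define \<sigma>' where "\<sigma>' = \<sigma> - pre A (\<beta> * Suc k) m"
  have ks: "\<beta> * Suc k = \<beta> * k + \<beta>" by simp
  have S: "S A (\<beta> * k) m i = pre A (\<beta> * k) (m * 2 ^ \<beta> + i) - pre A (\<beta> * Suc k) m" for i
    unfolding ks by (simp add: pre_child)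
  have \<sigma>': "0 < \<sigma>'" "\<sigma>' \<le> S A (\<beta> * k) m (2 ^ \<beta>)"
    using m(4,5) pre_add[of A "\<beta> * k" "Suc m"] unfolding \<sigma>'_def S ks by (simp_all add: add.commute)
  obtain c where c: "c \<le> F" "\<And>i. S A (\<beta> * k) m i < \<sigma>' \<longleftrightarrow> i \<le> c"
    using select_child[OF assms(2) \<sigma>'] by blast
  have "\<sigma>' < 2 ^ (b - 1)" using \<sigma>'(2) S_word[OF bd assms(2), of "\<beta> * k" m "2 ^ \<beta>"] by linarith
  moreover have "(2::int) ^ (b - 1) \<le> 2 ^ b" by (intro power_increasing) auto
  ultimately have \<sigma>_less: "\<sigma>' < 2 ^ b" by linarith
  note adv = advance_ok[OF bd assms(2) node ok c \<sigma>'(1) \<sigma>_less]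
  note cr = inv[unfolded const_regs_def]
  have split: "wp b select_body Q R M \<longleftrightarrow>
      wp b (Do [Alu Sub 6 6 22, Load 5 1 3]) (wp b select_rank (wp b advance (wp b advance (wp b advance
        (wp b (Do [Alu Add 4 12 21]) (wp b child_prefix (wp b (Do [Alu Sub 0 0 101]) (wp b child Q)))))))) R M" for Q
    unfolding select_body_def select_rank_def wp.simps by (rule refl)
  define R1 where "R1 = R(6 := \<beta> * k, 5 := M 1 (R 3))"
  have R1: "const_regs R1" "R1 3 = vertex (Suc k) m" "R1 5 = M 1 (R1 3)" "R1 6 = \<beta> * k" "R1 0 = word_of b \<sigma>'"
    using cr R3 m(3) by (simp_all add: R1_def const_regs_def \<sigma>'_def)
  have head: "wp b (Do [Alu Sub 6 6 22, Load 5 1 3]) Q R M \<longleftrightarrow> Q R1 M" for Q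
    using cr \<beta>k_step[OF k] node_ok_word[OF ok] R3 by (simp add: R1_def)
  show ?thesis
    unfolding split head
  proof (rule select_rank_ok[OF bd assms(2) node ok \<sigma>' c R1])
    fix x y r assume r: "r \<le> c" "c \<le> r + 3"
    define R2 where "R2 = R1(10 := x, 11 := y, 12 := r)"
    define like where "like R' \<longleftrightarrow> (\<forall>r<100. r \<notin> {4, 12} \<longrightarrow> R' r = R2 r)" for R'
    have like: "const_regs R'" "R' 3 = vertex (Suc k) m" "R' 5 = M 1 (R' 3)" "R' 6 = \<beta> * k" "R' 0 = word_of b \<sigma>'"
      if "like R'" for R'
      using that R1 by (simp_all add: like_def R2_def const_regs_def)
    have step: "wp b advance Q R' M"
      if "like R'" "R' 12 \<le> c" "\<And>R''. like R'' \<Longrightarrow> R'' 12 = min c (Suc (R' 12)) \<Longrightarrow> Q R'' M" for Q R'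
      by (rule adv[OF like[OF that(1)] that(2)]) (use that(1) in \<open>auto simp: like_def intro!: that(3)\<close>)
    show "wp b advance (wp b advance (wp b advance (wp b (Do [Alu Add 4 12 21])
        (wp b child_prefix (wp b (Do [Alu Sub 0 0 101]) (wp b child (select_inv A M0 \<sigma> k))))))) (R1(10 := x, 11 := y, 12 := r)) M"
      unfolding R2_def[symmetric]
    proof (intro step)
      show "like R2" by (simp add: like_def)
      show R2: "R2 12 \<le> c" using r by (simp add: R2_def)
      fix Ra assume Ra: "like Ra" "Ra 12 = min c (Suc (R2 12))"
      then show "like Ra" "Ra 12 \<le> c" by simp_all
      fix Rb assume Rb: "like Rb" "Rb 12 = min c (Suc (Ra 12))"
      then show "like Rb" "Rb 12 \<le> c" by simp_all
      fix Rc assume Rc: "like Rc" "Rc 12 = min c (Suc (Rb 12))"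
      \<comment> \<open>Each run takes the successor cut off at \<open>c\<close>; three of them
        close a gap of at most 3.\<close>
      have c12: "Rc 12 = c" using Ra Rb Rc r by (simp add: R2_def)
      define Rd where "Rd = Rc(4 := c)"
      have Rd: "const_regs Rd" "Rd 3 = vertex (Suc k) m" "Rd 4 = c" "Rd 5 = M 1 (Rd 3)" "Rd 6 = \<beta> * k"
        "Rd 0 = word_of b \<sigma>'"
        using like[OF Rc(1)] by (simp_all add: Rd_def const_regs_def)
      have "wp b child_prefix (wp b (Do [Alu Sub 0 0 101]) (wp b child (select_inv A M0 \<sigma> k))) Rd M"
      proof (rule child_prefix_ok[OF bd node ok Rd(1,2) _ Rd(4,5)])
        show "Rd 4 \<le> F" using Rd c by simp
        fix Re assume Re: "\<And>r. r < 100 \<Longrightarrow> Re r = Rd r" "Re 101 = word_of b (S A (\<beta> * k) m (Rd 4))"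
        define Rf where "Rf = Re(0 := word_of b (\<sigma>' - S A (\<beta> * k) m c))"
        have Rf: "const_regs Rf" "Rf 3 = vertex (Suc k) m" "Rf 4 = c" "Rf 6 = \<beta> * k"
          using Re Rd by (simp_all add: Rf_def const_regs_def)
        have "m * 2 ^ \<beta> + c < Suc m * 2 ^ \<beta>" using c(1) two_\<beta> by simp
        also have "\<dots> \<le> 2 ^ (\<beta> * (D - Suc k)) * 2 ^ \<beta>" using m(1) by (intro mult_le_mono1) simp
        also have "\<dots> = 2 ^ (\<beta> * (D - k))"
          using k by (simp flip: power_add) (metis Suc_diff_Suc add.commute mult_Suc_right)
        finally have less: "m * 2 ^ \<beta> + c < 2 ^ (\<beta> * (D - k))" .
        have "wp b child (select_inv A M0 \<sigma> k) Rf M"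
        proof (rule child_ok[OF Rf(1) k Rf(2) node])
          show "Rf 4 \<le> F" using Rf c by simp
          have "pre A (\<beta> * k) (m * 2 ^ \<beta> + c) < \<sigma>" "\<sigma> \<le> pre A (\<beta> * k) (Suc (m * 2 ^ \<beta> + c))"
            using c(2)[of c] c(2)[of "Suc c"] unfolding S \<sigma>'_def by simp_all
          then show "select_inv A M0 \<sigma> k (Rf(3 := word_of b (int (vertex k (m * 2 ^ \<beta> + Rf 4))))) M"
            unfolding select_inv_def
            using Rf inv k less by (auto simp: const_regs_def Rf_def S \<sigma>'_def intro!: exI[of _ "m * 2 ^ \<beta> + c"])
        qed
        then show "wp b (Do [Alu Sub 0 0 101]) (wp b child (select_inv A M0 \<sigma> k)) Re M"
          using Re Rd by (simp add: Rf_def alu_val_word)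
      qed
      then show "wp b (Do [Alu Add 4 12 21])
        (wp b child_prefix (wp b (Do [Alu Sub 0 0 101]) (wp b child (select_inv A M0 \<sigma> k)))) Rc M"
        using like[OF Rc(1)] c12 c(1) small(4) by (simp add: Rd_def const_regs_def)
    qed
  qed
qed

lemma select_ok:
  assumes "mem_ok A M" "positive A" "0 < \<sigma>" "\<sigma> \<le> psum A n" "R 0 = word_of b \<sigma>"
  defines "enter \<equiv> prologue ;; Do [Alu Add 6 32 21, Alu Add 3 20 21]"
    and "fin \<equiv> Do [Alu Shl 100 20 32, Alu Sub 0 3 100, Alu Add 0 0 20]"
  shows "wpt b select_com (len enter + ((D * (len select_body + 2) + 2) + len fin))
    (\<lambda>R' M'. M' = M \<and> R' 0 \<in> {1..n} \<and> psum A (R' 0 - 1) < \<sigma> \<and> \<sigma> \<le> psum A (R' 0)) R M"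
proof -
  have par: "params_ok M" using assms(1) by (simp add: mem_ok_def)
  have "wp b enter (select_inv A M \<sigma> D) R M"
    unfolding enter_def wp.simps(2)
  proof (rule prologue_ok[OF par])
    fix R' assume R': "const_regs R'" "\<And>r. r < 20 \<Longrightarrow> R' r = R r"
    have "pre A (\<beta> * D) 0 = 0" "pre A (\<beta> * D) (Suc 0) = psum A n"
      using D_le by (simp_all add: pre_def psum_def)
    then show "wp b (Do [Alu Add 6 32 21, Alu Add 3 20 21]) (select_inv A M \<sigma> D) R' M"
      using R' assms(3-5) \<beta>D_less small(1)
      by (simp add: select_inv_def const_regs_def vertex_def)
  qed
  then have 1: "wpt b enter (len enter) (select_inv A M \<sigma> D) R M"
    by (rule wp_imp_wpt)
  have 2: "wpt b (While 21 6 select_body) (D * (len select_body + 2) + 2) (select_inv A M \<sigma> 0) R M'"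
    if "select_inv A M \<sigma> D R M'" for R M'
  proof (rule wpt_While[where Inv = "select_inv A M \<sigma>"])
    fix k R M' assume *: "select_inv A M \<sigma> (Suc k) R M'"
    show "R 21 < R 6 \<and> wpt b select_body (len select_body) (select_inv A M \<sigma> k) R M'"
      using select_body_ok[OF assms(1,2) *] * \<beta>
      by (auto simp: select_inv_def const_regs_def intro: wp_imp_wpt)
  next
    fix R M' assume "select_inv A M \<sigma> 0 R M'"
    then show "\<not> R 21 < R 6" by (simp add: select_inv_def const_regs_def)
  qed fact
  have 3: "wpt b fin (len fin)
      (\<lambda>R' M'. M' = M \<and> R' 0 \<in> {1..n} \<and> psum A (R' 0 - 1) < \<sigma> \<and> \<sigma> \<le> psum A (R' 0)) R M'"
    if inv: "select_inv A M \<sigma> 0 R M'" for R M'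
  proof -
    obtain m where m: "R 3 = word_of b (int (vertex 0 m))" "pre A 0 m < \<sigma>" "\<sigma> \<le> pre A 0 (Suc m)"
      using inv by (auto simp: select_inv_def)
    have mn: "m < n" by (rule ccontr) (use m in \<open>simp add: pre_def\<close>)
    \<comment> \<open>The leaf number may have overflowed, but subtracting
      \<open>2 ^ (\<beta> * D)\<close> modulo \<open>2 ^ b\<close> leaves \<open>m\<close>; the 1
      converts to array indices.\<close>
    have "word_of b (int (vertex 0 m) - 2 ^ (\<beta> * D) + 1) = word_of b (int (Suc m))"
      by (simp add: vertex_def add.commute)
    also have "\<dots> = Suc m" using mn n by (intro word_of_int_eq) simp
    finally have "word_of b (int (vertex 0 m) - 2 ^ (\<beta> * D) + 1) = Suc m" .
    then show ?thesis
      unfolding fin_def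
      using inv m mn
      by (intro wp_imp_wpt)
        (simp add: select_inv_def const_regs_def alu_val_1[simplified] alu_val_word pre_def min_absorb2)
  qed
  show ?thesis
    unfolding select_com_def enter_def[symmetric] fin_def[symmetric]
    by (intro wpt_Seq[OF 1] wpt_Seq[OF 2] 3)
qed

end


section \<open>Update\<close>

text \<open>For the field \<open>r\<close> in array 4, the correction moves from the packed word to
  the word of child \<open>r + 1\<close>. The key is replaced by adding the shifted difference of
  the new and the old one, as in \<open>pack_upd\<close>, and \<open>r\<close> advances
  cyclically.\<close>

definition refresh :: com where
  "refresh =
     Do [Load 102 4 3, Alu Mul 103 23 102,
         Alu Add 104 5 27, Alu Shr 104 104 103, Alu And 104 104 25, Alu Sub 104 104 26,
         Alu Add 105 102 20, Alu Shl 106 3 22, Alu Add 105 106 105,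
         Load 106 3 105, Alu Add 106 106 104, Store 3 105 106,
         Alu Shl 107 104 103, Alu Sub 5 5 107, Store 1 3 5,
         Load 107 2 3, Alu Shr 108 107 103, Alu And 108 108 25,
         Alu Shl 109 20 6, Alu Add 109 109 106, Alu Shr 109 109 6, Alu And 109 109 25,
         Alu Sub 109 109 108, Alu Shl 109 109 103, Alu Add 107 107 109, Store 2 3 107,
         Alu Add 102 102 20] ;;
     Cond 102 24 (Do []) (Do [Const 102 0]) ;;
     Do [Store 4 3 102]"

text \<open>Field \<open>f\<close> belongs to the prefix before child \<open>f + 1\<close>, so a
  change below child \<open>i\<close> concerns the fields from \<open>i\<close> on, and none if
  \<open>i = F\<close>.\<close>

definition shift_prefixes :: com where
  "shift_prefixes =
     Do [Alu Mul 100 23 4, Alu Shr 101 28 100, Alu Shl 101 101 100, Alu Mul 101 7 101,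
         Alu Add 5 5 101, Store 1 3 5] ;;
     Cond 6 29 (Do []) refresh"

definition update_body :: com where
  "update_body = descend ;; shift_prefixes ;; child"

definition update_start :: com where
  "update_start =
     Do [Load 7 0 0, Store 0 0 1, Alu Sub 7 1 7, Alu Sub 2 0 20, Alu Add 6 32 21, Alu Add 3 20 21]"

definition update_com :: com where
  "update_com = (prologue ;; update_start) ;; While 21 6 update_body"

section \<open>Updating one node\<close>

context tree
begin

text \<open>The locations not owned by the node. Array 3 has one word per child, so there ownership
  is decided by the quotient of the address.\<close>

definition outside :: "nat \<Rightarrow> nat \<Rightarrow> nat \<Rightarrow> nat \<Rightarrow> bool" where
  "outside k m j a \<longleftrightarrow> (j \<in> {1, 2, 4} \<longrightarrow> a \<noteq> vertex (Suc k) m) \<and>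
     (j = 3 \<longrightarrow> a div 2 ^ \<beta> \<noteq> vertex (Suc k) m) \<and> j \<le> 4 \<and> j \<noteq> 0"

lemma vertex_child_div: "i \<le> F \<Longrightarrow> (x * 2 ^ \<beta> + i) div 2 ^ \<beta> = x"
proof -
  assume "i \<le> F"
  then have "i < 2 ^ \<beta>" using two_\<beta> by linarith
  then show ?thesis by simp
qed

lemma pack_nth_word:
  assumes "\<And>f. f < F \<Longrightarrow> 0 \<le> K f \<and> K f < 2 ^ w" "r < F"
  shows "pack w F K mod 2 ^ b div 2 ^ (w * r) mod 2 ^ w = K r"
proof -
  have "Suc r \<le> F" using assms(2) by simp
  then have "w * r + w \<le> w * F" by (metis mult_Suc_right add.commute mult_le_mono2)
  then have "w * r + w \<le> b" using wF_le by linarith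
  then show ?thesis using pack_nth[OF assms] by (simp add: div_mod_window)
qed

lemma refresh_ok:
  assumes node: "node k m" "\<not> \<beta> * k < thr"
    and R: "const_regs R" "R 3 = vertex (Suc k) m" "R 6 = \<beta> * k"
    and M: "M 4 (vertex (Suc k) m) = r" "r < F" "M 2 (vertex (Suc k) m) = word_of b (pack w F K)"
      "M 3 (vertex (Suc k) m * 2 ^ \<beta> + Suc r) = word_of b v"
    and R5: "R 5 = word_of b (pack w F c)" and c: "\<And>f. f < F \<Longrightarrow> \<bar>c f\<bar> \<le> int F * 2 ^ \<delta>"
    and K: "\<And>f. f < F \<Longrightarrow> 0 \<le> K f \<and> K f < 2 ^ w"
    and Q: "\<And>R' M'. (\<And>i. i < 100 \<Longrightarrow> i \<noteq> 5 \<Longrightarrow> R' i = R i) \<Longrightarrow>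
      M' 1 (vertex (Suc k) m) = word_of b (pack w F (c(r := 0))) \<Longrightarrow>
      M' 2 (vertex (Suc k) m) = word_of b (pack w F (K(r := key (\<beta> * k) (v + c r)))) \<Longrightarrow>
      M' 4 (vertex (Suc k) m) = (if Suc r < F then Suc r else 0) \<Longrightarrow>
      M' 3 (vertex (Suc k) m * 2 ^ \<beta> + Suc r) = word_of b (v + c r) \<Longrightarrow>
      (\<And>a. a \<noteq> vertex (Suc k) m * 2 ^ \<beta> + Suc r \<Longrightarrow> M' 3 a = M 3 a) \<Longrightarrow>
      (\<And>j a. a \<noteq> vertex (Suc k) m \<Longrightarrow> j \<in> {1, 2, 4} \<Longrightarrow> M' j a = M j a) \<Longrightarrow>
      (\<And>j. j \<notin> {1, 2, 3, 4} \<Longrightarrow> M' j = M j) \<Longrightarrow> Q R' M'"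
  shows "wp b refresh Q R M"
proof -
  note cr = R(1)[unfolded const_regs_def]
  define x where "x = vertex (Suc k) m"
  have 1: "take_bit b r = r" "alu_val b Mul w r = w * r" "alu_val b Add r 1 = Suc r"
    using M(2) small by (simp_all add: take_bit_nat_eq_self alu_val_mult alu_val_add)
  have 2: "alu_val b Add (alu_val b Shl x \<beta>) (Suc r) = x * 2 ^ \<beta> + Suc r"
    using high_address[OF node, of "Suc r"] M(2) unfolding x_def by simp
  note e = extract_high[OF node M(2) c]
  note o = pack_nth_word[OF K M(2)]
  have C: "pack w F c - c r * 2 ^ (w * r) = pack w F (c(r := 0))"
    using pack_upd[OF M(2), of w c 0] by simp
  have H: "pack w F K + (y - K r) * 2 ^ (w * r) = pack w F (K(r := y))" for y
    using pack_upd[OF M(2), of w K y] by simp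
  show ?thesis
  proof (cases "Suc r < F")
    case True
    show ?thesis
      unfolding refresh_def
      apply (simp add: cr R(2,3)[folded x_def] M[folded x_def, simplified] R5 1[simplified] 2[simplified] alu_val_word alu_val_1[simplified]
          alu_val_mask w_le e[simplified] o C H True)
      apply (rule Q)
      using True by (auto simp: x_def[symmetric] key_def)
  next
    case False
    show ?thesis
      unfolding refresh_def
      apply (simp add: cr R(2,3)[folded x_def] M[folded x_def, simplified] R5 1[simplified] 2[simplified] alu_val_word alu_val_1[simplified]
          alu_val_mask w_le e[simplified] o C H False)
      apply (rule Q)
      using False by (auto simp: x_def[symmetric] key_def)
  qed
qed

lemma shift_prefixes_ok:
  assumes bd: "bounded A'" and d: "\<bar>d\<bar> \<le> 2 ^ \<delta>" and node: "node k m" and ok: "node_ok A k m M"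
    and S': "\<And>f. f < F \<Longrightarrow>
      S A' (\<beta> * k) m (Suc f) = S A (\<beta> * k) m (Suc f) + d * of_bool (i \<le> f)"
    and R: "const_regs R" "R 3 = vertex (Suc k) m" "R 4 = i" "i \<le> F" "R 5 = M 1 (R 3)" "R 6 = \<beta> * k"
      "R 7 = word_of b d"
    and Q: "\<And>R' M'. (\<And>i. i < 100 \<Longrightarrow> i \<noteq> 5 \<Longrightarrow> R' i = R i) \<Longrightarrow> node_ok A' k m M' \<Longrightarrow>
      (\<And>j a. outside k m j a \<Longrightarrow> M' j a = M j a) \<Longrightarrow>
      (\<And>j. j \<notin> {1, 2, 3, 4} \<Longrightarrow> M' j = M j) \<Longrightarrow> Q R' M'"
  shows "wp b shift_prefixes Q R M"
proof -
  note cr = R(1)[unfolded const_regs_def]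
  define x where "x = vertex (Suc k) m"
  have 1: "alu_val b Mul w i = w * i"
    using R(4) small by (simp add: alu_val_mult)
  have 2: "d * (pack w F (\<lambda>_. 1) mod 2 ^ b div 2 ^ (w * i) * 2 ^ (w * i)) = pack w F (\<lambda>f. d * of_bool (i \<le> f))"
    unfolding pack_ones_from[OF R(4) wF_le w_ge] pack_mult ..
  show ?thesis
  proof (cases "\<beta> * k < thr")
    case True
    define z where "z = pack w F (\<lambda>f. S A (\<beta> * k) m (Suc f))"
    have M: "M 1 x = word_of b z"
      using ok True by (simp add: node_ok_def x_def z_def)
    have 3: "z + pack w F (\<lambda>f. d * of_bool (i \<le> f)) = pack w F (\<lambda>f. S A' (\<beta> * k) m (Suc f))"
      unfolding z_def pack_add[symmetric] by (rule pack_cong) (simp add: S')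
    show ?thesis
      unfolding shift_prefixes_def
      apply (simp add: cr R(2-7)[folded x_def] M[simplified] True 1 alu_val_word 2[simplified] 3)
      apply (rule Q)
      using True by (auto simp: node_ok_def x_def outside_def)
  next
    case False
    then obtain c K where h: "high_node A k m M c K" using ok by (auto simp: node_ok_def)
    note h = h[unfolded high_node_def]
    define r where "r = M 4 x"
    define c' where "c' = (\<lambda>f. c f + d * of_bool (i \<le> f))"
    have r: "r < F" using h by (simp add: r_def x_def)
    have 3: "pack w F c + pack w F (\<lambda>f. d * of_bool (i \<le> f)) = pack w F c'"
      unfolding c'_def by (rule pack_add[symmetric])
    \<comment> \<open>This is the bound for the next age of every field but \<open>r\<close>, by
      \<open>age_next\<close>; the correction of \<open>r\<close> is about to become 0.\<close>
    have cb: "\<bar>c' f\<bar> \<le> int (Suc (age f r)) * 2 ^ \<delta>" if "f < F" for f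
    proof -
      have "\<bar>c f\<bar> \<le> int (age f r) * 2 ^ \<delta>" using h that by (simp add: r_def x_def)
      moreover have "\<bar>c' f\<bar> \<le> \<bar>c f\<bar> + \<bar>d\<bar>" by (simp add: c'_def abs_triangle_ineq)
      moreover have "int (Suc (age f r)) * 2 ^ \<delta> = int (age f r) * 2 ^ \<delta> + 2 ^ \<delta>"
        by (simp add: algebra_simps)
      ultimately show ?thesis using d by linarith
    qed
    have cF: "\<bar>c' f\<bar> \<le> int F * 2 ^ \<delta>" if "f < F" for f
    proof -
      have "Suc (age f r) \<le> F" using age_less[OF that r] by simp
      then have "int (Suc (age f r)) * 2 ^ \<delta> \<le> int F * 2 ^ \<delta>"
        by (intro mult_right_mono) (simp_all only: of_nat_le_iff zero_le_power zero_le_numeral)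
      then show ?thesis using cb[OF that] by linarith
    qed
    define v where "v = S A (\<beta> * k) m (Suc r) - c r"
    have v: "v + c' r = S A' (\<beta> * k) m (Suc r)" using S'[OF r] by (simp add: v_def c'_def)
    let ?R = "R(100 := w * i, 101 := word_of b (pack w F (\<lambda>f. d * of_bool (i \<le> f))), 5 := word_of b (pack w F c'))"
    let ?M = "M(1 := (M 1)(x := word_of b (pack w F c')))"
    have "wp b refresh Q ?R ?M"
    proof (rule refresh_ok[OF node False])
      show "?R 3 = vertex (Suc k) m" "?R 6 = \<beta> * k" "?R 5 = word_of b (pack w F c')"
        using R by simp_all
      show "const_regs ?R" using cr by (simp add: const_regs_def)
      show "?M 4 (vertex (Suc k) m) = r" by (simp add: r_def x_def)
      show "?M 2 (vertex (Suc k) m) = word_of b (pack w F K)"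
        "?M 3 (vertex (Suc k) m * 2 ^ \<beta> + Suc r) = word_of b v"
        using h r by (simp_all add: v_def)
      show "0 \<le> K f \<and> K f < 2 ^ w" if "f < F" for f using h that by simp
      fix R' M'
      assume R': "\<And>i. i < 100 \<Longrightarrow> i \<noteq> 5 \<Longrightarrow> R' i = ?R i"
        and M'1: "M' 1 (vertex (Suc k) m) = word_of b (pack w F (c'(r := 0)))"
        and M'2: "M' 2 (vertex (Suc k) m) = word_of b (pack w F (K(r := key (\<beta> * k) (v + c' r))))"
        and M'4: "M' 4 (vertex (Suc k) m) = (if Suc r < F then Suc r else 0)"
        and M'3: "M' 3 (vertex (Suc k) m * 2 ^ \<beta> + Suc r) = word_of b (v + c' r)"
        and fr3: "\<And>a. a \<noteq> vertex (Suc k) m * 2 ^ \<beta> + Suc r \<Longrightarrow> M' 3 a = ?M 3 a"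
        and fr: "\<And>j a. a \<noteq> vertex (Suc k) m \<Longrightarrow> j \<in> {1, 2, 4} \<Longrightarrow> M' j a = ?M j a"
        and fr': "\<And>j. j \<notin> {1, 2, 3, 4} \<Longrightarrow> M' j = ?M j"
      show "Q R' M'"
      proof (rule Q)
        show "R' i = R i" if "i < 100" "i \<noteq> 5" for i using R'[OF that] that by simp
        show "M' j = M j" if "j \<notin> {1, 2, 3, 4}" for j using fr'[OF that] that by simp
        show "M' j a = M j a" if "outside k m j a" for j a
        proof (cases "j = 3")
          case True
          then have "a \<noteq> vertex (Suc k) m * 2 ^ \<beta> + Suc r"
            using that vertex_child_div[of "Suc r" "vertex (Suc k) m"] r by (auto simp: outside_def)
          from fr3[OF this] show ?thesis using True by simp
        next
          case False
          then have "j \<in> {1, 2, 4}" "a \<noteq> x" using that by (auto simp: outside_def x_def)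
          then show ?thesis using fr[of a j] by (auto simp: x_def)
        qed
        have "high_node A' k m M' (c'(r := 0)) (K(r := key (\<beta> * k) (v + c' r)))"
          unfolding high_node_def
        proof (intro conjI allI impI)
          show "M' 4 (vertex (Suc k) m) < F" using M'4 F_ge by (simp split: if_splits)
          fix f assume f: "f < F"
          show "\<bar>(c'(r := 0)) f\<bar> \<le> int (age f (M' 4 (vertex (Suc k) m))) * 2 ^ \<delta>"
            unfolding M'4 using cb[OF f] age_next[OF f r] by simp
          have Kf: "0 \<le> K f" "K f < 2 ^ w" using h f by simp_all
          show "0 \<le> (K(r := key (\<beta> * k) (v + c' r))) f"
            "(K(r := key (\<beta> * k) (v + c' r))) f < 2 ^ w"
            using Kf by (simp_all add: key_def)
          \<comment> \<open>Prefix sum and correction change by the same amount, so the words and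
            keys of the fields not refreshed stay valid.\<close>
          have same: "S A' (\<beta> * k) m (Suc f) - c' f = S A (\<beta> * k) m (Suc f) - c f"
            using S'[OF f] by (simp add: c'_def)
          show "M' 3 (vertex (Suc k) m * 2 ^ \<beta> + Suc f) =
              word_of b (S A' (\<beta> * k) m (Suc f) - (c'(r := 0)) f)"
            using M'3 v same fr3[of "vertex (Suc k) m * 2 ^ \<beta> + Suc f"] h f by (cases "f = r") simp_all
          show "(K(r := key (\<beta> * k) (v + c' r))) f = key (\<beta> * k) (S A' (\<beta> * k) m (Suc f) - (c'(r := 0)) f) \<or>
              (K(r := key (\<beta> * k) (v + c' r))) f = 0 \<and> (c'(r := 0)) f = S A' (\<beta> * k) m (Suc f)"
          proof (cases "f = r")
            case True
            then show ?thesis using v by simp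
          next
            case False
            have "K f = key (\<beta> * k) (S A (\<beta> * k) m (Suc f) - c f) \<or> K f = 0 \<and> c f = S A (\<beta> * k) m (Suc f)"
              using h f by blast
            then show ?thesis using False same by auto
          qed
        qed (rule M'1 M'2)+
        then show "node_ok A' k m M'" using False by (auto simp: node_ok_def)
      qed
    qed (use r cF in simp_all)
    moreover have "M 1 x = word_of b (pack w F c)" using h by (simp add: x_def)
    ultimately show ?thesis
      unfolding shift_prefixes_def
      by (simp add: cr R(2-7)[folded x_def] False 1 alu_val_word 2[simplified] 3)
  qed
qed

end


section \<open>Initialisation\<close>

text \<open>Registers 3 and 4 hold \<open>\<delta> + j\<close> and \<open>b div 2 ^ (j + 2)\<close>.
  The guard is ahead by one: holding at \<open>j - 1\<close> it says that \<open>2 ^ j\<close>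
  fields of width \<open>2 * (\<delta> + j)\<close> fit into a word, and failing at \<open>j\<close>
  it bounds \<open>b\<close> from above, as the running time requires.\<close>

definition init_width :: com where
  "init_width =
     Do [Const 20 1, Const 21 0, Alu Add 3 2 21, Alu Shr 4 1 20, Alu Shr 4 4 20] ;;
     While 3 4 (Do [Alu Add 3 3 20, Alu Shr 4 4 20]) ;;
     Cond 2 3 (Do [Alu Sub 5 3 2, Alu Add 6 3 3, Alu Add 7 3 21])
       (Do [Const 5 1, Alu Add 6 1 21, Alu Add 7 1 21])"

text \<open>The ones vector is built by Horner's rule. The height is the least multiple of
  \<open>\<beta>\<close> by which \<open>n - 1\<close> is shifted to 0, since
  \<open>n \<le> 2 ^ h\<close> exactly if \<open>(n - 1) div 2 ^ h = 0\<close>.\<close>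

definition init_tree :: com where
  "init_tree =
     Do [Store 10 21 5, Store 11 21 6, Store 12 21 7, Alu Shl 8 20 5, Alu Sub 8 8 20, Const 9 0] ;;
     While 21 8 (Do [Alu Shl 9 9 6, Alu Add 9 9 20, Alu Sub 8 8 20]) ;;
     Do [Store 13 21 9, Alu Sub 10 0 20, Const 11 0, Alu Add 12 10 21] ;;
     While 21 12 (Do [Alu Add 11 11 5, Alu Shr 12 10 11]) ;;
     Do [Store 14 21 11]"

definition init_com :: com where
  "init_com = init_width ;; init_tree"

section \<open>Correctness of updates and of the initialisation\<close>

context tree
begin

lemma node_ok_frame:
  assumes "node k m" "node k' m'" "(k', m') \<noteq> (k, m)"
    and "\<And>j a. outside k m j a \<Longrightarrow> M' j a = M j a"
    and "node_ok A k' m' M"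
  shows "node_ok A k' m' M'"
proof -
  have x: "vertex (Suc k') m' \<noteq> vertex (Suc k) m"
    using vertex_inj[OF assms(2,1)] assms(3) by auto
  have 1: "M' 1 (vertex (Suc k') m') = M 1 (vertex (Suc k') m')"
    "M' 2 (vertex (Suc k') m') = M 2 (vertex (Suc k') m')"
    "M' 4 (vertex (Suc k') m') = M 4 (vertex (Suc k') m')"
    using x by (auto intro!: assms(4) simp: outside_def)
  have 2: "M' 3 (vertex (Suc k') m' * 2 ^ \<beta> + Suc f) = M 3 (vertex (Suc k') m' * 2 ^ \<beta> + Suc f)" if "f < F" for f
    using x vertex_child_div[of "Suc f" "vertex (Suc k') m'"] that by (auto intro!: assms(4) simp: outside_def)
  have "high_node A k' m' M' c K" if "high_node A k' m' M c K" for c K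
    using that unfolding high_node_def 1 by (simp add: 2[simplified])
  then show ?thesis
    using assms(5) 1(1) unfolding node_ok_def by (auto split: if_splits)
qed

lemma node_ok_cong:
  assumes "\<And>f. f < F \<Longrightarrow> S A' (\<beta> * k) m (Suc f) = S A (\<beta> * k) m (Suc f)" "node_ok A k m M"
  shows "node_ok A' k m M"
  using assms(2) unfolding node_ok_def high_node_def
  by (auto simp: assms(1) cong: pack_cong)

definition update_inv ::
  "(nat \<Rightarrow> int) \<Rightarrow> (nat \<Rightarrow> int) \<Rightarrow> memory \<Rightarrow> nat \<Rightarrow> int \<Rightarrow> nat \<Rightarrow> registers \<Rightarrow> memory \<Rightarrow> bool" where
  "update_inv A A' M0 p d k R M \<longleftrightarrow> const_regs R \<and> k \<le> D \<and> R 2 = p \<and> R 6 = \<beta> * k \<and>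
     R 3 = word_of b (int (vertex k (p div 2 ^ (\<beta> * k)))) \<and> R 7 = word_of b d \<and>
     (\<forall>j. j \<notin> {1, 2, 3, 4} \<longrightarrow> M j = M0 j) \<and>
     (\<forall>k' m. node k' m \<longrightarrow> (if k' < k then node_ok A k' m M else node_ok A' k' m M))"

lemma update_body_ok:
  assumes A': "bounded A'" and i: "i \<in> {1..n}" "p = i - 1" "A' = A(i := y)" "d = y - A i" "\<bar>d\<bar> \<le> 2 ^ \<delta>"
    and inv: "update_inv A A' M0 p d (Suc k) R M"
  shows "wp b update_body (update_inv A A' M0 p d k) R M"
proof -
  define m where "m = p div 2 ^ (\<beta> * Suc k)"
  define c where "c = p div 2 ^ (\<beta> * k) mod 2 ^ \<beta>"
  note inv = inv[unfolded update_inv_def, folded m_def]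
  have k: "k < D" using inv by simp
  have p: "p < n" using i by auto
  have node: "node k m" unfolding m_def using path_node[OF p k] .
  have ok: "node_ok A k m M" using node inv by auto
  have c: "c \<le> F" using two_\<beta> by (simp add: c_def flip: less_Suc_eq_le)
  have R3: "R 3 = vertex (Suc k) m" using inv word_of_vertex[OF node] by simp
  have child: "p div 2 ^ (\<beta> * k) = m * 2 ^ \<beta> + c" unfolding m_def c_def by (rule path_child)
  have S': "S A' (\<beta> * k) m' (Suc f) = S A (\<beta> * k) m' (Suc f) + d * of_bool (m' = m \<and> c \<le> f)"
    if "f < F" for m' f
  proof -
    have le: "Suc f \<le> 2 ^ \<beta>" and e: "\<beta> * k + \<beta> = \<beta> * Suc k" using that two_\<beta> by simp_all
    note u = S_upd[OF i(1) le, of A y "\<beta> * k" m', unfolded e, folded i(2-4), folded m_def c_def]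
    show ?thesis unfolding u by (auto simp: less_Suc_eq_le)
  qed
  \<comment> \<open>Off the path both arrays have the same prefix sums, so these nodes represent the
    new array without being touched.\<close>
  have others: "node_ok A' k m' M" if "node k m'" "m' \<noteq> m" for m'
    using inv that S'[of _ m'] by (intro node_ok_cong[of A' k m' A]) auto
  show ?thesis
    unfolding update_body_def wp.simps(2)
  proof (rule descend_ok[where R = R and p = p, OF _ k p _ _ R3 ok])
    let ?R = "R(6 := \<beta> * k, 4 := p div 2 ^ (\<beta> * k) mod 2 ^ \<beta>, 5 := M 1 (R 3))"
    show "wp b shift_prefixes (wp b child (update_inv A A' M0 p d k)) ?R M"
      unfolding c_def[symmetric]
    proof (rule shift_prefixes_ok[OF A' i(5) node ok])
      show "S A' (\<beta> * k) m (Suc f) = S A (\<beta> * k) m (Suc f) + d * of_bool (c \<le> f)" if "f < F" for f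
        using S'[OF that, of m] by simp
      show "c \<le> F" by fact
      fix R' M'
      assume R': "\<And>i. i < 100 \<Longrightarrow> i \<noteq> 5 \<Longrightarrow> R' i = (R(6 := \<beta> * k, 4 := c, 5 := M 1 (R 3))) i"
        and new: "node_ok A' k m M'"
        and out: "\<And>j a. outside k m j a \<Longrightarrow> M' j a = M j a"
        and arr: "\<And>j. j \<notin> {1, 2, 3, 4} \<Longrightarrow> M' j = M j"
      have nodes: "if k' < k then node_ok A k' m' M' else node_ok A' k' m' M'" if n': "node k' m'" for k' m'
      proof (cases "(k', m') = (k, m)")
        case False
        note frame = node_ok_frame[OF node n' False out]
        have "if k' < Suc k then node_ok A k' m' M else node_ok A' k' m' M" using inv n' by blast
        then show ?thesis
          using frame others[of m'] n' False by (cases "k' = k") (auto split: if_splits)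
      qed (use new in simp)
      show "wp b child (update_inv A A' M0 p d k) R' M'"
      proof (rule child_ok[OF _ k _ node])
        show "const_regs R'" "R' 3 = vertex (Suc k) m" "R' 4 \<le> F"
          using R' inv R3 c by (simp_all add: const_regs_def)
        then show "update_inv A A' M0 p d k (R'(3 := word_of b (int (vertex k (m * 2 ^ \<beta> + R' 4))))) M'"
          unfolding update_inv_def
          using R' inv nodes arr k by (auto simp: const_regs_def child)
      qed
    qed (use inv R3 in \<open>simp_all add: const_regs_def\<close>)
  qed (use inv in simp_all)
qed

lemma update_ok:
  assumes ok: "mem_ok A M" and legal: "legal n b \<delta> A (Update i y)"
    and R: "R 0 = i" "R 1 = word_of b y"
  defines "enter \<equiv> prologue ;; update_start"
  shows "wpt b update_com (len enter + (D * (len update_body + 2) + 2))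
    (\<lambda>R' M'. mem_ok (A(i := y)) M') R M"
proof -
  define A' where "A' = A(i := y)"
  define d where "d = y - A i"
  define p where "p = i - 1"
  define M1 where "M1 = M(0 := (M 0)(i := word_of b y))"
  have i: "i \<in> {1..n}" and y: "fits \<delta> y" using legal by auto
  have bd: "bounded A" and par: "params_ok M" using ok by (simp_all add: mem_ok_def)
  have A': "bounded A'"
    using bd legal unfolding bounded_def A'_def by auto
  have "fits \<delta> (A i)" using bd i by (simp add: bounded_def)
  moreover have "(2::int) ^ \<delta> = 2 * 2 ^ (\<delta> - 1)" using \<delta> by (simp add: power_eq_if)
  ultimately have d: "\<bar>d\<bar> \<le> 2 ^ \<delta>" using y unfolding d_def fits_def by linarith
  have p: "p < n" using i by (auto simp: p_def)
  have M1: "M1 j = M j" if "j \<noteq> 0" for j using that by (simp add: M1_def)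
  have M1': "M1 1 = M 1" "M1 2 = M 2" "M1 3 = M 3" "M1 4 = M 4" by (simp_all add: M1_def)
  have nodes: "node_ok A k m M1" if "node k m" for k m
    using ok that unfolding mem_ok_def node_ok_def high_node_def M1' by blast
  have "wp b enter (update_inv A A' M1 p d D) R M"
    unfolding enter_def wp.simps(2)
  proof (rule prologue_ok[OF par])
    fix R' assume R': "const_regs R'" "\<And>r. r < 20 \<Longrightarrow> R' r = R r"
    have 1: "p div 2 ^ (\<beta> * D) = 0" using p D_le by simp
    have 2: "M 0 i = word_of b (A i)" using ok i by (simp add: mem_ok_def)
    have "i < 2 ^ b" "1 \<le> i" using i n by simp_all
    then have 3: "alu_val b Sub i 1 = p" by (simp add: alu_val_diff p_def)
    have regs: "const_regs (R'(7 := word_of b d, 2 := p, 6 := \<beta> * D, 3 := Suc 0))"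
      using R'(1) by (simp add: const_regs_def)
    have "update_inv A A' M1 p d D (R'(7 := word_of b d, 2 := p, 6 := \<beta> * D, 3 := Suc 0)) M1"
      using regs nodes by (simp add: update_inv_def 1 vertex_def node_def)
    then show "wp b update_start (update_inv A A' M1 p d D) R' M"
      using R' R \<beta>D_less small(1) 2 3 alu_val_word(2)[of b y "A i"]
      by (simp add: update_start_def const_regs_def M1_def d_def)
  qed
  then have 1: "wpt b enter (len enter) (update_inv A A' M1 p d D) R M"
    by (rule wp_imp_wpt)
  have 2: "wpt b (While 21 6 update_body) (D * (len update_body + 2) + 2)
      (\<lambda>R' M'. mem_ok A' M') R M'"
    if "update_inv A A' M1 p d D R M'" for R M'
  proof -
    have "wpt b (While 21 6 update_body) (D * (len update_body + 2) + 2) (update_inv A A' M1 p d 0) R M'"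
    proof (rule wpt_While[where Inv = "update_inv A A' M1 p d"])
      fix k R M' assume *: "update_inv A A' M1 p d (Suc k) R M'"
      show "R 21 < R 6 \<and> wpt b update_body (len update_body) (update_inv A A' M1 p d k) R M'"
        using update_body_ok[OF A' i p_def A'_def d_def d *] * \<beta>
        by (auto simp: update_inv_def const_regs_def intro: wp_imp_wpt)
    next
      fix R M' assume "update_inv A A' M1 p d 0 R M'"
      then show "\<not> R 21 < R 6" by (simp add: update_inv_def const_regs_def)
    qed fact
    then show ?thesis
    proof (rule wpt_weaken)
      fix R M' assume *: "update_inv A A' M1 p d 0 R M'"
      then have arr: "M' j = M1 j" if "j \<notin> {1, 2, 3, 4}" for j using that by (simp add: update_inv_def)
      have "params_ok M'" using par arr by (simp add: params_ok_def M1)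
      moreover have "\<forall>k\<in>{1..n}. M' 0 k = word_of b (A' k)"
        using ok arr[of 0] by (simp add: mem_ok_def M1_def A'_def)
      ultimately show "mem_ok A' M'"
        using * A' by (simp add: mem_ok_def update_inv_def)
    qed simp
  qed
  show ?thesis
    unfolding update_com_def enter_def[symmetric] A'_def[symmetric]
    by (intro wpt_Seq[OF 1] 2)
qed

lemma mem_ok_zero:
  assumes "params_ok M" "\<And>j a. j < 10 \<Longrightarrow> M j a = 0"
  shows "mem_ok (\<lambda>_. 0) M"
proof -
  have [simp]: "psum (\<lambda>_. 0) t = 0" for t by (simp add: psum_def)
  have [simp]: "S (\<lambda>_. 0) s m i = 0" for s m i by (simp add: S_def pre_def)
  have [simp]: "pack w F (\<lambda>_. 0) = 0" by (simp add: pack_def)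
  have "high_node (\<lambda>_. 0) k m M (\<lambda>_. 0) (\<lambda>_. 0)" for k m
    using F_ge assms(2) by (simp add: high_node_def)
  then have "node_ok (\<lambda>_. 0) k m M" for k m
    using assms(2) by (auto simp: node_ok_def)
  then show ?thesis
    using assms by (simp add: mem_ok_def bounded_def fits_def)
qed

lemma init_tree_ok:
  assumes R: "R 0 = n" "R 20 = 1" "R 21 = 0" "R 5 = \<beta>" "R 6 = w" "R 7 = thr" and M: "\<And>j a. M j a = 0"
  shows "\<exists>t. wpt b init_tree t (\<lambda>R' M'. mem_ok (\<lambda>_. 0) M') R M"
proof -
  define Base where "Base R \<longleftrightarrow> R 0 = n \<and> R 20 = 1 \<and> R 21 = 0 \<and> R 5 = \<beta> \<and> R 6 = w" for R :: registers
  define MI where "MI M' \<longleftrightarrow> M' 10 0 = \<beta> \<and> M' 11 0 = w \<and> M' 12 0 = thr \<and> (\<forall>j<10. \<forall>a. M' j a = 0)"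
    for M' :: memory
  define I1 where "I1 k R M' \<longleftrightarrow> Base R \<and> MI M' \<and> k \<le> F \<and> R 8 = k \<and> R 9 = word_of b (pack w (F - k) (\<lambda>_. 1))"
    for k R M'
  define I2 where "I2 k R M' \<longleftrightarrow> Base R \<and> MI M' \<and> M' 13 0 = word_of b (pack w F (\<lambda>_. 1)) \<and> k \<le> D \<and>
    R 10 = n - 1 \<and> R 11 = \<beta> * (D - k) \<and> R 12 = (n - 1) div 2 ^ (\<beta> * (D - k))" for k R M'
  let ?a = "Do [Store 10 21 5, Store 11 21 6, Store 12 21 7, Alu Shl 8 20 5, Alu Sub 8 8 20, Const 9 0]"
  let ?b = "Do [Alu Shl 9 9 6, Alu Add 9 9 20, Alu Sub 8 8 20]"
  let ?c = "Do [Store 13 21 9, Alu Sub 10 0 20, Const 11 0, Alu Add 12 10 21]"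
  let ?d = "Do [Alu Add 11 11 5, Alu Shr 12 10 11]"
  let ?e = "Do [Store 14 21 11]"
  have 1: "wpt b ?a (len ?a) (I1 F) R M"
    by (rule wp_imp_wpt)
      (use R M in \<open>simp add: I1_def Base_def MI_def alu_val_1[simplified] word_of_F\<close>)
  have 2: "wpt b (While 21 8 ?b) (F * (len ?b + 2) + 2) (I1 0) R M" if "I1 F R M" for R M
  proof (rule wpt_While[where Inv = I1])
    fix k R M' assume *: "I1 (Suc k) R M'"
    then have "Suc k \<le> F" by (simp add: I1_def)
    then have "F - k = Suc (F - Suc k)" by arith
    then have "pack w (F - k) (\<lambda>_. 1) = pack w (F - Suc k) (\<lambda>_. 1) * 2 ^ w + 1"
      by (simp add: pack_Suc)
    moreover have "alu_val b Sub (Suc k) 1 = k" using * small(4) by (simp add: I1_def alu_val_diff)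
    ultimately have "wp b ?b (I1 k) R M'"
      using * by (simp add: I1_def Base_def alu_val_word alu_val_1[simplified])
    moreover have "R 21 < R 8" using * by (simp add: I1_def Base_def)
    ultimately show "R 21 < R 8 \<and> wpt b ?b (len ?b) (I1 k) R M'"
      by (intro conjI wp_imp_wpt)
  qed (use that in \<open>simp_all add: I1_def Base_def\<close>)
  have 3: "wpt b ?c (len ?c) (I2 D) R M" if "I1 0 R M" for R M
  proof (rule wp_imp_wpt)
    have "alu_val b Sub n 1 = n - 1" using n by (simp add: alu_val_diff)
    then show "wp b ?c (I2 D) R M"
      using that n by (simp add: I1_def I2_def Base_def MI_def)
  qed
  have 4: "wpt b (While 21 12 ?d) (D * (len ?d + 2) + 2) (I2 0) R M" if "I2 D R M" for R M
  proof (rule wpt_While[where Inv = I2])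
    fix k R M' assume *: "I2 (Suc k) R M'"
    then have k: "k < D" by (simp add: I2_def)
    have "\<beta> * (D - Suc k) + \<beta> = \<beta> * Suc (D - Suc k)" by simp
    also have "Suc (D - Suc k) = D - k" using k by simp
    finally have e: "\<beta> * (D - Suc k) + \<beta> = \<beta> * (D - k)" .
    have "\<beta> * (D - k) \<le> \<beta> * D" by (intro mult_le_mono2) simp
    then have "\<beta> * (D - k) < 2 ^ b" using \<beta>D_less by linarith
    then have "alu_val b Add (\<beta> * (D - Suc k)) \<beta> = \<beta> * (D - k)"
      by (subst alu_val_add) (simp_all only: e)
    moreover have "alu_val b Shr (n - 1) (\<beta> * (D - k)) = (n - 1) div 2 ^ (\<beta> * (D - k))"
      using n by (simp add: alu_val_shr)
    ultimately have "wp b ?d (I2 k) R M'"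
      using * by (simp add: I2_def Base_def)
    moreover have "(2::nat) ^ (\<beta> * (D - Suc k)) \<le> 2 ^ (\<beta> * (D - 1))"
      by (intro power_increasing mult_le_mono2) auto
    then have "2 ^ (\<beta> * (D - Suc k)) \<le> n - 1" using D_ge k by linarith
    then have "0 < (n - 1) div 2 ^ (\<beta> * (D - Suc k))" by (simp add: div_greater_zero_iff)
    then have "R 21 < R 12" using * by (simp add: I2_def Base_def)
    ultimately show "R 21 < R 12 \<and> wpt b ?d (len ?d) (I2 k) R M'"
      by (intro conjI wp_imp_wpt)
  next
    have "(n - 1) div 2 ^ (\<beta> * D) = 0" using D_le n by simp
    then show "\<not> R 21 < R 12" if "I2 0 R M" for R M
      using that by (simp add: I2_def Base_def)
  qed (use that in simp)
  have 5: "wpt b ?e (len ?e) (\<lambda>R' M'. mem_ok (\<lambda>_. 0) M') R M" if "I2 0 R M" for R M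
  proof (rule wp_imp_wpt)
    have "mem_ok (\<lambda>_. 0) (M(14 := (M 14)(0 := \<beta> * D)))"
      by (rule mem_ok_zero) (use that in \<open>simp_all add: I2_def MI_def params_ok_def\<close>)
    then show "wp b ?e (\<lambda>R' M'. mem_ok (\<lambda>_. 0) M') R M"
      using that by (simp add: I2_def Base_def)
  qed
  show ?thesis
    unfolding init_tree_def
    by (intro exI) (rule wpt_Seq[OF 1] wpt_Seq[OF 2] wpt_Seq[OF 3] wpt_Seq[OF 4] 5 | assumption)+
qed

end

text \<open>
  If a machine word cannot hold the \<open>2 ^ \<beta> - 1\<close> fields of a node even for \<open>\<beta> = 1\<close>, then
  \<open>lg (b / \<delta>)\<close> is bounded and a binary tree with one full word per node suffices.
\<close>

lemma init_width_ok:
  assumes n: "1 \<le> n" "n < 2 ^ b" and \<delta>: "1 \<le> \<delta>" "\<delta> \<le> b"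
    and R: "R 0 = n" "R 1 = b" "R 2 = \<delta>"
  shows "\<exists>\<beta> w thr D F. tree n b \<delta> \<beta> w thr D F \<and> b < 2 ^ (\<beta> + 2) * (\<delta> + \<beta> + 1) \<and>
    (\<exists>t. wpt b init_width t (\<lambda>R' M'. M' = M \<and> R' 0 = n \<and> R' 20 = 1 \<and> R' 21 = 0 \<and>
      R' 5 = \<beta> \<and> R' 6 = w \<and> R' 7 = thr) R M)"
proof -
  let ?fits = "\<lambda>\<beta>. \<delta> + \<beta> < b div 2 ^ (\<beta> + 2)"
  define j where "j = (LEAST \<beta>. \<not> ?fits \<beta>)"
  \<comment> \<open>The search ends: at \<open>b\<close> itself the quotient vanishes, so a least
    failing value exists.\<close>
  have "b div 2 ^ (b + 2) = 0"
    by (rule div_less, rule less_le_trans[OF less_exp power_increasing]) auto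
  then have "\<not> ?fits b" by simp
  then have j: "\<not> ?fits j" unfolding j_def by (rule LeastI)
  have less: "?fits i" if "i < j" for i
    using not_less_Least[of i "\<lambda>\<beta>. \<not> ?fits \<beta>"] that by (auto simp: j_def)
  have b: "b < 2 ^ b" by (rule less_exp)
  have \<delta>i: "\<delta> + i \<le> b" if "i \<le> j" for i
  proof (cases i)
    case (Suc i')
    then have "\<delta> + i' < b div 2 ^ (i' + 2)" using less that by simp
    also have "\<dots> \<le> b" by simp
    finally show ?thesis using Suc by simp
  qed (use \<delta> in simp)
  define \<beta> where "\<beta> = (if j = 0 then 1 else j)"
  define w where "w = (if j = 0 then b else 2 * (\<delta> + j))"
  define thr where "thr = (if j = 0 then b else \<delta> + j)"
  define D where "D = (LEAST D. n \<le> 2 ^ (\<beta> * D))"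
  have \<beta>: "1 \<le> \<beta>" by (simp add: \<beta>_def)
  have "n \<le> 2 ^ (\<beta> * n)"
  proof -
    have "n < 2 ^ n" by (rule less_exp)
    also have "\<dots> \<le> 2 ^ (\<beta> * n)" using \<beta> by (intro power_increasing) auto
    finally show ?thesis by simp
  qed
  then have D_le: "n \<le> 2 ^ (\<beta> * D)" unfolding D_def by (rule LeastI)
  have D_ge: "2 ^ (\<beta> * (D - 1)) < n" if "0 < D"
    using not_less_Least[of "D - 1" "\<lambda>D. n \<le> 2 ^ (\<beta> * D)"] that by (auto simp: D_def)
  have wide: "2 ^ j * (2 * (\<delta> + j)) \<le> b" if "j \<noteq> 0"
  proof -
    have "\<delta> + j \<le> b div 2 ^ (j + 1)"
      using less[of "j - 1"] that by (cases j) simp_all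
    then have "(\<delta> + j) * 2 ^ (j + 1) \<le> b" by (simp add: less_eq_div_iff_mult_less_eq)
    then show ?thesis by (simp add: algebra_simps)
  qed
  have "tree n b \<delta> \<beta> w thr D (2 ^ \<beta> - 1)"
    using n \<delta> \<beta> D_le D_ge wide by unfold_locales (auto simp: \<beta>_def w_def thr_def)
  moreover have "b < 2 ^ (\<beta> + 2) * (\<delta> + \<beta> + 1)"
  proof -
    have "b div 2 ^ (j + 2) < \<delta> + j + 1" using j by simp
    then have "b < (\<delta> + j + 1) * 2 ^ (j + 2)" by (simp add: div_less_iff_less_mult)
    also have "\<dots> \<le> (\<delta> + \<beta> + 1) * 2 ^ (\<beta> + 2)"
      by (intro mult_le_mono power_increasing) (auto simp: \<beta>_def)
    finally show ?thesis by (simp add: mult.commute)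
  qed
  moreover have "\<exists>t. wpt b init_width t (\<lambda>R' M'. M' = M \<and> R' 0 = n \<and> R' 20 = 1 \<and> R' 21 = 0 \<and>
      R' 5 = \<beta> \<and> R' 6 = w \<and> R' 7 = thr) R M"
  proof -
    define I where "I k R M' \<longleftrightarrow> M' = M \<and> R 0 = n \<and> R 1 = b \<and> R 2 = \<delta> \<and> R 20 = 1 \<and> R 21 = 0 \<and>
      k \<le> j \<and> R 3 = \<delta> + (j - k) \<and> R 4 = b div 2 ^ (j - k + 2)" for k and R :: registers and M'
    let ?a = "Do [Const 20 1, Const 21 0, Alu Add 3 2 21, Alu Shr 4 1 20, Alu Shr 4 4 20]"
    let ?b = "Do [Alu Add 3 3 20, Alu Shr 4 4 20]"
    let ?c = "Cond 2 3 (Do [Alu Sub 5 3 2, Alu Add 6 3 3, Alu Add 7 3 21])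
       (Do [Const 5 1, Alu Add 6 1 21, Alu Add 7 1 21])"
    have one: "take_bit b (Suc 0) = 1" "b \<noteq> 0" using \<delta> b by (simp_all add: take_bit_nat_eq_self)
    have half: "alu_val b Shr (b div x) 1 = b div (x * 2)" for x
    proof -
      have "b div x < 2 ^ b" using b by (meson div_le_dividend le_less_trans)
      then show ?thesis by (simp add: alu_val_shr div_mult2_eq)
    qed
    have 1: "wpt b ?a (len ?a) (I j) R M"
    proof (rule wp_imp_wpt)
      have "\<delta> < 2 ^ b" using \<delta> b by linarith
      then have "alu_val b Add \<delta> 0 = \<delta>" by (subst alu_val_add) simp_all
      then show "wp b ?a (I j) R M"
        using R one half[of 1] half[of 2] by (simp add: I_def)
    qed
    have 2: "wpt b (While 3 4 ?b) (j * (len ?b + 2) + 2) (I 0) R M'" if "I j R M'" for R M'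
    proof (rule wpt_While[where Inv = I])
      fix k R M' assume *: "I (Suc k) R M'"
      then have k: "Suc k \<le> j" by (simp add: I_def)
      have s: "j - k = Suc (j - Suc k)" using k by simp
      have "\<delta> + (j - k) \<le> b" by (rule \<delta>i) simp
      then have "\<delta> + (j - Suc k) + 1 < 2 ^ b" using b s by linarith
      then have "alu_val b Add (\<delta> + (j - Suc k)) 1 = \<delta> + (j - k)"
        by (subst alu_val_add) (simp_all only: s add.assoc Suc_eq_plus1)
      moreover have "alu_val b Shr (b div 2 ^ (j - Suc k + 2)) 1 = b div 2 ^ (j - k + 2)"
        unfolding half by (simp add: s mult.commute)
      ultimately have "wp b ?b (I k) R M'" using * by (simp add: I_def)
      moreover have "R 3 < R 4" using * less[of "j - Suc k"] k by (simp add: I_def)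
      ultimately show "R 3 < R 4 \<and> wpt b ?b (len ?b) (I k) R M'"
        by (intro conjI wp_imp_wpt)
    next
      show "\<not> R 3 < R 4" if "I 0 R M'" for R M' using that j by (simp add: I_def)
    qed fact
    have 3: "wpt b ?c (len ?c) (\<lambda>R' M'. M' = M \<and> R' 0 = n \<and> R' 20 = 1 \<and> R' 21 = 0 \<and>
      R' 5 = \<beta> \<and> R' 6 = w \<and> R' 7 = thr) R M'" if "I 0 R M'" for R M'
    proof (rule wp_imp_wpt)
      have "\<delta> + j < 2 ^ b" using \<delta>i[of j] b by linarith
      then have "alu_val b Sub (\<delta> + j) \<delta> = j" "alu_val b Add (\<delta> + j) 0 = \<delta> + j"
        by (simp_all add: alu_val_diff alu_val_add)
      moreover have "j \<noteq> 0 \<Longrightarrow> \<delta> + j + (\<delta> + j) < 2 ^ b"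
      proof -
        assume "j \<noteq> 0"
        have "2 * (\<delta> + j) \<le> 2 ^ j * (2 * (\<delta> + j))" by simp
        from le_less_trans[OF le_trans[OF this wide[OF \<open>j \<noteq> 0\<close>]] b] show ?thesis
          by (simp only: mult_2)
      qed
      ultimately show "wp b ?c (\<lambda>R' M'. M' = M \<and> R' 0 = n \<and> R' 20 = 1 \<and> R' 21 = 0 \<and>
          R' 5 = \<beta> \<and> R' 6 = w \<and> R' 7 = thr) R M'"
        using that one b by (simp add: I_def \<beta>_def w_def thr_def alu_val_add)
    qed
    show ?thesis
      unfolding init_width_def
      by (intro exI) (rule wpt_Seq[OF 1] wpt_Seq[OF 2] 3 | assumption)+
  qed
  ultimately show ?thesis by blast
qed


section \<open>Running times\<close>

definition B_tree :: data_structure where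
  "B_tree =
     \<lparr>init_prog = compile 0 init_com, update_prog = compile 0 update_com,
      sum_prog = compile 0 sum_com, select_prog = compile 0 select_com\<rparr>"

text \<open>The three operations are added up so that one constant dominates each; being made of
  code lengths, it is independent of the parameters.\<close>

definition op_cost :: nat where
  "op_cost = len (prologue ;; update_start) + (len update_body + 2) + 2
     + (len (prologue ;; sum_start) + (len sum_body + 2) + 2 + len (Do [Alu Add 0 8 21]))
     + (len (prologue ;; Do [Alu Add 6 32 21, Alu Add 3 20 21]) + (len select_body + 2) + 2
        + len (Do [Alu Shl 100 20 32, Alu Sub 0 3 100, Alu Add 0 0 20]))"

lemma loop_cost:
  fixes a c e k K :: nat
  assumes "a + c + 2 + e \<le> K"
  shows "a + ((k * c + 2) + e) \<le> K * (k + 1)"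
proof -
  have "a + ((k * c + 2) + e) \<le> (a + c + 2 + e) * (k + 1)" by (simp add: algebra_simps)
  also have "\<dots> \<le> K * (k + 1)" using assms by (rule mult_le_mono1)
  finally show ?thesis .
qed

context tree
begin

lemma operation_ok:
  assumes ok: "mem_ok A M" and legal: "legal n b \<delta> A opn"
  shows "\<exists>t s. t \<le> op_cost * (D + 1) \<and> halts b (prog_of B_tree opn) (arguments b opn) M t s \<and>
    answer n b A opn (regs s 0) \<and> mem_ok (apply_op opn A) (mem s)"
proof -
  let ?R = "\<lambda>i. if i < length (arguments b opn) then arguments b opn ! i else 0"
  have "\<exists>c t. t \<le> op_cost * (D + 1) \<and> prog_of B_tree opn = compile 0 c \<and>
    wpt b c t (\<lambda>R' M'. answer n b A opn (R' 0) \<and> mem_ok (apply_op opn A) M') ?R M"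
  proof (cases opn)
    case (Update i y)
    have "wpt b update_com (len (prologue ;; update_start) + (D * (len update_body + 2) + 2))
        (\<lambda>R' M'. mem_ok (A(i := y)) M') ?R M"
      by (rule update_ok[OF ok]) (use legal Update in simp_all)
    moreover have "len (prologue ;; update_start) + (D * (len update_body + 2) + 2) \<le> op_cost * (D + 1)"
      by (rule loop_cost[where e = 0, simplified add_0_right]) (unfold op_cost_def, linarith)
    ultimately show ?thesis
      unfolding Update by (intro exI[of _ update_com] exI conjI) (auto simp: B_tree_def)
  next
    case (Sum k)
    have "wpt b sum_com (len (prologue ;; sum_start) +
          ((D * (len sum_body + 2) + 2) + len (Do [Alu Add 0 8 21])))
        (\<lambda>R' M'. M' = M \<and> R' 0 = word_of b (psum A k)) ?R M"
      by (rule sum_ok[OF ok]) (use legal Sum in simp_all)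
    then have "wpt b sum_com (len (prologue ;; sum_start) +
          ((D * (len sum_body + 2) + 2) + len (Do [Alu Add 0 8 21])))
        (\<lambda>R' M'. answer n b A opn (R' 0) \<and> mem_ok (apply_op opn A) M') ?R M"
      by (rule wpt_weaken) (use ok Sum in auto)
    moreover have "len (prologue ;; sum_start) +
          ((D * (len sum_body + 2) + 2) + len (Do [Alu Add 0 8 21])) \<le> op_cost * (D + 1)"
      by (rule loop_cost) (unfold op_cost_def, linarith)
    ultimately show ?thesis
      unfolding Sum by (intro exI[of _ sum_com] exI conjI) (auto simp: B_tree_def)
  next
    case (Select \<sigma>)
    let ?t = "len (prologue ;; Do [Alu Add 6 32 21, Alu Add 3 20 21]) +
      ((D * (len select_body + 2) + 2) + len (Do [Alu Shl 100 20 32, Alu Sub 0 3 100, Alu Add 0 0 20]))"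
    have "wpt b select_com ?t
        (\<lambda>R' M'. M' = M \<and> R' 0 \<in> {1..n} \<and> psum A (R' 0 - 1) < \<sigma> \<and> \<sigma> \<le> psum A (R' 0)) ?R M"
      by (rule select_ok[OF ok]) (use legal Select in \<open>simp_all add: positive_def\<close>)
    then have "wpt b select_com ?t
        (\<lambda>R' M'. answer n b A opn (R' 0) \<and> mem_ok (apply_op opn A) M') ?R M"
      by (rule wpt_weaken) (use ok Select in auto)
    moreover have "?t \<le> op_cost * (D + 1)"
      by (rule loop_cost) (unfold op_cost_def, linarith)
    ultimately show ?thesis
      unfolding Select by (intro exI[of _ select_com] exI conjI) (auto simp: B_tree_def)
  qed
  then obtain c t where c: "t \<le> op_cost * (D + 1)" "prog_of B_tree opn = compile 0 c"
    "wpt b c t (\<lambda>R' M'. answer n b A opn (R' 0) \<and> mem_ok (apply_op opn A) M') ?R M"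
    by blast
  from wpt_halts[OF c(3) refl] c(1,2) show ?thesis by (metis le_trans)
qed

lemma reachable_ok:
  assumes init: "halts b (init_prog B_tree) [n, b, \<delta>] (\<lambda>_ _. 0) t s" "mem_ok (\<lambda>_. 0) (mem s)"
    and "reachable B_tree n b \<delta> A M"
  shows "mem_ok A M"
  using assms(3)
proof induction
  case (initial t' s')
  then show ?case using halts_unique[OF init(1)] init(2) by blast
next
  case (operate A M opn t' s')
  from operation_ok[OF operate.IH operate.hyps(2)]
  obtain t'' s'' where "halts b (prog_of B_tree opn) (arguments b opn) M t'' s''"
    "mem_ok (apply_op opn A) (mem s'')" by blast
  then show ?case using halts_unique[OF operate.hyps(3)] by blast
qed

text \<open>The hypothesis gives \<open>b \<le> 2 ^ (2 * \<beta> + 3) * \<delta>\<close>, hence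
  \<open>lg (b / \<delta>) \<le> 2 * \<beta> + 4 \<le> 6 * \<beta>\<close>. With
  \<open>\<beta> * (D - 1) \<le> lg n\<close> this bounds \<open>D - 1\<close> by 6 times the
  quotient; the remaining 2 is absorbed by the maximum with 1, and \<open>6 + 2 = 8\<close>.\<close>

lemma depth_bound:
  assumes "b < 2 ^ (\<beta> + 2) * (\<delta> + \<beta> + 1)"
  shows "real (D + 1) \<le> 8 * time_bound n b \<delta>"
proof -
  have \<delta>': "0 < real \<delta>" using \<delta> by simp
  have le: "\<beta> + 2 \<le> 2 ^ (\<beta> + 1)"
    using less_exp[of "\<beta> + 1"] by simp
  have "1 * (\<beta> + 1) \<le> \<delta> * (\<beta> + 1)" using \<delta> by (intro mult_le_mono1)
  then have "\<delta> + \<beta> + 1 \<le> \<delta> * (\<beta> + 2)" by simp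
  then have "b < 2 ^ (\<beta> + 2) * (\<delta> * (\<beta> + 2))"
    using assms by (meson less_le_trans mult_le_mono2)
  also have "\<dots> \<le> 2 ^ (\<beta> + 2) * (\<delta> * 2 ^ (\<beta> + 1))" using le by (intro mult_le_mono2)
  also have "\<dots> = 2 ^ (2 * \<beta> + 3) * \<delta>" proof -
    have "2 * \<beta> + 3 = (\<beta> + 2) + (\<beta> + 1)" by simp
    then show ?thesis by (simp only: power_add ac_simps)
  qed
  finally have "real b \<le> real (2 ^ (2 * \<beta> + 3) * \<delta>)"
    unfolding of_nat_le_iff by (rule less_imp_le)
  then have "real b \<le> 2 ^ (2 * \<beta> + 3) * real \<delta>" by simp
  then have "real b / real \<delta> \<le> 2 ^ (2 * \<beta> + 3)"
    using \<delta>' by (simp add: divide_le_eq)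
  moreover have "(2::real) \<le> 2 ^ (2 * \<beta> + 3)"
    using power_increasing[of 1 "2 * \<beta> + 3" "2::real"] by simp
  moreover have "(2::real) ^ (2 * \<beta> + 4) = 2 ^ (2 * \<beta> + 3) + 2 ^ (2 * \<beta> + 3)" by (simp add: power_add)
  ultimately have "2 + real b / real \<delta> \<le> 2 ^ (2 * \<beta> + 4)" by linarith
  then have "lg (real b / real \<delta>) \<le> log 2 (2 ^ (2 * \<beta> + 4))"
    unfolding lg_def using \<delta>' by (intro log_mono) (auto intro: add_pos_nonneg)
  also have "\<dots> = real (2 * \<beta> + 4)" by (simp only: log_pow_cancel)
  also have "\<dots> \<le> 6 * real \<beta>" using \<beta> by simp
  finally have lg: "lg (real b / real \<delta>) \<le> 6 * real \<beta>" .
  have lg_pos: "0 < lg (real b / real \<delta>)"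
    unfolding lg_def using \<delta>' by (intro zero_less_log_cancel_iff[THEN iffD2]) (auto intro: add_pos_nonneg add_strict_increasing)
  have tb: "1 \<le> time_bound n b \<delta>" "lg (real n) / lg (real b / real \<delta>) \<le> time_bound n b \<delta>"
    by (simp_all add: time_bound_def)
  show ?thesis
  proof (cases "D = 0")
    case False
    have "2 ^ (\<beta> * (D - 1)) \<le> n" using D_ge False by simp
    then have "real (2 ^ (\<beta> * (D - 1))) \<le> real n" by (simp only: of_nat_le_iff)
    moreover have "real (2 ^ (\<beta> * (D - 1))) = 2 ^ (\<beta> * (D - 1))" by simp
    ultimately have "2 ^ (\<beta> * (D - 1)) \<le> 2 + real n" by linarith
    then have "log 2 (2 ^ (\<beta> * (D - 1))) \<le> lg (real n)"
      unfolding lg_def by (intro log_mono) auto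
    then have "real (\<beta> * (D - 1)) \<le> lg (real n)" by (simp only: log_pow_cancel)
    then have "real \<beta> * real (D - 1) \<le> lg (real n)" by simp
    moreover have "lg (real b / real \<delta>) * real (D - 1) \<le> 6 * real \<beta> * real (D - 1)"
      using lg by (intro mult_right_mono) auto
    ultimately have "lg (real b / real \<delta>) * real (D - 1) \<le> 6 * lg (real n)" by linarith
    then have "real (D - 1) \<le> 6 * (lg (real n) / lg (real b / real \<delta>))"
      using lg_pos by (simp add: pos_le_divide_eq mult.commute)
    moreover have "real (D + 1) = real (D - 1) + 2" using False by simp
    ultimately show ?thesis using tb by linarith
  qed (use tb in simp)
qed

end

lemma solves:
  assumes "(n, b, \<delta>) \<in> parameters"
  defines "T \<equiv> nat \<lfloor>8 * real op_cost * time_bound n b \<delta>\<rfloor>"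
  shows "solves_partial_sums B_tree n b \<delta> T T T"
proof -
  have n: "1 \<le> n" "n < 2 ^ b" and \<delta>: "1 \<le> \<delta>" "\<delta> \<le> b" using assms(1) by (auto simp: parameters_def)
  let ?R = "\<lambda>i. if i < length [n, b, \<delta>] then [n, b, \<delta>] ! i else 0"
  let ?M = "\<lambda>_ _. 0"
  have R: "?R 0 = n" "?R 1 = b" "?R 2 = \<delta>" by simp_all
  obtain \<beta> w thr D F t1 where tree: "tree n b \<delta> \<beta> w thr D F" "b < 2 ^ (\<beta> + 2) * (\<delta> + \<beta> + 1)"
    and t1: "wpt b init_width t1 (\<lambda>R' M'. M' = ?M \<and> R' 0 = n \<and> R' 20 = 1 \<and> R' 21 = 0 \<and>
      R' 5 = \<beta> \<and> R' 6 = w \<and> R' 7 = thr) ?R ?M"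
    using init_width_ok[OF n \<delta> R, of ?M] by blast
  interpret tree n b \<delta> \<beta> w thr D F by fact
  have "\<exists>t. wpt b init_com t (\<lambda>R' M'. mem_ok (\<lambda>_. 0) M') ?R ?M"
    unfolding init_com_def
    by (rule wpt_Seq_ex[OF t1], rule init_tree_ok) auto
  then obtain t2 where "wpt b init_com t2 (\<lambda>R' M'. mem_ok (\<lambda>_. 0) M') ?R ?M" by blast
  from wpt_halts[OF this refl]
  obtain t s where init: "halts b (init_prog B_tree) [n, b, \<delta>] ?M t s" "mem_ok (\<lambda>_. 0) (mem s)"
    by (auto simp: B_tree_def)
  have "real (op_cost * (D + 1)) \<le> 8 * real op_cost * time_bound n b \<delta>"
    using mult_left_mono[OF depth_bound[OF tree(2)], of "real op_cost"] by (simp add: algebra_simps)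
  then have T: "op_cost * (D + 1) \<le> T" unfolding T_def by (simp add: le_nat_floor)
  have "\<exists>t s. t \<le> time_of T T T opn \<and> halts b (prog_of B_tree opn) (arguments b opn) M t s \<and>
      answer n b A opn (regs s 0)"
    if "reachable B_tree n b \<delta> A M" "legal n b \<delta> A opn" for A M opn
  proof -
    have "time_of T T T opn = T" by (cases opn) simp_all
    then show ?thesis
      using operation_ok[OF reachable_ok[OF init that(1)] that(2)] T le_trans by metis
  qed
  then show ?thesis unfolding solves_partial_sums_def using init(1) by blast
qed

theorem theorem2p3:
  "\<exists>D tu tq ts.
     (\<forall>(n, b, \<delta>)\<in>parameters.
        solves_partial_sums D n b \<delta> (tu (n, b, \<delta>)) (tq (n, b, \<delta>)) (ts (n, b, \<delta>))) \<and>
     (\<forall>t\<in>{tu, tq, ts}.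
        (\<lambda>p. real (t p)) \<in> O[principal parameters](\<lambda>(n, b, \<delta>). time_bound n b \<delta>))"
proof -
  define T where "T = (\<lambda>(n, b, \<delta>). nat \<lfloor>8 * real op_cost * time_bound n b \<delta>\<rfloor>)"
  have "(\<lambda>p. real (T p)) \<in> O[principal parameters](\<lambda>(n, b, \<delta>). time_bound n b \<delta>)"
  \<comment> \<open>The summand 1 makes the constant positive without evaluating
    \<open>op_cost\<close>.\<close>
  proof (rule landau_o.bigI[of "8 * real op_cost + 1"])
    have "real (T (n, b, \<delta>)) \<le> (8 * real op_cost + 1) * time_bound n b \<delta>" for n b \<delta>
    proof -
      have tb: "1 \<le> time_bound n b \<delta>" by (simp add: time_bound_def)
      then have "0 \<le> 8 * real op_cost * time_bound n b \<delta>" by simp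
      then have "real (T (n, b, \<delta>)) \<le> 8 * real op_cost * time_bound n b \<delta>"
        by (simp add: T_def)
      then show ?thesis using tb by (simp add: distrib_right)
    qed
    moreover have "0 \<le> time_bound n b \<delta>" for n b \<delta> by (simp add: time_bound_def)
    ultimately show "\<forall>\<^sub>F p in principal parameters. norm (real (T p)) \<le>
        (8 * real op_cost + 1) * norm (case p of (n, b, \<delta>) \<Rightarrow> time_bound n b \<delta>)"
      by (auto simp: eventually_principal)
  qed simp
  moreover have "\<forall>(n, b, \<delta>)\<in>parameters.
      solves_partial_sums B_tree n b \<delta> (T (n, b, \<delta>)) (T (n, b, \<delta>)) (T (n, b, \<delta>))"
    using solves by (auto simp: T_def)
  ultimately show ?thesis by (intro exI[of _ B_tree] exI[of _ T]) simp
qed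

end
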